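(* Let $n,m\ge 1$ be integers, $\mu>0$ and $\nu>-1$. Let $D_{n,m}(\mu)=\{(z,w)\in\mathbb{C}^n\times\mathbb{C}^m:\|w\|^2<e^{-\mu\|z\|^2}\}$ be endowed with the Kähler metric $g(\mu;\nu)$ whose Kähler form is $\omega(\mu;\nu)=\frac{\sqrt{-1}}{2\pi}\partial\bar\partial\Phi$, where $\Phi(z,w)=\nu\mu\|z\|^2-\ln\left(e^{-\mu\|z\|^2}-\|w\|^2\right)$. Then for $\alpha>0$, the metric $\alpha g(\mu;\nu)$ on $D_{n,m}(\mu)$ is balanced if and only if $\alpha>m+n$, $n=1$ and $\nu=-\frac{1}{m+1}$.
   Context: $\|\cdot\|$ denotes the standard Hermitian norm. For $\alpha>0$, let $\mathcal{H}_\alpha$ be the weighted Hilbert space of holomorphic functions $f$ on $D_{n,m}(\mu)$ with $\int_{D_{n,m}(\mu)}|f|^2 e^{-\alpha\Phi}\frac{\omega(\mu;\nu)^{n+m}}{(n+m)!}<\infty$, with the corresponding inner product. When $\mathcal{H}_\alpha\neq\{0\}$, let $K_\alpha(Z,\bar Z)$ be its reproducing (Bergman) kernel evaluated on the diagonal, and define the Rawnsley $\varepsilon$-function $\varepsilon_{(\alpha,g(\mu;\nu))}(Z)=e^{-\alpha\Phi(Z)}K_\alpha(Z,\bar Z)$ for $Z\in D_{n,m}(\mu)$. The metric $\alpha g(\mu;\nu)$ is called balanced if $\mathcal{H}_\alpha\ne\{0\}$ and $\varepsilon_{(\alpha,g(\mu;\nu))}$ is a positive constant on $D_{n,m}(\mu)$.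 *)

theory Defs
  imports "HOL-Analysis.Analysis"
begin

text \<open>Points of C^N = C^n x C^m are extensional functions on the index set {..<N}
  (coordinates 0..n-1 are z, coordinates n..n+m-1 are w), i.e. elements of
  PiE {..<N} (\<lambda>_. UNIV); Lebesgue measure on C^N is the product of lborel on complex.\<close>

definition cspace :: "nat \<Rightarrow> (nat \<Rightarrow> complex) set" where
  "cspace N = PiE {..<N} (\<lambda>_. UNIV)"

definition lebesgue_CN :: "nat \<Rightarrow> (nat \<Rightarrow> complex) measure" where
  "lebesgue_CN N = PiM {..<N} (\<lambda>_. lborel)"

text \<open>Holomorphic functions of several complex variables on an open set U of C^N:
  continuous and holomorphic in each variable separately (Osgood).\<close>
definition holo_several :: "nat \<Rightarrow> (nat \<Rightarrow> complex) set \<Rightarrow> ((nat \<Rightarrow> complex) \<Rightarrow> complex) \<Rightarrow> bool" where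
  "holo_several N U f \<longleftrightarrow> continuous_on U f \<and>
     (\<forall>Z\<in>U. \<forall>i<N. (\<lambda>\<zeta>. f (Z(i := \<zeta>))) field_differentiable (at (Z i)))"

definition dirderiv :: "(nat \<Rightarrow> complex) \<Rightarrow> ((nat \<Rightarrow> complex) \<Rightarrow> real) \<Rightarrow> (nat \<Rightarrow> complex) \<Rightarrow> real" where
  "dirderiv v F p = deriv (\<lambda>t::real. F (\<lambda>k. p k + of_real t * v k)) 0"

definition ex :: "nat \<Rightarrow> nat \<Rightarrow> complex" where "ex i = (\<lambda>k. if k = i then 1 else 0)"
definition ey :: "nat \<Rightarrow> nat \<Rightarrow> complex" where "ey i = (\<lambda>k. if k = i then \<i> else 0)"

text \<open>Wirtinger derivative  d^2 F / (dz_i d(conj z_j))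
  = 1/4 (dx_i dx_j + dy_i dy_j + i (dx_i dy_j - dy_i dx_j)) F.\<close>
definition levi :: "((nat \<Rightarrow> complex) \<Rightarrow> real) \<Rightarrow> nat \<Rightarrow> nat \<Rightarrow> (nat \<Rightarrow> complex) \<Rightarrow> complex" where
  "levi F i j p = (1/4) * (complex_of_real (dirderiv (ex i) (dirderiv (ex j) F) p + dirderiv (ey i) (dirderiv (ey j) F) p)
      + \<i> * complex_of_real (dirderiv (ex i) (dirderiv (ey j) F) p - dirderiv (ey i) (dirderiv (ex j) F) p))"

definition detN :: "nat \<Rightarrow> (nat \<Rightarrow> nat \<Rightarrow> complex) \<Rightarrow> complex" where
  "detN N A = (\<Sum>p | p permutes {..<N}. of_int (sign p) * (\<Prod>i<N. A i (p i)))"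

text \<open>Density of omega^N / N! w.r.t. Lebesgue measure, where omega = (sqrt(-1)/(2 pi)) ddbar F:
  omega = sum (g_ij / pi) (i/2) dz_i ^ d(conj z_j), so omega^N/N! = pi^(-N) det(g) dV.\<close>
definition kahler_vol :: "nat \<Rightarrow> ((nat \<Rightarrow> complex) \<Rightarrow> real) \<Rightarrow> (nat \<Rightarrow> complex) \<Rightarrow> real" where
  "kahler_vol N F p = Re (detN N (\<lambda>i j. levi F i j p)) / pi ^ N"

definition znorm2 :: "nat \<Rightarrow> (nat \<Rightarrow> complex) \<Rightarrow> real" where
  "znorm2 n Z = (\<Sum>i<n. (cmod (Z i))^2)"
definition wnorm2 :: "nat \<Rightarrow> nat \<Rightarrow> (nat \<Rightarrow> complex) \<Rightarrow> real" where
  "wnorm2 n m Z = (\<Sum>i<m. (cmod (Z (n + i)))^2)"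

definition Dom :: "nat \<Rightarrow> nat \<Rightarrow> real \<Rightarrow> (nat \<Rightarrow> complex) set" where
  "Dom n m \<mu> = {Z \<in> cspace (n + m). wnorm2 n m Z < exp (- \<mu> * znorm2 n Z)}"

definition Phi :: "nat \<Rightarrow> nat \<Rightarrow> real \<Rightarrow> real \<Rightarrow> (nat \<Rightarrow> complex) \<Rightarrow> real" where
  "Phi n m \<mu> \<nu> Z = \<nu> * \<mu> * znorm2 n Z - ln (exp (- \<mu> * znorm2 n Z) - wnorm2 n m Z)"

definition wgt :: "nat \<Rightarrow> nat \<Rightarrow> real \<Rightarrow> real \<Rightarrow> real \<Rightarrow> (nat \<Rightarrow> complex) \<Rightarrow> real" where
  "wgt n m \<mu> \<nu> \<alpha> Z = exp (- \<alpha> * Phi n m \<mu> \<nu> Z) * kahler_vol (n + m) (Phi n m \<mu> \<nu>) Z"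

definition Hspace :: "nat \<Rightarrow> nat \<Rightarrow> real \<Rightarrow> real \<Rightarrow> real \<Rightarrow> ((nat \<Rightarrow> complex) \<Rightarrow> complex) set" where
  "Hspace n m \<mu> \<nu> \<alpha> = {f. holo_several (n + m) (Dom n m \<mu>) f \<and> (\<forall>Z. Z \<notin> Dom n m \<mu> \<longrightarrow> f Z = 0) \<and>
      (\<integral>\<^sup>+ Z. ennreal (indicator (Dom n m \<mu>) Z * (cmod (f Z))^2 * wgt n m \<mu> \<nu> \<alpha> Z) \<partial>lebesgue_CN (n + m)) < \<infinity>}"

definition Hinner :: "nat \<Rightarrow> nat \<Rightarrow> real \<Rightarrow> real \<Rightarrow> real \<Rightarrow> ((nat \<Rightarrow> complex) \<Rightarrow> complex) \<Rightarrow> ((nat \<Rightarrow> complex) \<Rightarrow> complex) \<Rightarrow> complex" where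
  "Hinner n m \<mu> \<nu> \<alpha> f g = (LINT Z|lebesgue_CN (n + m).
      indicator (Dom n m \<mu>) Z * f Z * cnj (g Z) * complex_of_real (wgt n m \<mu> \<nu> \<alpha> Z))"

definition Kdiag :: "nat \<Rightarrow> nat \<Rightarrow> real \<Rightarrow> real \<Rightarrow> real \<Rightarrow> (nat \<Rightarrow> complex) \<Rightarrow> complex" where
  "Kdiag n m \<mu> \<nu> \<alpha> Z = (THE k. \<exists>KZ \<in> Hspace n m \<mu> \<nu> \<alpha>.
      (\<forall>f \<in> Hspace n m \<mu> \<nu> \<alpha>. Hinner n m \<mu> \<nu> \<alpha> f KZ = f Z) \<and> k = KZ Z)"

definition rawnsley_eps :: "nat \<Rightarrow> nat \<Rightarrow> real \<Rightarrow> real \<Rightarrow> real \<Rightarrow> (nat \<Rightarrow> complex) \<Rightarrow> complex" where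
  "rawnsley_eps n m \<mu> \<nu> \<alpha> Z = complex_of_real (exp (- \<alpha> * Phi n m \<mu> \<nu> Z)) * Kdiag n m \<mu> \<nu> \<alpha> Z"

definition balanced :: "nat \<Rightarrow> nat \<Rightarrow> real \<Rightarrow> real \<Rightarrow> real \<Rightarrow> bool" where
  "balanced n m \<mu> \<nu> \<alpha> \<longleftrightarrow>
     (\<exists>f \<in> Hspace n m \<mu> \<nu> \<alpha>. \<exists>Z \<in> Dom n m \<mu>. f Z \<noteq> 0) \<and>
     (\<exists>c::real. c > 0 \<and> (\<forall>Z \<in> Dom n m \<mu>. rawnsley_eps n m \<mu> \<nu> \<alpha> Z = complex_of_real c))"

end

theory Submission
  imports
    Defs
    "HOL-Complex_Analysis.Complex_Analysis"
    "HOL-Probability.Probability"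
    "HOL-Real_Asymp.Real_Asymp"
    "Jordan_Normal_Form.Determinant"
begin

text \<open>Write $s = \<parallel>w\<parallel>^2 e^{\mu\<parallel>z\<parallel>^2}$ and $a = \alpha(1+\nu)$. The weight of
  $\mathcal{H}_\alpha$ is $e^{(m-a)\mu\<parallel>z\<parallel>^2}$ times a function of $s$. Heisenberg translations in $z$ and unitary maps in $w$
  preserve $s$ and act on $\mathcal{H}_\alpha$ by unitary operators, so $\varepsilon$ is a function of $s$ alone and it
  suffices to reproduce at the points $(0, \tau e_1)$. There, averaging over phases replaces $f$ by the
  one-variable function $\tau \mapsto f(0, \tau e_1)$, and its Taylor expansion shows that the kernel is
  $\sum_k (\bar\tau w_1)^k / M_k$ with $M_k = \<parallel>w_1^k\<parallel>^2$. If $\alpha \le n+m$ every $M_k$ is infinite and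
  $\mathcal{H}_\alpha = 0$. Otherwise $M_k$ is a sum of Beta values, and constancy of
  $(1-s)^\alpha \sum_k s^k/M_k$ is an identity of polynomials of degree $n$, with $\beta = \alpha-n-m$ and $t = \alpha+k$,
  \[ \sum_j {n \choose j}\nu^j(\beta)_j\prod_{l=1}^{n-j}(t-l) = (t+\alpha\nu)^n. \]
  The coefficients of $t^{n-1}$ and, for $n \ge 2$, of $t^{n-2}$ give $\nu(n+m) = -(n+1)/2$ and
  $\nu\beta(1+\nu) = (n+1)/12$; the latter contradicts $-1 < \nu < 0 < \beta$.\<close>

section \<open>Lebesgue measure on complex space\<close>

text \<open>Holomorphy here means continuity together with differentiability in each variable,
  whereas rotations and Heisenberg translations mix the variables; composing with them therefore
  rests on Osgood's lemma along holomorphic curves. The kernel is a definite description, so each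
  evaluation is given an explicit representer, and Hermitian symmetry settles uniqueness of the
  diagonal value. All symmetries are composed of maps that change one complex coordinate affinely,
  with coefficients free of that coordinate; every change of variables thus reduces to Fubini and an
  affine substitution in the plane. The threshold \<alpha> = n + m comes from the volume density,
  which contributes (1-s)^(-m-1) and (\<nu> + 1/(1-s))^n, so that the weight behaves like
  (1-s)^(\<alpha>-n-m-1) near the boundary s = 1. In the polynomial identity the right side stems
  from the Gaussian integral over z, which gives (a+k)^(-n) with a + k = t + \<alpha>\<nu>; the
  products (t-1)...(t-(n-j)) are the quotients \<Gamma>(t)/\<Gamma>(t-(n-j)) left over when the Beta
  values are brought to a common denominator.\<close>

lemma measurable_Complex [measurable (raw)]:
  fixes f g :: "'a \<Rightarrow> real"
  assumes [measurable]: "f \<in> borel_measurable M" "g \<in> borel_measurable M"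
  shows "(\<lambda>x. Complex (f x) (g x)) \<in> borel_measurable M"
  unfolding Complex_eq by measurable

text \<open>Lebesgue measure is determined by its values on boxes, and the preimage of a complex box
  is the planar box with the same corners.\<close>

lemma lborel_complex_eq:
  "(lborel :: complex measure) = distr (lborel :: (real \<times> real) measure) borel (\<lambda>(x, y). Complex x y)"
proof (rule lborel_eqI)
  have meas: "(\<lambda>(x, y). Complex x y) \<in> borel_measurable (borel :: (real \<times> real) measure)"
    unfolding borel_prod[symmetric] by measurable
  fix l u :: complex assume lu: "\<And>b. b \<in> Basis \<Longrightarrow> l \<bullet> b \<le> u \<bullet> b"
  have "(\<lambda>(x, y). Complex x y) -` box l u = box (Re l, Im l) (Re u, Im u)"
    by (auto simp: box_def Basis_complex_def Basis_prod_def)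
  moreover have "Re l \<le> Re u" "Im l \<le> Im u"
    using lu[of 1] lu[of \<i>] by (auto simp: Basis_complex_def)
  ultimately show "emeasure (distr lborel borel (\<lambda>(x, y). Complex x y)) (box l u) = (\<Prod>b\<in>Basis. (u - l) \<bullet> b)"
    using meas emeasure_lborel_box[of "(Re l, Im l)" "(Re u, Im u)"]
    by (simp add: emeasure_distr Basis_prod_def Basis_complex_def prod.insert_if mult.commute) force
qed simp

lemma nn_integral_complex:
  fixes f :: "complex \<Rightarrow> ennreal"
  assumes [measurable]: "f \<in> borel_measurable borel"
  shows "(\<integral>\<^sup>+\<zeta>. f \<zeta> \<partial>lborel) = (\<integral>\<^sup>+x. \<integral>\<^sup>+y. f (Complex x y) \<partial>lborel \<partial>lborel)"
proof -
  have [measurable]: "(\<lambda>p. Complex (fst p) (snd p)) \<in> borel_measurable (borel :: (real \<times> real) measure)"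
    unfolding borel_prod[symmetric] by measurable
  have "(\<integral>\<^sup>+\<zeta>. f \<zeta> \<partial>lborel) = (\<integral>\<^sup>+p. f (Complex (fst p) (snd p)) \<partial>(lborel \<Otimes>\<^sub>M lborel))"
    by (subst lborel_complex_eq, subst nn_integral_distr) (auto simp: lborel_prod case_prod_unfold)
  also have "\<dots> = (\<integral>\<^sup>+x. \<integral>\<^sup>+y. f (Complex x y) \<partial>lborel \<partial>lborel)"
    by (subst lborel.nn_integral_fst[symmetric]) (auto simp: lborel_prod)
  finally show ?thesis .
qed

text \<open>Multiplication by $d$ with $\mathrm{Re}\,d \ne 0$ is a composition of two maps that each change one real coordinate affinely.\<close>

lemma nn_integral_complex_affine_aux:
  fixes f :: "complex \<Rightarrow> ennreal"
  assumes f[measurable]: "f \<in> borel_measurable borel" and d: "Re d \<noteq> 0"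
  shows "(\<integral>\<^sup>+\<zeta>. f \<zeta> \<partial>lborel) = ennreal ((cmod d)\<^sup>2) * (\<integral>\<^sup>+\<zeta>. f (t + d * \<zeta>) \<partial>lborel)"
proof -
  define a b where "a = Re d" and "b = Im d"
  \<comment> \<open>Writing d = a + ib, the substitution x -> Re t - b y + a x has Jacobian
    \<open>\<bar>a\<bar>\<close>. The remaining substitution in y has Jacobian
    \<open>\<bar>c\<bar>\<close>, and a c is the squared modulus of d.\<close>
  define c where "c = (a\<^sup>2 + b\<^sup>2) / a"
  have a: "a \<noteq> 0" using d by (simp add: a_def)
  then have c: "c \<noteq> 0" by (simp add: c_def sum_power2_eq_zero_iff)
  define h where "h = (\<lambda>p. f (Complex (fst p) (Im t + (b / a) * (fst p - Re t) + c * snd p)))"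
  have h[measurable]: "h \<in> borel_measurable (borel \<Otimes>\<^sub>M borel)"
    unfolding h_def by measurable
  have eq: "f (t + d * Complex x y) = h ((Re t - b * y) + a * x, y)" for x y
  proof -
    have "t + d * Complex x y = Complex ((Re t - b * y) + a * x) (Im t + b * x + a * y)"
      by (simp add: complex_eq_iff a_def b_def)
    moreover have "Im t + b * x + a * y = Im t + (b / a) * (((Re t - b * y) + a * x) - Re t) + c * y"
      using a by (simp add: c_def field_simps power2_eq_square)
    ultimately show ?thesis by (simp add: h_def)
  qed
  have m1[measurable]: "(\<lambda>\<zeta>. f (t + d * \<zeta>)) \<in> borel_measurable borel" by measurable
  have "(\<integral>\<^sup>+\<zeta>. f (t + d * \<zeta>) \<partial>lborel) = (\<integral>\<^sup>+x. \<integral>\<^sup>+y. h ((Re t - b * y) + a * x, y) \<partial>lborel \<partial>lborel)"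
    by (subst nn_integral_complex) (auto simp: eq)
  also have "\<dots> = (\<integral>\<^sup>+y. \<integral>\<^sup>+x. h ((Re t - b * y) + a * x, y) \<partial>lborel \<partial>lborel)"
    by (rule lborel_pair.Fubini') measurable
  finally have "ennreal \<bar>a\<bar> * (\<integral>\<^sup>+\<zeta>. f (t + d * \<zeta>) \<partial>lborel) = (\<integral>\<^sup>+y. ennreal \<bar>a\<bar> * (\<integral>\<^sup>+x. h ((Re t - b * y) + a * x, y) \<partial>lborel) \<partial>lborel)"
    by (simp add: nn_integral_cmult)
  also have "\<dots> = (\<integral>\<^sup>+y. \<integral>\<^sup>+x. h (x, y) \<partial>lborel \<partial>lborel)"
    by (intro nn_integral_cong nn_integral_real_affine[symmetric]) (use a in auto)
  also have "\<dots> = (\<integral>\<^sup>+x. \<integral>\<^sup>+y. h (x, y) \<partial>lborel \<partial>lborel)"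
    by (rule lborel_pair.Fubini') measurable
  finally have 1: "ennreal \<bar>a\<bar> * (\<integral>\<^sup>+\<zeta>. f (t + d * \<zeta>) \<partial>lborel) = (\<integral>\<^sup>+x. \<integral>\<^sup>+y. h (x, y) \<partial>lborel \<partial>lborel)" .
  have 2: "ennreal \<bar>c\<bar> * (\<integral>\<^sup>+y. h (x, y) \<partial>lborel) = (\<integral>\<^sup>+y. f (Complex x y) \<partial>lborel)" for x
  proof -
    show ?thesis
      by (subst nn_integral_real_affine[where c = c and t = "Im t + (b / a) * (x - Re t)"])
        (use c in \<open>auto simp: h_def\<close>)
  qed
  have "ennreal \<bar>c\<bar> * (ennreal \<bar>a\<bar> * (\<integral>\<^sup>+\<zeta>. f (t + d * \<zeta>) \<partial>lborel)) = (\<integral>\<^sup>+x. ennreal \<bar>c\<bar> * (\<integral>\<^sup>+y. h (x, y) \<partial>lborel) \<partial>lborel)"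
    unfolding 1 by (simp add: nn_integral_cmult)
  also have "\<dots> = (\<integral>\<^sup>+\<zeta>. f \<zeta> \<partial>lborel)" by (simp add: 2 nn_integral_complex)
  finally have "(\<integral>\<^sup>+\<zeta>. f \<zeta> \<partial>lborel) = ennreal (\<bar>c\<bar> * \<bar>a\<bar>) * (\<integral>\<^sup>+\<zeta>. f (t + d * \<zeta>) \<partial>lborel)"
    by (simp add: ennreal_mult mult.assoc)
  moreover have "\<bar>c\<bar> * \<bar>a\<bar> = (cmod d)\<^sup>2"
    using a by (simp add: c_def cmod_power2 a_def b_def abs_mult[symmetric])
  ultimately show ?thesis by simp
qed

lemma nn_integral_complex_affine:
  fixes f :: "complex \<Rightarrow> ennreal"
  assumes f[measurable]: "f \<in> borel_measurable borel" and d: "d \<noteq> 0"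
  shows "(\<integral>\<^sup>+\<zeta>. f \<zeta> \<partial>lborel) = ennreal ((cmod d)\<^sup>2) * (\<integral>\<^sup>+\<zeta>. f (t + d * \<zeta>) \<partial>lborel)"
proof (cases "Re d = 0")
  case True
  \<comment> \<open>Dividing a purely imaginary number by 1 + i rotates it off the imaginary axis.
    Both factors e and 1 + i have nonzero real part, so the special case applies twice.\<close>
  define e where "e = d / (1 + \<i>)"
  have 0: "1 + \<i> \<noteq> 0" by (simp add: complex_eq_iff)
  then have de: "d = e * (1 + \<i>)" by (simp add: e_def)
  have "Re d = Re e - Im e" "Im d = Re e + Im e" unfolding de by auto
  then have e: "Re e \<noteq> 0" using d True by (auto simp: complex_eq_iff)
  have "(\<integral>\<^sup>+\<zeta>. f \<zeta> \<partial>lborel) = ennreal ((cmod e)\<^sup>2) * (\<integral>\<^sup>+\<zeta>. f (t + e * \<zeta>) \<partial>lborel)"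
    by (intro nn_integral_complex_affine_aux e f)
  also have "(\<integral>\<^sup>+\<zeta>. f (t + e * \<zeta>) \<partial>lborel) = ennreal ((cmod (1 + \<i>))\<^sup>2) * (\<integral>\<^sup>+\<zeta>. f (t + e * (0 + (1 + \<i>) * \<zeta>)) \<partial>lborel)"
    by (rule nn_integral_complex_affine_aux) auto
  finally show ?thesis
    by (simp add: de norm_mult power_mult_distrib ennreal_mult mult.assoc)
qed (use assms nn_integral_complex_affine_aux in auto)

text \<open>The image of planar measure under the squared modulus gives {..<x} the area pi x of a
  disc of radius sqrt x. Such half-lines generate the Borel sets and are stable under intersection,
  which identifies the image with pi times Lebesgue measure on the half-line.\<close>

lemma nn_integral_complex_norm_square:
  fixes v :: "real \<Rightarrow> ennreal"
  assumes [measurable]: "v \<in> borel_measurable borel"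
  shows "(\<integral>\<^sup>+\<zeta>. v ((cmod \<zeta>)\<^sup>2) \<partial>lborel) = ennreal pi * (\<integral>\<^sup>+x. v x * indicator {0..} x \<partial>lborel)"
proof -
  define M where "M = distr (lborel :: complex measure) borel (\<lambda>\<zeta>. (cmod \<zeta>)\<^sup>2)"
  define N where "N = density (lborel :: real measure) (\<lambda>x. ennreal pi * indicator {0..} x)"
  have eM: "emeasure M {..<x} = ennreal pi * ennreal x" if "x \<ge> 0" for x
  proof -
    have "(cmod \<zeta>)\<^sup>2 < x \<longleftrightarrow> cmod \<zeta> < sqrt x" for \<zeta>
      by (metis abs_norm_cancel real_sqrt_abs real_sqrt_less_iff)
    then have "(\<lambda>\<zeta>. (cmod \<zeta>)\<^sup>2) -` {..<x} = ball 0 (sqrt x)" by auto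
    then have "emeasure M {..<x} = emeasure lborel (ball (0::complex) (sqrt x))"
      unfolding M_def by (subst emeasure_distr) auto
    also have "\<dots> = ennreal (pi * x)"
      using that by (simp add: emeasure_ball unit_ball_vol_2)
    finally show ?thesis using that by (simp add: ennreal_mult)
  qed
  have eN: "emeasure N {..<x} = ennreal pi * ennreal x" if "x \<ge> 0" for x
  proof -
    have "emeasure N {..<x} = (\<integral>\<^sup>+y. ennreal pi * indicator {0..<x} y \<partial>lborel)"
      unfolding N_def by (subst emeasure_density) (auto intro!: nn_integral_cong simp: indicator_def)
    also have "\<dots> = ennreal pi * ennreal x" using that by (subst nn_integral_cmult) auto
    finally show ?thesis .
  qed
  have z: "emeasure M {..<x} = 0" "emeasure N {..<x} = 0" if "x < 0" for x
  proof -
    have "emeasure M {..<x} \<le> emeasure M {..<0}" "emeasure N {..<x} \<le> emeasure N {..<0}"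
      by (rule emeasure_mono; use that in \<open>auto simp: M_def N_def\<close>)+
    then show "emeasure M {..<x} = 0" "emeasure N {..<x} = 0" using eM[of 0] eN[of 0] by auto
  qed
  have "M = N"
  proof (rule measure_eqI_generator_eq[where E = "range lessThan" and \<Omega> = UNIV and A = "\<lambda>i. {..<real i}"])
    show "Int_stable (range lessThan :: real set set)"
    proof -
      have "{..<a} \<inter> {..<b} = {..<min a b}" for a b :: real by auto
      then show ?thesis unfolding Int_stable_def by fastforce
    qed
    show "sets M = sigma_sets UNIV (range lessThan)" "sets N = sigma_sets UNIV (range lessThan)"
      by (auto simp: M_def N_def borel_Iio)
    fix X :: "real set" assume "X \<in> range lessThan"
    then obtain x where "X = {..<x}" by auto
    then show "emeasure M X = emeasure N X" using eM[of x] eN[of x] z[of x] by (cases "x \<ge> 0") simp_all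
  next
    show "(\<Union>i. {..<real i}) = UNIV" using reals_Archimedean2 by auto
    show "\<And>i. emeasure M {..<real i} \<noteq> \<infinity>"
      by (subst eM) (auto simp: ennreal_mult[symmetric])
  qed auto
  have "(\<integral>\<^sup>+\<zeta>. v ((cmod \<zeta>)\<^sup>2) \<partial>lborel) = integral\<^sup>N M v"
    unfolding M_def by (subst nn_integral_distr) auto
  also have "\<dots> = (\<integral>\<^sup>+x. ennreal pi * (v x * indicator {0..} x) \<partial>lborel)"
    unfolding \<open>M = N\<close> N_def by (subst nn_integral_density) (auto intro!: nn_integral_cong simp: mult_ac)
  finally show ?thesis by (subst (asm) nn_integral_cmult) auto
qed

interpretation CN: product_sigma_finite "\<lambda>_::nat. lborel :: complex measure"
  by standard

lemma space_lebesgue_CN [simp]: "space (lebesgue_CN N) = cspace N"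
  by (simp add: lebesgue_CN_def space_PiM cspace_def)

lemma sigma_finite_lebesgue_CN: "sigma_finite_measure (lebesgue_CN N)"
  unfolding lebesgue_CN_def by (rule CN.sigma_finite) simp

lemma measurable_lebesgue_CN_component [measurable]:
  "i < N \<Longrightarrow> (\<lambda>X. X i) \<in> borel_measurable (lebesgue_CN N)"
  unfolding lebesgue_CN_def using measurable_component_singleton[of i "{..<N}" "\<lambda>_. lborel :: complex measure"] by simp

text \<open>Coordinates from N on are constantly \<open>undefined\<close> on the carrier, so the
  inclusion into the full product is measurable. Through it, Borel functions on all sequences become
  measurable for \<open>lebesgue_CN N\<close>.\<close>

lemma measurable_lebesgue_CN_ident [measurable]:
  "(\<lambda>X. X) \<in> borel_measurable (lebesgue_CN N)"
proof -
  have "(\<lambda>X. X) \<in> lebesgue_CN N \<rightarrow>\<^sub>M PiM UNIV (\<lambda>_. borel)"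
  proof (rule measurable_PiM_single')
    fix i :: nat
    show "(\<lambda>X. X i) \<in> borel_measurable (lebesgue_CN N)"
    proof (cases "i < N")
      case False
      then have "X i = undefined" if "X \<in> space (lebesgue_CN N)" for X
        using that by (auto simp: cspace_def PiE_def extensional_def)
      then show ?thesis by (subst measurable_cong[where g = "\<lambda>_. undefined"]) auto
    qed auto
  qed auto
  then show ?thesis
    using measurable_cong_sets[OF refl sets_PiM_equal_borel] by blast
qed

lemma borel_measurable_lebesgue_CN:
  "f \<in> borel_measurable borel \<Longrightarrow> f \<in> borel_measurable (lebesgue_CN N)"
  using measurable_comp[OF measurable_lebesgue_CN_ident] by (simp add: o_def)

lemma measurable_lebesgue_CN_fun_upd:
  assumes "i < N" "f \<in> M \<rightarrow>\<^sub>M lebesgue_CN N" "h \<in> borel_measurable M"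
  shows "(\<lambda>x. (f x)(i := h x)) \<in> M \<rightarrow>\<^sub>M lebesgue_CN N"
  using assms unfolding lebesgue_CN_def by (intro measurable_fun_upd[where J = "{..<N}"]) auto

lemma nn_integral_lebesgue_CN_fibre:
  assumes i: "i < N" and G[measurable]: "G \<in> borel_measurable (lebesgue_CN N)"
  shows "(\<integral>\<^sup>+X. G X \<partial>lebesgue_CN N) =
    (\<integral>\<^sup>+X. \<integral>\<^sup>+\<zeta>. G (X(i := \<zeta>)) \<partial>lborel \<partial>PiM ({..<N} - {i}) (\<lambda>_. lborel))"
proof -
  have "insert i ({..<N} - {i}) = {..<N}" using i by auto
  then show ?thesis
    using CN.product_nn_integral_insert[of "{..<N} - {i}" i G] G by (simp add: lebesgue_CN_def)
qed

text \<open>Since d and g are free of coordinate i, the map is affine on every fibre in direction i,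
  with real Jacobian the squared modulus of d. This is the building block of all changes of
  variables below.\<close>

lemma nn_integral_lebesgue_CN_affine:
  assumes i: "i < N"
    and G[measurable]: "G \<in> borel_measurable (lebesgue_CN N)"
    and d[measurable]: "d \<in> borel_measurable (lebesgue_CN N)"
    and g[measurable]: "g \<in> borel_measurable (lebesgue_CN N)"
    and d0: "\<And>X. d X \<noteq> 0"
    and di: "\<And>X \<zeta>. d (X(i := \<zeta>)) = d X" and gi: "\<And>X \<zeta>. g (X(i := \<zeta>)) = g X"
  shows "(\<integral>\<^sup>+X. G (X(i := g X + d X * X i)) * ennreal ((cmod (d X))\<^sup>2) \<partial>lebesgue_CN N) = (\<integral>\<^sup>+X. G X \<partial>lebesgue_CN N)"
proof -
  have [measurable]: "(\<lambda>X. X i) \<in> borel_measurable (lebesgue_CN N)" using i by simp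
  have m: "(\<lambda>X. X(i := g X + d X * X i)) \<in> lebesgue_CN N \<rightarrow>\<^sub>M lebesgue_CN N"
    by (rule measurable_lebesgue_CN_fun_upd) (use i in auto)
  note [measurable] = measurable_compose[OF m G]
  have "(\<integral>\<^sup>+X. G (X(i := g X + d X * X i)) * ennreal ((cmod (d X))\<^sup>2) \<partial>lebesgue_CN N) =
    (\<integral>\<^sup>+X. \<integral>\<^sup>+\<zeta>. G (X(i := g X + d X * \<zeta>)) * ennreal ((cmod (d X))\<^sup>2) \<partial>lborel \<partial>PiM ({..<N} - {i}) (\<lambda>_. lborel))"
    by (subst nn_integral_lebesgue_CN_fibre[OF i]) (auto simp: di gi)
  also have "\<dots> = (\<integral>\<^sup>+X. \<integral>\<^sup>+\<zeta>. G (X(i := \<zeta>)) \<partial>lborel \<partial>PiM ({..<N} - {i}) (\<lambda>_. lborel))"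
  proof (rule nn_integral_cong)
    fix X :: "nat \<Rightarrow> complex" assume X: "X \<in> space (PiM ({..<N} - {i}) (\<lambda>_. lborel))"
    have "(\<lambda>\<zeta>. X(i := \<zeta>)) \<in> lborel \<rightarrow>\<^sub>M lebesgue_CN N"
      unfolding lebesgue_CN_def
      by (rule measurable_fun_upd[where J = "{..<N} - {i}"]) (use i X in auto)
    from measurable_compose[OF this G] have [measurable]: "(\<lambda>\<zeta>. G (X(i := \<zeta>))) \<in> borel_measurable borel" by simp
    show "(\<integral>\<^sup>+\<zeta>. G (X(i := g X + d X * \<zeta>)) * ennreal ((cmod (d X))\<^sup>2) \<partial>lborel) = (\<integral>\<^sup>+\<zeta>. G (X(i := \<zeta>)) \<partial>lborel)"
      by (subst (2) nn_integral_complex_affine[where d = "d X" and t = "g X"])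
        (auto simp: d0 nn_integral_multc mult.commute[of "ennreal _"])
  qed
  also have "\<dots> = (\<integral>\<^sup>+X. G X \<partial>lebesgue_CN N)"
    by (rule nn_integral_lebesgue_CN_fibre[OF i G, symmetric])
  finally show ?thesis .
qed

section \<open>Averaging over rotations\<close>

text \<open>The integral of \<open>G (R \<theta> X)\<close> is the same for every \<theta>, hence
  equals its mean over the probability space; Tonelli moves the mean inside.\<close>

lemma nn_integral_average:
  fixes R :: "'b \<Rightarrow> 'a \<Rightarrow> 'a"
  assumes U: "prob_space U" and M: "sigma_finite_measure M"
    and R: "(\<lambda>p. R (fst p) (snd p)) \<in> U \<Otimes>\<^sub>M M \<rightarrow>\<^sub>M M"
    and inv: "\<And>\<theta> F. F \<in> borel_measurable M \<Longrightarrow> (\<integral>\<^sup>+X. F (R \<theta> X) \<partial>M) = (\<integral>\<^sup>+X. F X \<partial>M)"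
    and G: "G \<in> borel_measurable M"
  shows "(\<integral>\<^sup>+X. G X \<partial>M) = (\<integral>\<^sup>+X. \<integral>\<^sup>+\<theta>. G (R \<theta> X) \<partial>U \<partial>M)"
proof -
  interpret U: prob_space U by fact
  interpret M: sigma_finite_measure M by fact
  interpret P: pair_sigma_finite U M ..
  have "(\<integral>\<^sup>+X. G X \<partial>M) = (\<integral>\<^sup>+\<theta>. \<integral>\<^sup>+X. G (R \<theta> X) \<partial>M \<partial>U)"
    by (simp add: inv[OF G] U.emeasure_space_1)
  also have "\<dots> = (\<integral>\<^sup>+X. \<integral>\<^sup>+\<theta>. G (R \<theta> X) \<partial>U \<partial>M)"
    by (rule P.Fubini'[symmetric]) (use measurable_compose[OF R G] in \<open>simp add: case_prod_unfold\<close>)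
  finally show ?thesis .
qed

text \<open>Invariance is assumed for nonnegative functions. Applied to indicators it shows that
  every \<open>R \<theta>\<close> preserves the measure; applied to the norm of \<open>G\<close> it
  yields the integrability on the product that Fubini requires.\<close>

lemma integral_average:
  fixes R :: "'b \<Rightarrow> 'a \<Rightarrow> 'a" and G :: "'a \<Rightarrow> complex"
  assumes U: "prob_space U" and M: "sigma_finite_measure M"
    and R: "(\<lambda>p. R (fst p) (snd p)) \<in> U \<Otimes>\<^sub>M M \<rightarrow>\<^sub>M M"
    and R': "\<And>\<theta>. R \<theta> \<in> M \<rightarrow>\<^sub>M M"
    and inv: "\<And>\<theta> F. F \<in> borel_measurable M \<Longrightarrow> (\<integral>\<^sup>+X. F (R \<theta> X) \<partial>M) = (\<integral>\<^sup>+X. F X \<partial>M)"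
    and G: "integrable M G"
  shows "(\<integral>X. G X \<partial>M) = (\<integral>X. \<integral>\<theta>. G (R \<theta> X) \<partial>U \<partial>M)"
proof -
  interpret U: prob_space U by fact
  interpret M: sigma_finite_measure M by fact
  interpret P: pair_sigma_finite U M ..
  have Gm: "G \<in> borel_measurable M" using G by auto
  have "distr M M (R \<theta>) = M" for \<theta>
  proof (rule measure_eqI)
    fix A assume A: "A \<in> sets (distr M M (R \<theta>))"
    then have "emeasure (distr M M (R \<theta>)) A = (\<integral>\<^sup>+X. indicator A (R \<theta> X) \<partial>M)"
      using R'[of \<theta>] by (simp flip: nn_integral_distr)
    also have "\<dots> = emeasure M A" using A by (subst inv) auto
    finally show "emeasure (distr M M (R \<theta>)) A = emeasure M A" .
  qed simp
  then have "(\<integral>X. G (R \<theta> X) \<partial>M) = (\<integral>X. G X \<partial>M)" for \<theta>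
    using integral_distr[OF R' Gm, of \<theta>] by simp
  then have "(\<integral>X. G X \<partial>M) = (\<integral>\<theta>. \<integral>X. G (R \<theta> X) \<partial>M \<partial>U)"
    by (simp add: U.prob_space)
  also have "\<dots> = (\<integral>X. \<integral>\<theta>. G (R \<theta> X) \<partial>U \<partial>M)"
  proof (rule P.Fubini_integral[symmetric])
    have m: "(\<lambda>(\<theta>, X). G (R \<theta> X)) \<in> borel_measurable (U \<Otimes>\<^sub>M M)"
      using measurable_compose[OF R Gm] by (simp add: case_prod_unfold)
    have "(\<integral>\<^sup>+p. ennreal (norm (case p of (\<theta>, X) \<Rightarrow> G (R \<theta> X))) \<partial>(U \<Otimes>\<^sub>M M)) = (\<integral>\<^sup>+\<theta>. \<integral>\<^sup>+X. ennreal (norm (G (R \<theta> X))) \<partial>M \<partial>U)"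
      by (subst M.nn_integral_fst[symmetric]) (use m in auto)
    also have "\<dots> = (\<integral>\<^sup>+X. ennreal (norm (G X)) \<partial>M)"
      using inv[of "\<lambda>X. ennreal (norm (G X))"] Gm by (simp add: U.emeasure_space_1)
    also have "\<dots> < \<infinity>" using G by (simp add: integrable_iff_bounded)
    finally show "integrable (U \<Otimes>\<^sub>M M) (\<lambda>(\<theta>, X). G (R \<theta> X))"
      using m by (simp add: integrable_iff_bounded)
  qed
  finally show ?thesis .
qed

text \<open>Nonnegativity of the variance: expand the mean of the squared distance from h to its own
  mean.\<close>

lemma (in prob_space) cmod_integral_square_le:
  fixes h :: "'a \<Rightarrow> complex"
  assumes h: "integrable M h" and h2: "integrable M (\<lambda>x. (cmod (h x))\<^sup>2)"
  shows "(cmod (\<integral>x. h x \<partial>M))\<^sup>2 \<le> (\<integral>x. (cmod (h x))\<^sup>2 \<partial>M)"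
proof -
  define c where "c = (\<integral>x. h x \<partial>M)"
  define q where "q = (\<lambda>x. Re (cnj c * h x))"
  have eq: "(cmod (h x - c))\<^sup>2 = (cmod (h x))\<^sup>2 - 2 * q x + (cmod c)\<^sup>2" for x
    unfolding cmod_power2 q_def by (simp add: algebra_simps power2_eq_square)
  have i: "integrable M q" using h unfolding q_def by auto
  have "0 \<le> (\<integral>x. (cmod (h x - c))\<^sup>2 \<partial>M)" by simp
  also have "\<dots> = (\<integral>x. (cmod (h x))\<^sup>2 \<partial>M) - 2 * (\<integral>x. q x \<partial>M) + (cmod c)\<^sup>2"
    unfolding eq using h2 i by (simp add: prob_space)
  also have "(\<integral>x. q x \<partial>M) = Re (cnj c * c)"
    unfolding q_def using h by (subst integral_Re) (auto simp: c_def)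
  also have "Re (cnj c * c) = (cmod c)\<^sup>2"
    unfolding cmod_power2 by (simp add: power2_eq_square)
  finally show ?thesis by (simp add: c_def)
qed

definition unit_interval :: "real measure" where
  "unit_interval = restrict_space lborel {0..1}"

lemma prob_space_unit_interval: "prob_space unit_interval"
  by (auto intro!: prob_spaceI simp: unit_interval_def space_restrict_space emeasure_restrict_space)

lemma integral_unit_interval:
  fixes h :: "real \<Rightarrow> 'a::euclidean_space"
  assumes "continuous_on {0..1} h"
  shows "integrable unit_interval h" "(\<integral>x. h x \<partial>unit_interval) = integral {0..1} h"
proof -
  have *: "set_integrable lborel {0..1} h" using assms by (rule borel_integrable_atLeastAtMost')
  then show "integrable unit_interval h"
    by (simp add: unit_interval_def integrable_restrict_space set_integrable_def)
  have "(\<integral>x. h x \<partial>unit_interval) = set_lebesgue_integral lborel {0..1} h"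
    by (simp add: unit_interval_def integral_restrict_space set_lebesgue_integral_def)
  also have "\<dots> = integral {0..1} h" by (rule set_borel_integral_eq_integral(2)[OF *])
  finally show "(\<integral>x. h x \<partial>unit_interval) = integral {0..1} h" .
qed

text \<open>Cauchy's formula for the k-th derivative at 0 of u -> g(\<zeta> u), integrated over the
  unit circle. Rescaling the variable, rather than integrating over the circle through \<zeta>, also
  covers \<zeta> = 0; the radius \<open>R > 1\<close> puts the unit circle inside the domain of the
  rescaled function.\<close>

lemma Taylor_coefficient_rotation_average:
  assumes hol: "g holomorphic_on ball 0 r" and \<zeta>: "cmod \<zeta> < r"
  shows "(\<integral>\<theta>. g (cis (2 * pi * \<theta>) * \<zeta>) * cis (- (2 * pi * \<theta> * real k)) \<partial>unit_interval) = (deriv ^^ k) g 0 / fact k * \<zeta> ^ k"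
    and "continuous_on {0..1} (\<lambda>\<theta>. g (cis (2 * pi * \<theta>) * \<zeta>))"
proof -
  show c: "continuous_on {0..1} (\<lambda>\<theta>. g (cis (2 * pi * \<theta>) * \<zeta>))"
    by (rule continuous_on_compose2[OF holomorphic_on_imp_continuous_on[OF hol]])
       (use \<zeta> in \<open>auto intro!: continuous_intros simp: norm_mult\<close>)
  obtain R where R: "R > 1" "R * cmod \<zeta> < r"
  proof (cases "\<zeta> = 0")
    case True then show ?thesis using that[of 2] \<zeta> by auto
  next
    case False
    obtain R where "1 < R" "R < r / cmod \<zeta>" using dense[of 1 "r / cmod \<zeta>"] False \<zeta> by (auto simp: field_simps)
    then show ?thesis using that[of R] False by (auto simp: field_simps)
  qed
  define G where "G = (\<lambda>u. g (\<zeta> * u))"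
  have sub: "\<zeta> * u \<in> ball 0 r" if "u \<in> ball 0 R" for u
  proof -
    have "cmod \<zeta> * cmod u \<le> cmod \<zeta> * R" using that by (intro mult_left_mono) auto
    also have "\<dots> < r" using R by (simp add: mult.commute)
    finally show ?thesis by (simp add: norm_mult)
  qed
  have G: "G holomorphic_on ball 0 R"
    unfolding G_def by (rule holomorphic_on_compose_gen[of "\<lambda>u. \<zeta> * u" _ g, unfolded o_def, OF _ hol])
      (use sub in \<open>auto intro!: holomorphic_intros\<close>)
  have dG: "(deriv ^^ k) G 0 = \<zeta> ^ k * (deriv ^^ k) g 0"
    unfolding G_def using higher_deriv_compose_linear[OF hol, of "ball 0 R" 0 \<zeta> k] sub R by auto
  have "((\<lambda>u. G u / (u - 0) ^ Suc k) has_contour_integral 2 * pi * \<i> / fact k * (deriv ^^ k) G 0) (circlepath 0 1)"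
    by (rule Cauchy_has_contour_integral_higher_derivative_circlepath)
      (use R in \<open>auto intro!: holomorphic_on_imp_continuous_on holomorphic_on_subset[OF G]\<close>)
  then have "((\<lambda>t::real. 2 * pi * \<i> * exp (2 * of_real pi * \<i> * t) * (G (exp (2 * of_real pi * \<i> * t)) / exp (2 * of_real pi * \<i> * t) ^ Suc k)) has_integral 2 * pi * \<i> / fact k * (deriv ^^ k) G 0) {0..1}"
    unfolding has_contour_integral_def
    by (rule has_integral_eq[rotated]) (auto simp: vector_derivative_circlepath01, simp add: circlepath)
  then have "((\<lambda>t::real. inverse (2 * pi * \<i>) * (2 * pi * \<i> * exp (2 * of_real pi * \<i> * t) * (G (exp (2 * of_real pi * \<i> * t)) / exp (2 * of_real pi * \<i> * t) ^ Suc k))) has_integral inverse (2 * pi * \<i>) * (2 * pi * \<i> / fact k * (deriv ^^ k) G 0)) {0..1}"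
    by (rule has_integral_mult_right)
  moreover have "inverse (2 * pi * \<i>) * (2 * pi * \<i> * exp (2 * of_real pi * \<i> * t) * (G (exp (2 * of_real pi * \<i> * t)) / exp (2 * of_real pi * \<i> * t) ^ Suc k)) = g (cis (2 * pi * t) * \<zeta>) * cis (- (2 * pi * t * real k))" for t :: real
  proof -
    have e: "exp (2 * of_real pi * \<i> * t) = cis (2 * pi * t)" by (simp add: cis_conv_exp mult_ac)
    have "cis (- (2 * pi * t * real k)) = inverse (cis (2 * pi * t) ^ k)"
      by (simp add: Complex.DeMoivre mult_ac)
    then show ?thesis unfolding e G_def by (simp add: field_simps)
  qed
  ultimately have "((\<lambda>t. g (cis (2 * pi * t) * \<zeta>) * cis (- (2 * pi * t * real k))) has_integral (deriv ^^ k) g 0 / fact k * \<zeta> ^ k) {0..1}"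
    by (simp add: dG field_simps)
  moreover have "continuous_on {0..1} (\<lambda>t. g (cis (2 * pi * t) * \<zeta>) * cis (- (2 * pi * t * real k)))"
    by (intro continuous_intros c)
  ultimately show "(\<integral>\<theta>. g (cis (2 * pi * \<theta>) * \<zeta>) * cis (- (2 * pi * \<theta> * real k)) \<partial>unit_interval) = (deriv ^^ k) g 0 / fact k * \<zeta> ^ k"
    by (simp add: integral_unit_interval integral_unique)
qed

text \<open>One term of Bessel's inequality on the circle through \<zeta>: the coefficient is a mean
  of g times a unimodular factor. The bound is phrased with a nonnegative integral so that it can be
  integrated over X before anything is known to be finite.\<close>

lemma Taylor_coefficient_square_le:
  assumes hol: "g holomorphic_on ball 0 r" and \<zeta>: "cmod \<zeta> < r"
  shows "ennreal ((cmod ((deriv ^^ k) g 0 / fact k * \<zeta> ^ k))\<^sup>2) \<le> (\<integral>\<^sup>+\<theta>. ennreal ((cmod (g (cis (2 * pi * \<theta>) * \<zeta>)))\<^sup>2) \<partial>unit_interval)"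
proof -
  interpret prob_space unit_interval by (rule prob_space_unit_interval)
  let ?h = "\<lambda>\<theta>. g (cis (2 * pi * \<theta>) * \<zeta>) * cis (- (2 * pi * \<theta> * real k))"
  have c: "continuous_on {0..1} ?h"
    by (intro continuous_intros Taylor_coefficient_rotation_average(2)[OF assms])
  have i: "integrable unit_interval (\<lambda>\<theta>. (cmod (?h \<theta>))\<^sup>2)"
    by (intro integral_unit_interval continuous_intros c)
  have "(cmod (\<integral>\<theta>. ?h \<theta> \<partial>unit_interval))\<^sup>2 \<le> (\<integral>\<theta>. (cmod (?h \<theta>))\<^sup>2 \<partial>unit_interval)"
    by (rule cmod_integral_square_le[OF integral_unit_interval(1)[OF c] i])
  then have "ennreal ((cmod ((deriv ^^ k) g 0 / fact k * \<zeta> ^ k))\<^sup>2) \<le> ennreal (\<integral>\<theta>. (cmod (?h \<theta>))\<^sup>2 \<partial>unit_interval)"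
    unfolding Taylor_coefficient_rotation_average(1)[OF assms] by (rule ennreal_leI)
  also have "\<dots> = (\<integral>\<^sup>+\<theta>. ennreal ((cmod (?h \<theta>))\<^sup>2) \<partial>unit_interval)"
    by (rule nn_integral_eq_integral[symmetric, OF i]) simp
  finally show ?thesis by (simp add: norm_mult)
qed

section \<open>Separately holomorphic functions\<close>

text \<open>By Cauchy's formula, $F(\zeta, c(\zeta)) - F(\zeta, c(\zeta_0)) = (c(\zeta)-c(\zeta_0))\,Q(\zeta)$ where the integral $Q$ is continuous.\<close>

lemma field_differentiable_diagonal:
  fixes F :: "complex \<Rightarrow> complex \<Rightarrow> complex"
  assumes cont: "continuous_on (ball \<zeta>0 \<epsilon> \<times> ball (c \<zeta>0) r) (\<lambda>p. F (fst p) (snd p))"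
    and \<epsilon>: "\<epsilon> > 0" and r: "r > 0"
    and hol: "\<And>\<zeta>. \<zeta> \<in> ball \<zeta>0 \<epsilon> \<Longrightarrow> F \<zeta> holomorphic_on ball (c \<zeta>0) r"
    and c: "c holomorphic_on ball \<zeta>0 \<epsilon>"
    and F0: "(\<lambda>\<zeta>. F \<zeta> (c \<zeta>0)) field_differentiable at \<zeta>0"
  shows "(\<lambda>\<zeta>. F \<zeta> (c \<zeta>)) field_differentiable at \<zeta>0"
proof -
  define p where "p = c \<zeta>0"
  define \<rho> where "\<rho> = r / 2"
  have \<rho>: "0 < \<rho>" "\<rho> < r" using r by (auto simp: \<rho>_def)
  have cc: "continuous_on (ball \<zeta>0 \<epsilon>) c" using c by (rule holomorphic_on_imp_continuous_on)
  then have "isCont c \<zeta>0" using \<epsilon> by (simp add: continuous_on_eq_continuous_at)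
  then obtain \<delta>0 where \<delta>0: "\<delta>0 > 0" "\<And>\<zeta>. dist \<zeta> \<zeta>0 < \<delta>0 \<Longrightarrow> dist (c \<zeta>) p < \<rho>"
    using \<rho> unfolding continuous_at_eps_delta p_def by blast
  define \<delta> where "\<delta> = min \<delta>0 \<epsilon> / 2"
  have \<delta>: "\<delta> > 0" "\<delta> < \<delta>0" "\<delta> < \<epsilon>" using \<delta>0 \<epsilon> by (auto simp: \<delta>_def)
  have cb: "cball \<zeta>0 \<delta> \<subseteq> ball \<zeta>0 \<epsilon>" using \<delta> by auto
  have cp: "dist (c \<zeta>) p < \<rho>" if "\<zeta> \<in> cball \<zeta>0 \<delta>" for \<zeta>
    using that \<delta> by (intro \<delta>0) (auto simp: dist_commute)
  \<comment> \<open>The circle of radius \<open>\<rho> = r / 2\<close> stays inside the ball of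
    holomorphy, while \<open>c \<zeta>\<close> and \<open>p\<close> lie strictly inside the circle
    for \<zeta> within \<delta> of the centre. Hence the denominators of \<open>Q\<close> never
    vanish.\<close>
  define C where "C = (\<lambda>t::real. p + of_real \<rho> * cis (2 * pi * t))"
  have Cr: "dist (C t) p = \<rho>" for t using \<rho> by (simp add: C_def dist_norm norm_mult)
  define Q where "Q = (\<lambda>\<zeta>. integral {0..1} (\<lambda>t. F \<zeta> (C t) / ((C t - c \<zeta>) * (C t - p)) * (of_real \<rho> * cis (2 * pi * t))))"
  have Cn: "C t - c \<zeta> \<noteq> 0" if "\<zeta> \<in> cball \<zeta>0 \<delta>" for t \<zeta>
    using cp[OF that] Cr[of t] by auto
  have Cn0: "C t - p \<noteq> 0" for t using Cr[of t] \<rho> by auto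
  have Cball: "C t \<in> ball p r" for t using Cr[of t] \<rho> by (auto simp: dist_commute)
  have Cc: "continuous_on A C" for A unfolding C_def by (intro continuous_intros)
  have "continuous_on (cball \<zeta>0 \<delta>) Q"
    unfolding Q_def
  proof (rule integral_continuous_on_param[where a = "0::real" and b = 1, unfolded cbox_interval])
    have "continuous_on (cball \<zeta>0 \<delta> \<times> {0..1}) (\<lambda>x. F (fst x) (C (snd x)))"
      by (rule continuous_on_compose2[OF cont, where f = "\<lambda>x. (fst x, C (snd x))", simplified])
        (use cb Cball in \<open>auto intro!: continuous_intros continuous_on_compose2[OF Cc] simp: p_def\<close>)
    moreover have "continuous_on (cball \<zeta>0 \<delta> \<times> {0..1}) (\<lambda>x. c (fst x))"
      by (rule continuous_on_compose2[OF cc]) (use cb in \<open>auto intro!: continuous_intros\<close>)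
    ultimately show "continuous_on (cball \<zeta>0 \<delta> \<times> {0..1}) (\<lambda>(\<zeta>, t). F \<zeta> (C t) / ((C t - c \<zeta>) * (C t - p)) * (of_real \<rho> * cis (2 * pi * t)))"
      unfolding case_prod_unfold
      by (intro continuous_intros continuous_on_compose2[OF Cc]) (use Cn Cn0 in auto)
  qed
  then have Q: "isCont Q \<zeta>0"
    using \<delta> by (intro continuous_on_interior) auto
  have key: "F \<zeta> (c \<zeta>) = F \<zeta> p + (c \<zeta> - p) * Q \<zeta>" if \<zeta>: "\<zeta> \<in> cball \<zeta>0 \<delta>" for \<zeta>
  proof -
    have H: "F \<zeta> holomorphic_on ball p r" using hol \<zeta> cb by (auto simp: p_def)
    have cauchy: "((\<lambda>t. F \<zeta> (C t) / (C t - w) * (of_real \<rho> * cis (2 * pi * t))) has_integral F \<zeta> w) {0..1}"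
      if w: "w \<in> ball p \<rho>" for w
    proof -
      have "((\<lambda>u. F \<zeta> u / (u - w)) has_contour_integral 2 * of_real pi * \<i> * F \<zeta> w) (circlepath p \<rho>)"
        by (rule Cauchy_integral_circlepath)
         (use w \<rho> in \<open>auto intro!: holomorphic_on_imp_continuous_on holomorphic_on_subset[OF H] simp: dist_commute dist_norm norm_minus_commute\<close>)
      then have "((\<lambda>t. F \<zeta> (C t) / (C t - w) * (2 * of_real pi * \<i> * (of_real \<rho> * cis (2 * pi * t)))) has_integral 2 * of_real pi * \<i> * F \<zeta> w) {0..1}"
        unfolding has_contour_integral_def
        by (rule has_integral_eq[rotated]) (auto simp: vector_derivative_circlepath01, simp add: circlepath C_def cis_conv_exp mult_ac)
      then have "((\<lambda>t. inverse (2 * of_real pi * \<i>) * (F \<zeta> (C t) / (C t - w) * (2 * of_real pi * \<i> * (of_real \<rho> * cis (2 * pi * t))))) has_integral inverse (2 * of_real pi * \<i>) * (2 * of_real pi * \<i> * F \<zeta> w)) {0..1}"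
        by (rule has_integral_mult_right)
      then show ?thesis by (simp add: field_simps)
    qed
    have "((\<lambda>t. F \<zeta> (C t) / (C t - c \<zeta>) * (of_real \<rho> * cis (2 * pi * t)) - F \<zeta> (C t) / (C t - p) * (of_real \<rho> * cis (2 * pi * t))) has_integral F \<zeta> (c \<zeta>) - F \<zeta> p) {0..1}"
      by (intro has_integral_diff cauchy) (use cp[OF \<zeta>] \<rho> in \<open>auto simp: dist_commute\<close>)
    moreover have "F \<zeta> (C t) / (C t - c \<zeta>) * (of_real \<rho> * cis (2 * pi * t)) - F \<zeta> (C t) / (C t - p) * (of_real \<rho> * cis (2 * pi * t)) =
        (c \<zeta> - p) * (F \<zeta> (C t) / ((C t - c \<zeta>) * (C t - p)) * (of_real \<rho> * cis (2 * pi * t)))" for t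
    proof -
      have "a / u * b - a / v * b = (v - u) * (a / (u * v) * b)" if "u \<noteq> 0" "v \<noteq> 0" for a b u v :: complex
      proof -
        have "a / u * b - a / v * b = (a * v / (u * v) - a * u / (u * v)) * b" using that by (simp add: left_diff_distrib)
        also have "\<dots> = (v - u) * (a / (u * v) * b)"
          unfolding diff_divide_distrib[symmetric] right_diff_distrib[symmetric] by (simp add: mult_ac)
        finally show ?thesis .
      qed
      from this[OF Cn[OF \<zeta>, of t] Cn0[of t]] show ?thesis by simp
    qed
    ultimately have "((\<lambda>t. (c \<zeta> - p) * (F \<zeta> (C t) / ((C t - c \<zeta>) * (C t - p)) * (of_real \<rho> * cis (2 * pi * t)))) has_integral F \<zeta> (c \<zeta>) - F \<zeta> p) {0..1}"
      by simp
    from integral_unique[OF this] have "(c \<zeta> - p) * Q \<zeta> = F \<zeta> (c \<zeta>) - F \<zeta> p"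
      unfolding Q_def integral_mult_right .
    then show ?thesis by simp
  qed
  have "c field_differentiable at \<zeta>0"
    using c \<epsilon> by (auto simp: holomorphic_on_open field_differentiable_def)
  \<comment> \<open>Caratheodory's form of the derivative: the difference quotient h of c is
    continuous at the centre, so h times Q is a continuous difference quotient of the product, for
    which continuity of Q suffices.\<close>
  then obtain h where h: "\<And>z. c z - p = h z * (z - \<zeta>0)" "isCont h \<zeta>0"
    unfolding field_differentiable_def CARAT_DERIV p_def by blast
  have "((\<lambda>\<zeta>. (c \<zeta> - p) * Q \<zeta>) has_field_derivative h \<zeta>0 * Q \<zeta>0) (at \<zeta>0)"
    unfolding CARAT_DERIV
    by (rule exI[of _ "\<lambda>z. h z * Q z"]) (use h Q in \<open>auto simp: mult_ac p_def intro!: isCont_mult\<close>)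
  then have "(\<lambda>\<zeta>. F \<zeta> p + (c \<zeta> - p) * Q \<zeta>) field_differentiable at \<zeta>0"
    using F0 by (intro field_differentiable_add) (auto simp: p_def field_differentiable_def)
  then show ?thesis
    by (rule field_differentiable_transform_within[where d = \<delta>, rotated 3]) (use \<delta> key in \<open>auto simp: dist_commute\<close>)
qed

text \<open>Osgood's lemma along a holomorphic curve: the coordinates of the curve are switched on one after the other.\<close>

lemma field_differentiable_compose_separately:
  fixes f :: "(nat \<Rightarrow> complex) \<Rightarrow> complex" and \<gamma> :: "complex \<Rightarrow> nat \<Rightarrow> complex"
  assumes U: "open U" and f: "continuous_on U f"
    and sep: "\<And>Z i. Z \<in> U \<Longrightarrow> i < N \<Longrightarrow> (\<lambda>\<zeta>. f (Z(i := \<zeta>))) field_differentiable (at (Z i))"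
    and \<epsilon>: "\<epsilon> > 0" and \<gamma>: "\<And>i. (\<lambda>\<zeta>. \<gamma> \<zeta> i) holomorphic_on ball \<zeta>0 \<epsilon>"
    and \<gamma>N: "\<And>i \<zeta>. i \<ge> N \<Longrightarrow> \<zeta> \<in> ball \<zeta>0 \<epsilon> \<Longrightarrow> \<gamma> \<zeta> i = \<gamma> \<zeta>0 i"
    and U0: "\<gamma> \<zeta>0 \<in> U"
  shows "(\<lambda>\<zeta>. f (\<gamma> \<zeta>)) field_differentiable at \<zeta>0"
proof -
  define g where "g = (\<lambda>k \<zeta> i. if i < k then \<gamma> \<zeta> i else \<gamma> \<zeta>0 i)"
  have "(\<lambda>\<zeta>. f (g k \<zeta>)) field_differentiable at \<zeta>0" if "k \<le> N" for k
    using that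
  proof (induction k)
    case (Suc k)
    define q where "q = (\<lambda>p. (g k (fst p))(k := snd p))"
    define W where "W = (ball \<zeta>0 \<epsilon> \<times> UNIV) \<inter> q -` U"
    have q: "continuous_on (ball \<zeta>0 \<epsilon> \<times> UNIV) q"
    proof (rule continuous_on_coordinatewise_then_product)
      fix i
      have "continuous_on (ball \<zeta>0 \<epsilon> \<times> UNIV) (\<lambda>p. \<gamma> (fst p) i)"
        by (rule continuous_on_compose2[OF holomorphic_on_imp_continuous_on[OF \<gamma>]]) (auto intro!: continuous_intros)
      then show "continuous_on (ball \<zeta>0 \<epsilon> \<times> UNIV) (\<lambda>p. q p i)"
        by (cases "i = k"; cases "i < k") (auto simp: q_def g_def intro!: continuous_intros)
    qed
    have "open W" unfolding W_def
      by (rule continuous_open_preimage[OF q _ U]) (auto intro: open_Times)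
    moreover have q0: "q (\<zeta>0, \<gamma> \<zeta>0 k) = \<gamma> \<zeta>0" by (auto simp: q_def g_def)
    then have "(\<zeta>0, \<gamma> \<zeta>0 k) \<in> W" using U0 \<epsilon> by (simp add: W_def)
    ultimately obtain A B where AB: "open A" "open B" "(\<zeta>0, \<gamma> \<zeta>0 k) \<in> A \<times> B" "A \<times> B \<subseteq> W"
      by (rule open_prod_elim)
    obtain \<epsilon>' where \<epsilon>': "\<epsilon>' > 0" "ball \<zeta>0 \<epsilon>' \<subseteq> A" using AB by (meson mem_Sigma_iff openE)
    obtain r where r: "r > 0" "ball (\<gamma> \<zeta>0 k) r \<subseteq> B" using AB by (meson mem_Sigma_iff openE)
    have sub: "ball \<zeta>0 \<epsilon>' \<times> ball (\<gamma> \<zeta>0 k) r \<subseteq> W" using \<epsilon>' r AB by blast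
    have sub': "ball \<zeta>0 \<epsilon>' \<subseteq> ball \<zeta>0 \<epsilon>" 
    proof
      fix z assume "z \<in> ball \<zeta>0 \<epsilon>'"
      then have "(z, \<gamma> \<zeta>0 k) \<in> W" using sub r by auto
      then show "z \<in> ball \<zeta>0 \<epsilon>" by (simp add: W_def)
    qed
    have "(\<lambda>\<zeta>. f ((g k \<zeta>)(k := \<gamma> \<zeta> k))) field_differentiable at \<zeta>0"
    proof (rule field_differentiable_diagonal[where F = "\<lambda>\<zeta> \<tau>. f ((g k \<zeta>)(k := \<tau>))" and c = "\<lambda>\<zeta>. \<gamma> \<zeta> k" and \<epsilon> = \<epsilon>' and r = r])
      have "continuous_on (ball \<zeta>0 \<epsilon>' \<times> ball (\<gamma> \<zeta>0 k) r) (\<lambda>p. f (q p))"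
        by (rule continuous_on_compose2[OF f continuous_on_subset[OF q]]) (use sub sub' in \<open>auto simp: W_def\<close>)
      then show "continuous_on (ball \<zeta>0 \<epsilon>' \<times> ball (\<gamma> \<zeta>0 k) r) (\<lambda>p. f ((g k (fst p))(k := snd p)))"
        by (simp add: q_def)
      show "(\<lambda>\<tau>. f ((g k \<zeta>)(k := \<tau>))) holomorphic_on ball (\<gamma> \<zeta>0 k) r" if "\<zeta> \<in> ball \<zeta>0 \<epsilon>'" for \<zeta>
      proof -
        have "(\<lambda>\<tau>. f ((g k \<zeta>)(k := \<tau>))) field_differentiable at \<tau>" if "\<tau> \<in> ball (\<gamma> \<zeta>0 k) r" for \<tau>
        proof -
          have "(\<zeta>, \<tau>) \<in> W" using sub that \<open>\<zeta> \<in> _\<close> by blast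
          then show ?thesis using sep[of "(g k \<zeta>)(k := \<tau>)" k] Suc.prems by (simp add: W_def q_def)
        qed
        then show ?thesis by (meson field_differentiable_at_within holomorphic_onI holomorphic_on_def)
      qed
      show "(\<lambda>\<zeta>. \<gamma> \<zeta> k) holomorphic_on ball \<zeta>0 \<epsilon>'" using \<gamma> sub' by (rule holomorphic_on_subset)
      \<comment> \<open>With the new coordinate frozen at its initial value the curve is still
        \<open>g k\<close>, so differentiability in the first argument is the induction
        hypothesis.\<close>
      have "(g k \<zeta>)(k := \<gamma> \<zeta>0 k) = g k \<zeta>" for \<zeta> by (auto simp: g_def)
      then show "(\<lambda>\<zeta>. f ((g k \<zeta>)(k := \<gamma> \<zeta>0 k))) field_differentiable at \<zeta>0" using Suc by simp
    qed (use \<epsilon>' r in auto)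
    moreover have "(g k \<zeta>)(k := \<gamma> \<zeta> k) = g (Suc k) \<zeta>" for \<zeta> by (auto simp: g_def less_Suc_eq)
    ultimately show ?case by simp
  qed (auto simp: g_def)
  from this[of N] have "(\<lambda>\<zeta>. f (g N \<zeta>)) field_differentiable at \<zeta>0" by simp
  moreover have "g N \<zeta> = \<gamma> \<zeta>" if "\<zeta> \<in> ball \<zeta>0 \<epsilon>" for \<zeta>
    using \<gamma>N that by (fastforce simp: g_def)
  ultimately show ?thesis
    using field_differentiable_transform_within[of \<epsilon> \<zeta>0 UNIV "\<lambda>\<zeta>. f (g N \<zeta>)" "\<lambda>\<zeta>. f (\<gamma> \<zeta>)"] \<epsilon>
    by (simp add: dist_commute)
qed

abbreviation res :: "nat \<Rightarrow> (nat \<Rightarrow> complex) \<Rightarrow> nat \<Rightarrow> complex" where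
  "res N X \<equiv> restrict X {..<N}"

lemma continuous_on_res: "continuous_on A (res N)"
proof (rule continuous_on_coordinatewise_then_product)
  fix i show "continuous_on A (\<lambda>X. res N X i)"
    by (cases "i < N") (auto intro: continuous_on_subset[OF continuous_on_product_coordinates])
qed

lemma res_cspace: "X \<in> cspace N \<Longrightarrow> res N X = X"
  by (auto simp: cspace_def PiE_def extensional_restrict)

lemma fun_upd_in_open_slice:
  assumes U: "open (res N -` D)" and D: "D \<subseteq> cspace N" and X: "X \<in> D" and i: "i < N"
  obtains \<epsilon> where "\<epsilon> > 0" "\<And>\<zeta>. \<zeta> \<in> ball (X i) \<epsilon> \<Longrightarrow> X(i := \<zeta>) \<in> D"
proof -
  have c: "X(i := \<zeta>) \<in> cspace N" for \<zeta> using X D i by (auto simp: cspace_def PiE_def extensional_def)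
  have "continuous_on UNIV (\<lambda>\<zeta>. X(i := \<zeta>))"
  proof (rule continuous_on_coordinatewise_then_product)
    fix j show "continuous_on UNIV (\<lambda>\<zeta>. (X(i := \<zeta>)) j)" by (cases "i = j") (auto intro!: continuous_intros)
  qed
  then have "open ((\<lambda>\<zeta>. X(i := \<zeta>)) -` (res N -` D))"
    using U by (simp add: continuous_on_open_vimage)
  moreover have "X i \<in> (\<lambda>\<zeta>. X(i := \<zeta>)) -` (res N -` D)" using X D by (auto simp: res_cspace)
  ultimately obtain \<epsilon> where "\<epsilon> > 0" "ball (X i) \<epsilon> \<subseteq> (\<lambda>\<zeta>. X(i := \<zeta>)) -` (res N -` D)" by (rule openE)
  then have "X(i := \<zeta>) \<in> D" if "\<zeta> \<in> ball (X i) \<epsilon>" for \<zeta> using that c res_cspace by (metis subsetD vimageE)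
  then show ?thesis using that[of \<epsilon>] \<open>\<epsilon> > 0\<close> by blast
qed

lemma holo_several_compose:
  assumes U: "open (res N -` D)" and D: "D \<subseteq> cspace N"
    and f: "holo_several N D f"
    and T: "\<And>k. k < N \<Longrightarrow> holo_several N D (\<lambda>X. T X k)" and TD: "\<And>X. X \<in> D \<Longrightarrow> T X \<in> D"
  shows "holo_several N D (\<lambda>X. f (T X))"
  unfolding holo_several_def
proof (intro conjI ballI allI impI)
  have und: "T X k = undefined" if "k \<ge> N" "X \<in> D" for X k
    using TD[OF that(2)] D that(1) by (auto simp: cspace_def PiE_def extensional_def)
  have "continuous_on D T"
  proof (rule continuous_on_coordinatewise_then_product)
    fix k show "continuous_on D (\<lambda>X. T X k)"
    proof (cases "k < N")
      case True then show ?thesis using T by (simp add: holo_several_def)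
    next
      case False then show ?thesis using und by (subst continuous_on_cong[OF refl, where g = "\<lambda>_. undefined"]) auto
    qed
  qed
  then show "continuous_on D (\<lambda>X. f (T X))"
    by (rule continuous_on_compose2[rotated, of D T D f]) (use f TD in \<open>auto simp: holo_several_def\<close>)
  fix X i assume X: "X \<in> D" and i: "i < N"
  obtain \<epsilon> where \<epsilon>: "\<epsilon> > 0" "\<And>\<zeta>. \<zeta> \<in> ball (X i) \<epsilon> \<Longrightarrow> X(i := \<zeta>) \<in> D"
    using fun_upd_in_open_slice[OF U D X i] by blast
  have "(\<lambda>\<zeta>. f (res N (T (X(i := \<zeta>))))) field_differentiable at (X i)"
  proof (rule field_differentiable_compose_separately[OF U, where f = "\<lambda>X. f (res N X)" and N = N and \<epsilon> = \<epsilon> and \<gamma> = "\<lambda>\<zeta>. T (X(i := \<zeta>))"])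
    show "continuous_on (res N -` D) (\<lambda>X. f (res N X))"
      by (rule continuous_on_compose2[OF _ continuous_on_res, of D f]) (use f in \<open>auto simp: holo_several_def\<close>)
    show "(\<lambda>\<zeta>. f (res N (Z(j := \<zeta>)))) field_differentiable at (Z j)" if Z: "Z \<in> res N -` D" and j: "j < N" for Z j
    proof -
      have "res N (Z(j := \<zeta>)) = (res N Z)(j := \<zeta>)" for \<zeta> using j by (auto simp: restrict_def)
      moreover have "(\<lambda>\<zeta>. f ((res N Z)(j := \<zeta>))) field_differentiable at (res N Z j)"
        using f Z j by (auto simp: holo_several_def)
      ultimately show ?thesis using j by simp
    qed
    show "(\<lambda>\<zeta>. T (X(i := \<zeta>)) k) holomorphic_on ball (X i) \<epsilon>" for k
    proof (cases "k < N")
      case True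
      have "(\<lambda>\<zeta>. T (X(i := \<zeta>)) k) field_differentiable at \<zeta>" if "\<zeta> \<in> ball (X i) \<epsilon>" for \<zeta>
      proof -
        have "(\<lambda>\<zeta>'. T ((X(i := \<zeta>))(i := \<zeta>')) k) field_differentiable at ((X(i := \<zeta>)) i)"
          using T[OF True] i \<epsilon>(2)[OF that] unfolding holo_several_def by blast
        then show ?thesis by simp
      qed
      then show ?thesis by (meson field_differentiable_at_within holomorphic_on_def)
    next
      case False
      then have "T (X(i := \<zeta>)) k = undefined" if "\<zeta> \<in> ball (X i) \<epsilon>" for \<zeta> using und \<epsilon>(2) that by auto
      then show ?thesis by (subst holomorphic_cong[OF refl, where g = "\<lambda>_. undefined"]) auto
    qed
    show "T (X(i := \<zeta>)) k = T (X(i := X i)) k" if "k \<ge> N" "\<zeta> \<in> ball (X i) \<epsilon>" for k \<zeta>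
      using und[OF that(1)] \<epsilon> that(2) X by auto
    show "T (X(i := X i)) \<in> res N -` D" using TD[OF X] D by (auto simp: res_cspace)
  qed (use \<epsilon> in auto)
  then show "(\<lambda>\<zeta>. f (T (X(i := \<zeta>)))) field_differentiable at (X i)"
    by (rule field_differentiable_transform_within[where d = \<epsilon>, rotated 3])
      (use \<epsilon> TD D in \<open>auto simp: dist_commute intro!: arg_cong[of _ _ f] res_cspace\<close>)
qed

section \<open>The volume density\<close>

lemma detN_eq_det: "detN N A = det (mat N N (\<lambda>(i, j). A i j))"
  unfolding detN_def det_def
  by (auto simp: atLeast0LessThan intro!: sum.cong prod.cong dest: permutes_in_image)

lemma det_unitriangular:
  assumes "\<And>i j. j < i \<Longrightarrow> i < N \<Longrightarrow> A i j = 0" "\<And>i. i < N \<Longrightarrow> A i i = (1::complex)"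
  shows "det (mat N N (\<lambda>(i, j). A i j)) = 1"
proof -
  have "det (mat N N (\<lambda>(i, j). A i j)) = prod_list (diag_mat (mat N N (\<lambda>(i, j). A i j)))"
    by (rule det_upper_triangular[of _ N]) (auto simp: upper_triangular_def assms)
  also have "\<dots> = 1" using assms by (simp add: prod_list_diag_prod)
  finally show ?thesis .
qed

lemma det_scalar_diagonal:
  "det (mat N N (\<lambda>(i, j). if i = j then (c::complex) else 0)) = c ^ N"
proof -
  have "det (mat N N (\<lambda>(i, j). if i = j then c else 0)) = prod_list (diag_mat (mat N N (\<lambda>(i, j). if i = j then c else 0)))"
    by (rule det_upper_triangular[of _ N]) (auto simp: upper_triangular_def)
  also have "\<dots> = c ^ N" by (simp add: prod_list_diag_prod)
  finally show ?thesis .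
qed

lemma det_block_lower:
  assumes "\<And>i j. i < n \<Longrightarrow> n \<le> j \<Longrightarrow> j < n + m \<Longrightarrow> A i j = (0::complex)"
  shows "det (mat (n + m) (n + m) (\<lambda>(i, j). A i j)) =
    det (mat n n (\<lambda>(i, j). A i j)) * det (mat m m (\<lambda>(i, j). A (n + i) (n + j)))"
proof -
  have "mat (n + m) (n + m) (\<lambda>(i, j). A i j) = four_block_mat (mat n n (\<lambda>(i, j). A i j)) (0\<^sub>m n m)
      (mat m n (\<lambda>(i, j). A (n + i) j)) (mat m m (\<lambda>(i, j). A (n + i) (n + j)))"
    by (rule eq_matI) (use assms in \<open>auto simp: not_less\<close>)
  then show ?thesis by (simp add: det_four_block_mat_upper_right_zero[of _ n _ m])
qed

lemma mat_mult_mat: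
  "mat N N (\<lambda>(i, j). A i j) * mat N N (\<lambda>(i, j). B i j) = mat N N (\<lambda>(i, j). \<Sum>k<N. A i k * (B k j :: complex))"
  by (rule eq_matI) (auto simp: scalar_prod_def atLeast0LessThan)

text \<open>The bordered matrix $Q = (1, -y; x, a I)$ becomes block triangular after a unipotent multiplication from either side.\<close>

lemma det_scalar_plus_rank_one:
  fixes a :: complex
  assumes a: "a \<noteq> 0"
  shows "det (mat m m (\<lambda>(i, j). (if i = j then a else 0) + x i * y j)) = a ^ m * (1 + (\<Sum>i<m. x i * y i) / a)"
proof -
  define Q where "Q = (\<lambda>i j. if i = 0 then (if j = 0 then 1 else - y (j - 1)) else if j = 0 then x (i - 1) else if i = j then a else 0)"
  define R where "R = (\<lambda>i j. if i = j then 1 else if i = 0 then y (j - 1) else (0::complex))"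
  define S where "S = (\<lambda>i j. if i = j then 1 else if i = 0 then y (j - 1) / a else (0::complex))"
  let ?M = "\<lambda>A. mat (1 + m) (1 + m) (\<lambda>(i, j). A i j :: complex)"
  have R1: "det (?M R) = 1" "det (?M S) = 1" by (rule det_unitriangular; auto simp: R_def S_def)+
  have split: "(\<Sum>k<1 + m. f k) = f 0 + (\<Sum>k<m. f (Suc k))" for f :: "nat \<Rightarrow> complex"
    by (metis plus_1_eq_Suc sum.lessThan_Suc_shift)
  have cong: "det (?M A) = det (?M B)" if "\<And>i j. i < 1 + m \<Longrightarrow> j < 1 + m \<Longrightarrow> A i j = B i j" for A B
    by (rule arg_cong[of _ _ det], rule eq_matI) (use that in auto)
  have "det (?M Q) * det (?M R) = det (?M (\<lambda>i j. \<Sum>k<1 + m. Q i k * R k j))"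
    by (subst det_mult[symmetric, of _ "1 + m"]) (simp_all only: mat_mult_mat mat_carrier)
  also have "\<dots> = det (?M (\<lambda>i j. if i = 0 then (if j = 0 then 1 else 0) else if j = 0 then x (i - 1) else (if i = j then a else 0) + x (i - 1) * y (j - 1)))"
  proof (rule cong)
    fix i j assume ij: "i < 1 + m" "j < 1 + m"
    have *: "(\<Sum>k<m. (if i = Suc k then a else 0) * (if Suc k = j then 1 else 0)) = (if i = j then a else 0)" if "i > 0"
    proof -
      have "(\<Sum>k<m. (if i = Suc k then a else 0) * (if Suc k = j then 1 else 0)) = (\<Sum>k<m. if k = i - 1 then (if i = j then a else 0) else 0)"
        using that by (intro sum.cong) auto
      moreover have "i - 1 < m" using that ij by simp
      ultimately show ?thesis by simp
    qed
    have **: "(\<Sum>k<m. y k * (if Suc k = j then 1 else 0)) = (if j = 0 then 0 else y (j - 1))"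
    proof -
      have "(\<Sum>k<m. y k * (if Suc k = j then 1 else 0)) = (\<Sum>k<m. if k = j - 1 then (if j = 0 then 0 else y k) else 0)"
        by (intro sum.cong) auto
      then show ?thesis using ij by (cases "j = 0") (auto simp: sum.delta)
    qed
    show "(\<Sum>k<1 + m. Q i k * R k j) = (if i = 0 then (if j = 0 then 1 else 0) else if j = 0 then x (i - 1) else (if i = j then a else 0) + x (i - 1) * y (j - 1))"
    proof -
      have R': "R 0 j = (if j = 0 then 1 else y (j - 1))" "R (Suc k) j = (if Suc k = j then 1 else 0)" for k
        by (auto simp: R_def)
      have Q': "Q i 0 = (if i = 0 then 1 else x (i - 1))" "Q i (Suc k) = (if i = 0 then - y k else if i = Suc k then a else 0)" for k
        by (auto simp: Q_def)
      show ?thesis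
        unfolding split R' Q' using * ** by (cases "i = 0") (simp_all add: sum_negf)
    qed
  qed
  also have "\<dots> = det (mat 1 1 (\<lambda>(i, j). 1 :: complex)) * det (mat m m (\<lambda>(i, j). (if i = j then a else 0) + x i * y j))"
    by (subst det_block_lower) (auto intro!: arg_cong2[where f = "(*)"] arg_cong[of _ _ det] eq_matI)
  also have "det (mat 1 1 (\<lambda>(i, j). 1 :: complex)) = 1"
    using det_unitriangular[of 1 "\<lambda>_ _. 1"] by simp
  finally have 1: "det (mat m m (\<lambda>(i, j). (if i = j then a else 0) + x i * y j)) = det (?M Q)"
    unfolding R1 mult_1_left mult_1_right ..
  have "det (?M S) * det (?M Q) = det (?M (\<lambda>i j. \<Sum>k<1 + m. S i k * Q k j))"
    by (subst det_mult[symmetric, of _ "1 + m"]) (simp_all only: mat_mult_mat mat_carrier)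
  also have "\<dots> = det (?M (\<lambda>i j. if i = 0 then (if j = 0 then 1 + (\<Sum>i<m. x i * y i) / a else 0) else if j = 0 then x (i - 1) else if i = j then a else 0))"
  proof (rule cong)
    fix i j assume ij: "i < 1 + m" "j < 1 + m"
    have *: "(\<Sum>k<m. (if i = Suc k then 1 else 0) * Q (Suc k) j) = Q i j" if "i > 0"
    proof -
      have "(\<Sum>k<m. (if i = Suc k then 1 else 0) * Q (Suc k) j) = (\<Sum>k<m. if k = i - 1 then Q i j else 0)"
        using that by (intro sum.cong) auto
      moreover have "i - 1 < m" using that ij by simp
      ultimately show ?thesis by simp
    qed
    have **: "(\<Sum>k<m. y k / a * (if Suc k = j then a else 0)) = (if j = 0 then 0 else y (j - 1))"
    proof -
      have "(\<Sum>k<m. y k / a * (if Suc k = j then a else 0)) = (\<Sum>k<m. if k = j - 1 then (if j = 0 then 0 else y k) else 0)"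
        by (intro sum.cong) (use a in auto)
      then show ?thesis using ij by (cases "j = 0") (auto simp: sum.delta)
    qed
    show "(\<Sum>k<1 + m. S i k * Q k j) = (if i = 0 then (if j = 0 then 1 + (\<Sum>i<m. x i * y i) / a else 0) else if j = 0 then x (i - 1) else if i = j then a else 0)"
    proof (cases "i = 0")
      case True
      then show ?thesis unfolding split using **
        by (cases "j = 0") (auto simp: Q_def S_def sum_divide_distrib mult_ac)
    next
      case False
      then have S': "S i 0 = 0" "S i (Suc k) = (if i = Suc k then 1 else 0)" for k by (auto simp: S_def)
      show ?thesis unfolding split S' using * False by (simp add: Q_def)
    qed
  qed
  also have "\<dots> = det (mat 1 1 (\<lambda>(i, j). 1 + (\<Sum>i<m. x i * y i) / a)) * det (mat m m (\<lambda>(i, j). if i = j then a else 0))"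
    by (subst det_block_lower) (auto intro!: arg_cong2[where f = "(*)"] arg_cong[of _ _ det] eq_matI)
  also have "det (mat 1 1 (\<lambda>(i, j). 1 + (\<Sum>i<m. x i * y i) / a)) = 1 + (\<Sum>i<m. x i * y i) / a"
    by (simp add: det_single)
  finally show ?thesis unfolding 1 R1 mult_1_left det_scalar_diagonal by (simp add: mult.commute)
qed

section \<open>The complex Hessian of the potential and its determinant\<close>

definition kvec :: "nat \<Rightarrow> complex \<Rightarrow> nat \<Rightarrow> complex" where
  "kvec l u = (\<lambda>k. if k = l then u else 0)"

text \<open>Both real directions of a coordinate are given by a complex number of modulus 1, so each
  directional derivative is computed only once, for general u.\<close>

lemma ex_ey_kvec: "ex l = kvec l 1" "ey l = kvec l \<i>"
  by (simp_all add: ex_def ey_def kvec_def)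

lemma cmod_line_square:
  assumes "cmod u = 1"
  shows "(cmod (a + of_real t * u))\<^sup>2 = (cmod a)\<^sup>2 + (2 * t * Re (cnj u * a) + t\<^sup>2)"
proof -
  have "(Re u)\<^sup>2 + (Im u)\<^sup>2 = 1" using assms by (simp add: cmod_def)
  then have "t\<^sup>2 * ((Re u)\<^sup>2 + (Im u)\<^sup>2) = t\<^sup>2" by simp
  then show ?thesis unfolding cmod_power2 by (simp add: power2_eq_square algebra_simps)
qed

lemma znorm2_line:
  assumes "cmod u = 1"
  shows "znorm2 n (\<lambda>k. p k + of_real t * kvec l u k) = znorm2 n p + (if l < n then 2 * t * Re (cnj u * p l) + t\<^sup>2 else 0)"
proof -
  have "(cmod (p i + of_real t * kvec l u i))\<^sup>2 = (cmod (p i))\<^sup>2 + (if i = l then 2 * t * Re (cnj u * p l) + t\<^sup>2 else 0)" for i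
    using cmod_line_square[OF assms] by (simp add: kvec_def)
  then show ?thesis by (simp add: znorm2_def sum.distrib)
qed

lemma wnorm2_line:
  assumes "cmod u = 1" and l: "l < n + m"
  shows "wnorm2 n m (\<lambda>k. p k + of_real t * kvec l u k) = wnorm2 n m p + (if l < n then 0 else 2 * t * Re (cnj u * p l) + t\<^sup>2)"
proof -
  have "(cmod (p (n + i) + of_real t * kvec l u (n + i)))\<^sup>2 = (cmod (p (n + i)))\<^sup>2 + (if i = l - n then (if l < n then 0 else 2 * t * Re (cnj u * p l) + t\<^sup>2) else 0)" for i
    using cmod_line_square[OF assms(1)] by (auto simp: kvec_def)
  then show ?thesis using l by (auto simp: wnorm2_def sum.distrib)
qed

context
  fixes n m :: nat and \<mu> \<nu> :: real
begin

definition EE :: "(nat \<Rightarrow> complex) \<Rightarrow> real" where "EE p = exp (- \<mu> * znorm2 n p)"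
definition WW :: "(nat \<Rightarrow> complex) \<Rightarrow> real" where "WW p = wnorm2 n m p"
definition DD :: "(nat \<Rightarrow> complex) \<Rightarrow> real" where "DD p = EE p - WW p"
text \<open>The potential is a function of the two squared norms of z and w. \<open>dcoef\<close> is
  its first partial derivative in the norm to which index l belongs, and \<open>scoef\<close>
  collects the second partial derivatives, simplified by \<open>EE - DD = WW\<close>.\<close>

definition dcoef :: "nat \<Rightarrow> (nat \<Rightarrow> complex) \<Rightarrow> real" where
  "dcoef l p = (if l < n then \<nu> * \<mu> + \<mu> * EE p / DD p else 1 / DD p)"
definition scoef :: "nat \<Rightarrow> nat \<Rightarrow> (nat \<Rightarrow> complex) \<Rightarrow> real" where
  "scoef k l p = (if k < n then (if l < n then \<mu>\<^sup>2 * EE p * WW p / (DD p)\<^sup>2 else \<mu> * EE p / (DD p)\<^sup>2)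
     else if l < n then \<mu> * EE p / (DD p)\<^sup>2 else 1 / (DD p)\<^sup>2)"

lemma EE_line_deriv:
  assumes "cmod u = 1"
  shows "((\<lambda>t. EE (\<lambda>k. p k + of_real t * kvec l u k)) has_real_derivative (if l < n then - \<mu> * EE p * (2 * Re (cnj u * p l)) else 0)) (at 0)"
  unfolding EE_def znorm2_line[OF assms] by (cases "l < n") (auto intro!: derivative_eq_intros)

lemma WW_line_deriv:
  assumes "cmod u = 1" "l < n + m"
  shows "((\<lambda>t. WW (\<lambda>k. p k + of_real t * kvec l u k)) has_real_derivative (if l < n then 0 else 2 * Re (cnj u * p l))) (at 0)"
  unfolding WW_def wnorm2_line[OF assms] by (cases "l < n") (auto intro!: derivative_eq_intros)

lemma DD_line_deriv:
  assumes "cmod u = 1" "l < n + m"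
  shows "((\<lambda>t. DD (\<lambda>k. p k + of_real t * kvec l u k)) has_real_derivative (if l < n then - \<mu> * EE p * (2 * Re (cnj u * p l)) else - (2 * Re (cnj u * p l)))) (at 0)"
  unfolding DD_def using DERIV_diff[OF EE_line_deriv[OF assms(1), of p l] WW_line_deriv[OF assms, of p]] by (auto split: if_splits)

lemma dirderiv_Phi:
  assumes u: "cmod u = 1" and l: "l < n + m" and p: "DD p > 0"
  shows "dirderiv (kvec l u) (Phi n m \<mu> \<nu>) p = dcoef l p * (2 * Re (cnj u * p l))"
proof -
  have *: "Phi n m \<mu> \<nu> q = \<nu> * \<mu> * znorm2 n q - ln (DD q)" for q
    by (simp add: Phi_def EE_def WW_def DD_def)
  have z: "((\<lambda>t. znorm2 n (\<lambda>k. p k + of_real t * kvec l u k)) has_real_derivative (if l < n then 2 * Re (cnj u * p l) else 0)) (at 0)"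
    unfolding znorm2_line[OF u] by (cases "l < n") (auto intro!: derivative_eq_intros)
  let ?r = "2 * Re (cnj u * p l)"
  have p': "0 < DD (\<lambda>k. p k + of_real 0 * kvec l u k)" using p by simp
  have "((\<lambda>t. Phi n m \<mu> \<nu> (\<lambda>k. p k + of_real t * kvec l u k)) has_real_derivative
     \<nu> * \<mu> * (if l < n then ?r else 0) - inverse (DD p) * (if l < n then - \<mu> * EE p * ?r else - ?r)) (at 0)"
    unfolding *
    using DERIV_diff[OF DERIV_cmult[OF z, of "\<nu> * \<mu>"] DERIV_chain2[OF DERIV_ln[OF p'] DD_line_deriv[OF u l]]] by simp
  also have "\<nu> * \<mu> * (if l < n then ?r else 0) - inverse (DD p) * (if l < n then - \<mu> * EE p * ?r else - ?r) = dcoef l p * ?r"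
    by (simp add: dcoef_def divide_inverse) (simp add: algebra_simps)
  finally have "((\<lambda>t. Phi n m \<mu> \<nu> (\<lambda>k. p k + of_real t * kvec l u k)) has_real_derivative dcoef l p * ?r) (at 0)" .
  then show ?thesis unfolding dirderiv_def by (rule DERIV_imp_deriv)
qed

text \<open>A second derivative needs the formula for the first one on a neighbourhood of p. The
  argument of the logarithm stays positive there by continuity.\<close>

lemma eventually_DD_line:
  assumes u: "cmod u = 1" and l: "l < n + m" and p: "DD p > 0"
  shows "eventually (\<lambda>t. DD (\<lambda>k. p k + of_real t * kvec l u k) > 0) (at 0)"
    "eventually (\<lambda>t. DD (\<lambda>k. p k + of_real t * kvec l u k) > 0) (nhds 0)"
proof -
  have "isCont (\<lambda>t. DD (\<lambda>k. p k + of_real t * kvec l u k)) 0"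
    by (rule DERIV_isCont[OF DD_line_deriv[OF u l]])
  then have "((\<lambda>t. DD (\<lambda>k. p k + of_real t * kvec l u k)) \<longlongrightarrow> DD p) (at 0)"
    unfolding isCont_def by simp
  from order_tendstoD(1)[OF this p]
  show 1: "eventually (\<lambda>t. DD (\<lambda>k. p k + of_real t * kvec l u k) > 0) (at 0)" .
  then show "eventually (\<lambda>t. DD (\<lambda>k. p k + of_real t * kvec l u k) > 0) (nhds 0)"
    using p by (simp add: eventually_nhds_conv_at)
qed

lemma dirderiv_dirderiv_Phi:
  assumes u: "cmod u = 1" and u': "cmod u' = 1" and l: "l < n + m" and k: "k < n + m" and p: "DD p > 0"
  shows "dirderiv (kvec k u') (dirderiv (kvec l u) (Phi n m \<mu> \<nu>)) p =
    4 * scoef k l p * Re (cnj u' * p k) * Re (cnj u * p l) + (if k = l then 2 * dcoef l p * Re (cnj u * u') else 0)"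
proof -
  let ?q = "\<lambda>t k'. p k' + of_real t * kvec k u' k'"
  have "eventually (\<lambda>t. dirderiv (kvec l u) (Phi n m \<mu> \<nu>) (?q t) = dcoef l (?q t) * (2 * Re (cnj u * ?q t l))) (nhds 0)"
    using eventually_DD_line(2)[OF u' k p] by eventually_elim (rule dirderiv_Phi[OF u l])
  then have 1: "dirderiv (kvec k u') (dirderiv (kvec l u) (Phi n m \<mu> \<nu>)) p = deriv (\<lambda>t. dcoef l (?q t) * (2 * Re (cnj u * ?q t l))) 0"
    unfolding dirderiv_def[of "kvec k u'"] by (rule deriv_cong_ev) simp
  have E: "((\<lambda>t. EE (?q t)) has_real_derivative (if k < n then - \<mu> * EE p * (2 * Re (cnj u' * p k)) else 0)) (at 0)"
    by (rule EE_line_deriv[OF u'])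
  have D: "((\<lambda>t. DD (?q t)) has_real_derivative (if k < n then - \<mu> * EE p * (2 * Re (cnj u' * p k)) else - (2 * Re (cnj u' * p k)))) (at 0)"
    by (rule DD_line_deriv[OF u' k])
  have p': "DD p \<noteq> 0" using p by simp
  have dc: "((\<lambda>t. dcoef l (?q t)) has_real_derivative 2 * scoef k l p * Re (cnj u' * p k)) (at 0)"
  proof (cases "l < n")
    case True
    have "((\<lambda>t. \<nu> * \<mu> + \<mu> * (EE (?q t) / DD (?q t))) has_real_derivative
      0 + \<mu> * (((if k < n then - \<mu> * EE p * (2 * Re (cnj u' * p k)) else 0) * DD p - EE p * (if k < n then - \<mu> * EE p * (2 * Re (cnj u' * p k)) else - (2 * Re (cnj u' * p k)))) / (DD p * DD p))) (at 0)"
      by (intro DERIV_add DERIV_const DERIV_cmult) (use DERIV_divide[OF E D] p' in simp)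
    moreover have "0 + \<mu> * (((if k < n then - \<mu> * EE p * (2 * Re (cnj u' * p k)) else 0) * DD p - EE p * (if k < n then - \<mu> * EE p * (2 * Re (cnj u' * p k)) else - (2 * Re (cnj u' * p k)))) / (DD p * DD p)) = 2 * scoef k l p * Re (cnj u' * p k)"
      using p' True by (simp add: scoef_def power2_eq_square divide_simps) (simp add: DD_def algebra_simps)
    ultimately show ?thesis using True by (simp add: dcoef_def)
  next
    case False
    have "((\<lambda>t. 1 / DD (?q t)) has_real_derivative
      (0 * DD p - 1 * (if k < n then - \<mu> * EE p * (2 * Re (cnj u' * p k)) else - (2 * Re (cnj u' * p k)))) / (DD p * DD p)) (at 0)"
      using DERIV_divide[OF DERIV_const D, of 1] p' by simp
    moreover have "(0 * DD p - 1 * (if k < n then - \<mu> * EE p * (2 * Re (cnj u' * p k)) else - (2 * Re (cnj u' * p k)))) / (DD p * DD p) = 2 * scoef k l p * Re (cnj u' * p k)"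
      using p' False by (simp add: scoef_def power2_eq_square divide_simps)
    ultimately show ?thesis using False by (simp add: dcoef_def)
  qed
  have lin: "((\<lambda>t. 2 * Re (cnj u * ?q t l)) has_real_derivative (if k = l then 2 * Re (cnj u * u') else 0)) (at 0)"
    by (cases "k = l") (auto simp: kvec_def intro!: derivative_eq_intros)
  have "((\<lambda>t. dcoef l (?q t) * (2 * Re (cnj u * ?q t l))) has_real_derivative
     4 * scoef k l p * Re (cnj u' * p k) * Re (cnj u * p l) + (if k = l then 2 * dcoef l p * Re (cnj u * u') else 0)) (at 0)"
    using DERIV_mult[OF dc lin] by (auto simp: algebra_simps)
  then show ?thesis unfolding 1 by (rule DERIV_imp_deriv)
qed

lemma levi_Phi:
  assumes i: "i < n + m" and j: "j < n + m" and p: "DD p > 0"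
  shows "levi (Phi n m \<mu> \<nu>) i j p = of_real (scoef i j p) * cnj (p i) * p j + (if i = j then of_real (dcoef j p) else 0)"
  unfolding levi_def ex_ey_kvec
  by (simp add: dirderiv_dirderiv_Phi[OF _ _ j i p] complex_eq_iff algebra_simps)

text \<open>The row operation $L$ corresponds to the fields $\partial_{z_i} - \mu\bar z_i\, w\cdot\partial_w$, which annihilate $s$; it makes the Levi matrix block triangular.\<close>

lemma detN_levi_Phi:
  assumes p: "DD p > 0"
  shows "detN (n + m) (\<lambda>i j. levi (Phi n m \<mu> \<nu>) i j p) =
    of_real ((\<nu> * \<mu> + \<mu> * EE p / DD p) ^ n * EE p / DD p ^ (m + 1))"
proof -
  define N where "N = n + m"
  define g where "g = (\<lambda>i j. of_real (scoef i j p) * cnj (p i) * p j + (if i = j then complex_of_real (dcoef j p) else 0))"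
  define L where "L = (\<lambda>i j. if i = j then 1 else if i < n \<and> n \<le> j then - of_real \<mu> * cnj (p i) * p j else 0)"
  define B where "B = (\<lambda>i j. if i < n then (if i = j then complex_of_real (dcoef j p) else 0) else g i j)"
  let ?M = "\<lambda>A. mat (n + m) (n + m) (\<lambda>(i, j). A i j :: complex)"
  have cong: "det (?M A) = det (?M A')" if "\<And>i j. i < n + m \<Longrightarrow> j < n + m \<Longrightarrow> A i j = A' i j" for A A'
    by (rule arg_cong[of _ _ det], rule eq_matI) (use that in auto)
  have E: "EE p = DD p + WW p" by (simp add: DD_def)
  have WW: "(\<Sum>l<m. p (n + l) * cnj (p (n + l))) = of_real (WW p)"
    by (simp add: WW_def wnorm2_def complex_norm_square del: of_real_power)
  have LB: "(\<Sum>k<n + m. L i k * g k j) = B i j" if ij: "i < n + m" "j < n + m" for i j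
  proof (cases "i < n")
    case False
    then have "(\<Sum>k<n + m. L i k * g k j) = (\<Sum>k<n + m. if k = i then g i j else 0)"
      by (intro sum.cong) (auto simp: L_def)
    then show ?thesis using ij False by (simp add: B_def)
  next
    case True
    have "(\<Sum>k<n + m. L i k * g k j) = (\<Sum>k<n. L i k * g k j) + (\<Sum>l<m. L i (n + l) * g (n + l) j)"
      by (simp add: sum.nat_group atLeast0LessThan[symmetric] sum.atLeastLessThan_concat[symmetric, of 0 n "n + m"] sum.shift_bounds_nat_ivl[symmetric])
        (simp add: sum.atLeastLessThan_shift_0[of _ n] add.commute)
    also have "(\<Sum>k<n. L i k * g k j) = (\<Sum>k<n. if k = i then g i j else 0)"
      by (intro sum.cong) (auto simp: L_def)
    also have "\<dots> = g i j" using True by simp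
    also have "(\<Sum>l<m. L i (n + l) * g (n + l) j) = - of_real \<mu> * cnj (p i) * (\<Sum>l<m. p (n + l) * g (n + l) j)"
      unfolding sum_distrib_left using True by (intro sum.cong) (auto simp: L_def)
    \<comment> \<open>The entries \<open>scoef k j p\<close> depend on k only through its block, so
      index n stands for all w-rows and the squared norm of w factors out.\<close>
    also have "(\<Sum>l<m. p (n + l) * g (n + l) j) = of_real (WW p * scoef n j p) * p j + (if j < n then 0 else p j * of_real (1 / DD p))"
    proof -
      have "(\<Sum>l<m. p (n + l) * g (n + l) j) = (\<Sum>l<m. (p (n + l) * cnj (p (n + l))) * (of_real (scoef n j p) * p j) + (if l = j - n then if j < n then 0 else p j * of_real (1 / DD p) else 0))"
        by (intro sum.cong refl) (auto simp: g_def scoef_def dcoef_def algebra_simps)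
      also have "\<dots> = of_real (WW p * scoef n j p) * p j + (if j < n then 0 else p j * of_real (1 / DD p))"
        unfolding sum.distrib sum_distrib_right[symmetric] WW using ij by auto
      finally show ?thesis .
    qed
    also have "g i j + - of_real \<mu> * cnj (p i) * (of_real (WW p * scoef n j p) * p j + (if j < n then 0 else p j * of_real (1 / DD p))) = B i j"
    proof -
      \<comment> \<open>This is the cancellation of the rank-one part in the z-rows. In z-columns
        the two terms are equal; in w-columns it amounts to \<open>EE = DD + WW\<close>.\<close>
      have r: "scoef i j p - \<mu> * (WW p * scoef n j p + (if j < n then 0 else 1 / DD p)) = 0"
        using p True by (simp add: scoef_def power2_eq_square divide_simps) (simp add: E algebra_simps)
      have "g i j + - of_real \<mu> * cnj (p i) * (of_real (WW p * scoef n j p) * p j + (if j < n then 0 else p j * of_real (1 / DD p))) =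
        of_real (scoef i j p - \<mu> * (WW p * scoef n j p + (if j < n then 0 else 1 / DD p))) * (cnj (p i) * p j) + (if i = j then complex_of_real (dcoef j p) else 0)"
        by (simp add: g_def algebra_simps)
      then show ?thesis unfolding r using True by (simp add: B_def)
    qed
    finally show ?thesis .
  qed
  have "detN (n + m) (\<lambda>i j. levi (Phi n m \<mu> \<nu>) i j p) = det (?M g)"
    unfolding detN_eq_det by (rule cong) (simp add: levi_Phi[OF _ _ p] g_def)
  also have "\<dots> = det (?M L) * det (?M g)"
    by (subst det_unitriangular) (auto simp: L_def)
  also have "\<dots> = det (?M (\<lambda>i j. \<Sum>k<n + m. L i k * g k j))"
    by (subst det_mult[symmetric, of _ "n + m"]) (simp_all only: mat_mult_mat mat_carrier)
  also have "\<dots> = det (?M B)" by (rule cong) (rule LB)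
  also have "\<dots> = det (mat n n (\<lambda>(i, j). B i j)) * det (mat m m (\<lambda>(i, j). B (n + i) (n + j)))"
    by (rule det_block_lower) (auto simp: B_def)
  also have "mat n n (\<lambda>(i, j). B i j) = mat n n (\<lambda>(i, j). if i = j then complex_of_real (\<nu> * \<mu> + \<mu> * EE p / DD p) else 0)"
    by (rule eq_matI) (auto simp: B_def dcoef_def)
  also have "mat m m (\<lambda>(i, j). B (n + i) (n + j)) = mat m m (\<lambda>(i, j). (if i = j then complex_of_real (1 / DD p) else 0) + (complex_of_real (1 / (DD p)\<^sup>2) * cnj (p (n + i))) * p (n + j))"
    by (rule eq_matI) (auto simp: B_def g_def dcoef_def scoef_def)
  also have "det (mat m m (\<lambda>(i, j). (if i = j then complex_of_real (1 / DD p) else 0) + (complex_of_real (1 / (DD p)\<^sup>2) * cnj (p (n + i))) * p (n + j))) =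
     complex_of_real (1 / DD p) ^ m * (1 + (\<Sum>i<m. (complex_of_real (1 / (DD p)\<^sup>2) * cnj (p (n + i))) * p (n + i)) / complex_of_real (1 / DD p))"
    by (rule det_scalar_plus_rank_one) (use p in auto)
  also have "(\<Sum>i<m. (complex_of_real (1 / (DD p)\<^sup>2) * cnj (p (n + i))) * p (n + i)) = complex_of_real (1 / (DD p)\<^sup>2 * WW p)"
    using WW by (simp add: mult_ac flip: sum_distrib_left sum_divide_distrib)
  also have "complex_of_real (1 / DD p) ^ m * (1 + complex_of_real (1 / (DD p)\<^sup>2 * WW p) / complex_of_real (1 / DD p)) = complex_of_real ((1 / DD p) ^ m * (1 + (1 / (DD p)\<^sup>2 * WW p) / (1 / DD p)))"
    by simp
  also have "(1 / DD p) ^ m * (1 + (1 / (DD p)\<^sup>2 * WW p) / (1 / DD p)) = EE p / DD p ^ (m + 1)"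
    using p by (simp add: E power_one_over power2_eq_square field_simps)
  finally show ?thesis by (simp add: det_scalar_diagonal)
qed

lemma kahler_vol_Phi:
  assumes p: "DD p > 0"
  shows "kahler_vol (n + m) (Phi n m \<mu> \<nu>) p = (\<nu> * \<mu> + \<mu> * EE p / DD p) ^ n * EE p / DD p ^ (m + 1) / pi ^ (n + m)"
  unfolding kahler_vol_def detN_levi_Phi[OF p] by simp

end

lemma continuous_on_coordinate: "continuous_on A (\<lambda>X :: nat \<Rightarrow> complex. X i)"
  by (rule continuous_on_subset[OF continuous_on_product_coordinates]) simp

lemma continuous_on_znorm2: "continuous_on A (znorm2 n)"
  unfolding znorm2_def by (intro continuous_intros continuous_on_coordinate)

lemma continuous_on_wnorm2: "continuous_on A (wnorm2 n m)"
  unfolding wnorm2_def by (intro continuous_intros continuous_on_coordinate)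

lemma borel_measurable_norm2 [measurable]:
  "znorm2 n \<in> borel_measurable borel" "wnorm2 n m \<in> borel_measurable borel"
  by (auto intro!: borel_measurable_continuous_onI continuous_on_znorm2 continuous_on_wnorm2)

lemma znorm2_nonneg: "znorm2 n X \<ge> 0" by (simp add: znorm2_def sum_nonneg)
lemma wnorm2_nonneg: "wnorm2 n m X \<ge> 0" by (simp add: wnorm2_def sum_nonneg)

section \<open>The weighted space\<close>

locale hartogs =
  fixes n m :: nat and \<mu> \<nu> \<alpha> :: real
  assumes n1: "n \<ge> 1" and m1: "m \<ge> 1" and \<mu>0: "\<mu> > 0" and \<nu>1: "\<nu> > -1" and \<alpha>0: "\<alpha> > 0"
begin

abbreviation "N \<equiv> n + m"
abbreviation "D \<equiv> Dom n m \<mu>"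
abbreviation "\<Lambda> \<equiv> lebesgue_CN (n + m)"
abbreviation "H \<equiv> Hspace n m \<mu> \<nu> \<alpha>"

definition "a = \<alpha> * (1 + \<nu>)"
definition "s X = wnorm2 n m X * exp (\<mu> * znorm2 n X)"
text \<open>The value 0 outside [0,1) makes \<open>V\<close> vanish off the domain, so that the
  indicator in the norm can be absorbed into the density. In the exponent of \<open>V\<close>, the
  part - a comes from the factor e^(-\<alpha>\<Phi>) and the part m from the volume density.\<close>

definition "\<kappa> \<sigma> = (if 0 \<le> \<sigma> \<and> \<sigma> < 1 then (1 - \<sigma>) powr \<alpha> * (\<mu> * (\<nu> + 1 / (1 - \<sigma>))) ^ n / (1 - \<sigma>) ^ (m + 1) / pi ^ N else 0)"
definition "V X = exp ((real m - a) * \<mu> * znorm2 n X) * \<kappa> (s X)"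
definition "M = density \<Lambda> (\<lambda>X. ennreal (V X))"

abbreviation "ip f g \<equiv> Hinner n m \<mu> \<nu> \<alpha> f g"
abbreviation "wexp X \<equiv> exp (- \<alpha> * Phi n m \<mu> \<nu> X)"
abbreviation "L2 f \<equiv> (\<integral>\<^sup>+X. ennreal ((cmod (f X))\<^sup>2) \<partial>M)"

lemma a0: "a > 0" using \<alpha>0 \<nu>1 by (simp add: a_def)
lemma s_nonneg: "s X \<ge> 0" by (simp add: s_def wnorm2_nonneg)

lemma mem_D_iff: "X \<in> D \<longleftrightarrow> X \<in> cspace N \<and> s X < 1"
proof -
  have "wnorm2 n m X < exp (- \<mu> * znorm2 n X) \<longleftrightarrow> s X < exp (- \<mu> * znorm2 n X) * exp (\<mu> * znorm2 n X)"
    by (simp add: s_def)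
  also have "exp (- \<mu> * znorm2 n X) * exp (\<mu> * znorm2 n X) = 1" by (simp flip: exp_add)
  finally show ?thesis by (simp add: Dom_def)
qed

lemma D_cspace: "D \<subseteq> cspace N" by (auto simp: mem_D_iff)

text \<open>On [0,1) the quotient 1/(1-\<sigma>) is at least 1, so \<nu> + 1/(1-\<sigma>) is at
  least \<nu> + 1 > 0.\<close>

lemma kappa_nonneg: "\<kappa> \<sigma> \<ge> 0"
  and kappa_pos: "0 \<le> \<sigma> \<Longrightarrow> \<sigma> < 1 \<Longrightarrow> \<kappa> \<sigma> > 0"
proof -
  have *: "\<nu> + 1 / (1 - \<sigma>) > 0" if "0 \<le> \<sigma>" "\<sigma> < 1"
  proof -
    have "1 / (1 - \<sigma>) \<ge> 1" using that by simp
    then show ?thesis using \<nu>1 by linarith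
  qed
  then show "0 \<le> \<sigma> \<Longrightarrow> \<sigma> < 1 \<Longrightarrow> \<kappa> \<sigma> > 0"
    using \<mu>0 by (simp add: \<kappa>_def)
  then show "\<kappa> \<sigma> \<ge> 0"
  proof (cases "0 \<le> \<sigma> \<and> \<sigma> < 1")
    case False
    then show ?thesis unfolding \<kappa>_def by (subst if_not_P) auto
  qed (simp add: less_imp_le)
qed

lemma V_nonneg: "V X \<ge> 0" by (simp add: V_def kappa_nonneg)

lemma EE_DD:
  shows "EE n \<mu> X = exp (- \<mu> * znorm2 n X)"
    and "DD n m \<mu> X = exp (- \<mu> * znorm2 n X) * (1 - s X)"
proof -
  show E: "EE n \<mu> X = exp (- \<mu> * znorm2 n X)" by (simp add: EE_def)
  have "exp (- \<mu> * znorm2 n X) * exp (\<mu> * znorm2 n X) = 1" by (simp flip: exp_add)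
  then show "DD n m \<mu> X = exp (- \<mu> * znorm2 n X) * (1 - s X)"
    by (simp add: DD_def E WW_def s_def algebra_simps)
qed

lemma exp_Phi:
  assumes "X \<in> D"
  shows "wexp X = exp (- a * \<mu> * znorm2 n X) * (1 - s X) powr \<alpha>"
proof -
  have s: "s X < 1" using assms by (simp add: mem_D_iff)
  have "exp (- \<mu> * znorm2 n X) - wnorm2 n m X = exp (- \<mu> * znorm2 n X) * (1 - s X)"
    using EE_DD[of X] by (simp add: DD_def WW_def)
  then have "Phi n m \<mu> \<nu> X = (\<nu> + 1) * \<mu> * znorm2 n X - ln (1 - s X)"
  proof -
    assume *: "exp (- \<mu> * znorm2 n X) - wnorm2 n m X = exp (- \<mu> * znorm2 n X) * (1 - s X)"
    have "ln (exp (- \<mu> * znorm2 n X) * (1 - s X)) = - \<mu> * znorm2 n X + ln (1 - s X)"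
      using s by (simp add: ln_mult)
    then show ?thesis unfolding Phi_def * by (simp add: algebra_simps)
  qed
  then have "- \<alpha> * Phi n m \<mu> \<nu> X = - \<alpha> * ((\<nu> + 1) * \<mu> * znorm2 n X - ln (1 - s X))" by simp
  also have "\<dots> = - a * \<mu> * znorm2 n X + \<alpha> * ln (1 - s X)"
    by (simp add: a_def algebra_simps)
  finally have "- \<alpha> * Phi n m \<mu> \<nu> X = - a * \<mu> * znorm2 n X + \<alpha> * ln (1 - s X)" .
  then show ?thesis using s by (simp only: exp_add powr_def) simp
qed

lemma wgt_eq:
  assumes X: "X \<in> D"
  shows "wgt n m \<mu> \<nu> \<alpha> X = V X"
proof -
  let ?z = "znorm2 n X"
  have s: "s X < 1" "0 \<le> s X" using X s_nonneg by (auto simp: mem_D_iff)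
  have p: "DD n m \<mu> X > 0" using s by (simp add: EE_DD)
  have "EE n \<mu> X / DD n m \<mu> X = 1 / (1 - s X)"
    unfolding EE_DD by simp
  then have 1: "\<nu> * \<mu> + \<mu> * EE n \<mu> X / DD n m \<mu> X = \<mu> * (\<nu> + 1 / (1 - s X))"
    by (simp add: algebra_simps flip: times_divide_eq_right)
  have "EE n \<mu> X / DD n m \<mu> X ^ (m + 1) = exp (- \<mu> * ?z) / (exp (- \<mu> * ?z) ^ (m + 1)) / (1 - s X) ^ (m + 1)"
    unfolding EE_DD power_mult_distrib by simp
  also have "exp (- \<mu> * ?z) / (exp (- \<mu> * ?z) ^ (m + 1)) = 1 / exp (- \<mu> * ?z) ^ m" by simp
  also have "\<dots> = exp (m * \<mu> * ?z)" by (simp add: exp_of_nat_mult[symmetric] exp_minus field_simps)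
  finally have 2: "EE n \<mu> X / DD n m \<mu> X ^ (m + 1) = exp (m * \<mu> * ?z) / (1 - s X) ^ (m + 1)" .
  have 3: "kahler_vol N (Phi n m \<mu> \<nu>) X = (\<mu> * (\<nu> + 1 / (1 - s X))) ^ n * (exp (m * \<mu> * ?z) / (1 - s X) ^ (m + 1)) / pi ^ N"
    unfolding kahler_vol_Phi[OF p] 1 2[symmetric] by simp
  have "exp ((real m - a) * \<mu> * ?z) = exp (- a * \<mu> * ?z) * exp (m * \<mu> * ?z)"
    by (simp flip: exp_add) (simp add: algebra_simps)
  then show ?thesis
    unfolding wgt_def exp_Phi[OF X] 3 V_def \<kappa>_def using s by simp
qed

lemma indicator_wgt:
  assumes "X \<in> cspace N"
  shows "indicator D X * wgt n m \<mu> \<nu> \<alpha> X = V X"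
proof (cases "X \<in> D")
  case False
  then have "\<not> s X < 1" using assms by (simp add: mem_D_iff)
  then show ?thesis using False by (simp add: V_def \<kappa>_def)
qed (simp add: wgt_eq)

lemma measurable_s: "s \<in> borel_measurable borel"
  unfolding s_def by measurable

lemma measurable_kappa: "\<kappa> \<in> borel_measurable borel"
  unfolding \<kappa>_def by measurable

lemma measurable_V: "V \<in> borel_measurable borel"
  unfolding V_def using measurable_s measurable_kappa by measurable

lemma measurable_V_CN [measurable]: "V \<in> borel_measurable \<Lambda>"
  by (rule borel_measurable_lebesgue_CN[OF measurable_V])

lemma sets_M [measurable_cong]: "sets M = sets \<Lambda>" by (simp add: M_def)
lemma space_M [simp]: "space M = cspace N" by (simp add: M_def)

lemma sigma_finite_M: "sigma_finite_measure M"
  unfolding M_def by (subst sigma_finite_measure.sigma_finite_iff_density_finite[OF sigma_finite_lebesgue_CN]) auto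

lemma AE_M_D: "AE X in M. X \<in> D"
proof -
  have "V X = 0" if "X \<in> cspace N" "X \<notin> D" for X
    using indicator_wgt[OF that(1)] that(2) by simp
  then have "AE X in \<Lambda>. 0 < ennreal (V X) \<longrightarrow> X \<in> D" by (intro AE_I2) force
  then show ?thesis unfolding M_def by (subst AE_density) auto
qed

lemma open_res_D: "open (res N -` D)"
proof -
  have r: "res N X \<in> cspace N" for X by (auto simp: cspace_def)
  have "znorm2 n (res N X) = znorm2 n X" "wnorm2 n m (res N X) = wnorm2 n m X" for X
    by (auto simp: znorm2_def wnorm2_def intro!: sum.cong)
  then have "res N -` D = {X. s X < 1}" using r by (auto simp: mem_D_iff s_def)
  moreover have "continuous_on UNIV s"
    unfolding s_def by (intro continuous_intros continuous_on_znorm2 continuous_on_wnorm2)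
  then have "open {X. s X < 1}" by (intro open_Collect_less continuous_intros)
  ultimately show ?thesis by simp
qed

text \<open>After restriction, f is continuous on an open set of sequences and is cut off by the
  indicator of that set; on the carrier this product is f itself, as f vanishes off the
  domain.\<close>

lemma measurable_holo:
  assumes f: "holo_several N D f" and f0: "\<And>X. X \<notin> D \<Longrightarrow> f X = 0"
  shows "f \<in> borel_measurable \<Lambda>"
proof -
  let ?U = "res N -` D"
  have "continuous_on ?U (\<lambda>X. f (res N X))"
    by (rule continuous_on_compose2[OF _ continuous_on_res, of D f]) (use f in \<open>auto simp: holo_several_def\<close>)
  then have "(\<lambda>X. indicator ?U X *\<^sub>R f (res N X)) \<in> borel_measurable borel"
    using open_res_D by (intro borel_measurable_continuous_on_indicator) auto
  then have "(\<lambda>X. indicator ?U X *\<^sub>R f (res N X)) \<in> borel_measurable \<Lambda>"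
    by (rule borel_measurable_lebesgue_CN)
  then show ?thesis
    by (rule measurable_cong[THEN iffD1, rotated]) (auto simp: res_cspace f0 indicator_def)
qed

lemma mem_H_iff:
  "f \<in> H \<longleftrightarrow> holo_several N D f \<and> (\<forall>X. X \<notin> D \<longrightarrow> f X = 0) \<and> L2 f < \<infinity>"
proof -
  have "(\<integral>\<^sup>+ Z. ennreal (indicator D Z * (cmod (f Z))\<^sup>2 * wgt n m \<mu> \<nu> \<alpha> Z) \<partial>\<Lambda>) = L2 f"
    if f: "holo_several N D f" "\<forall>X. X \<notin> D \<longrightarrow> f X = 0"
  proof -
    have [measurable]: "f \<in> borel_measurable \<Lambda>" using measurable_holo f by blast
    have "L2 f = (\<integral>\<^sup>+X. ennreal (V X) * ennreal ((cmod (f X))\<^sup>2) \<partial>\<Lambda>)"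
      unfolding M_def by (rule nn_integral_density) measurable
    also have "\<dots> = (\<integral>\<^sup>+ Z. ennreal (indicator D Z * (cmod (f Z))\<^sup>2 * wgt n m \<mu> \<nu> \<alpha> Z) \<partial>\<Lambda>)"
      by (intro nn_integral_cong) (auto simp: indicator_wgt[symmetric] ennreal_mult'[symmetric] mult_ac simp del: ennreal_mult)
    finally show ?thesis ..
  qed
  then show ?thesis unfolding Hspace_def by auto
qed

lemma H_measurable: "f \<in> H \<Longrightarrow> f \<in> borel_measurable \<Lambda>"
  using measurable_holo by (auto simp: mem_H_iff)

lemma Hinner_eq:
  assumes f: "f \<in> borel_measurable \<Lambda>" and g: "g \<in> borel_measurable \<Lambda>"
  shows "ip f g = (\<integral>X. f X * cnj (g X) \<partial>M)"
proof -
  note [measurable] = f g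
  have [measurable]: "(\<lambda>X. cnj (g X)) \<in> borel_measurable \<Lambda>"
    using g by (rule measurable_compose) (intro borel_measurable_continuous_onI continuous_intros)
  have "(\<integral>X. f X * cnj (g X) \<partial>M) = (\<integral>X. V X *\<^sub>R (f X * cnj (g X)) \<partial>\<Lambda>)"
    unfolding M_def by (rule integral_density) (auto simp: V_nonneg)
  also have "\<dots> = ip f g"
    unfolding Hinner_def
    by (intro Bochner_Integration.integral_cong)
      (auto simp: indicator_wgt[symmetric] scaleR_conv_of_real mult_ac split: split_indicator)
  finally show ?thesis ..
qed

definition reproducing :: "(nat \<Rightarrow> complex) \<Rightarrow> ((nat \<Rightarrow> complex) \<Rightarrow> complex) \<Rightarrow> bool" where
  "reproducing Z K \<longleftrightarrow> K \<in> H \<and> (\<forall>f\<in>H. ip f K = f Z)"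

lemma Hinner_commute:
  assumes "f \<in> H" "g \<in> H"
  shows "ip g f = cnj (ip f g)"
  unfolding Hinner_eq[OF H_measurable[OF assms(1)] H_measurable[OF assms(2)]]
    Hinner_eq[OF H_measurable[OF assms(2)] H_measurable[OF assms(1)]]
  by (subst Bochner_Integration.integral_cnj[symmetric]) (simp add: mult.commute)

text \<open>If K and K' both represent evaluation at Z, then K'(Z) = <K',K> and K(Z) = <K,K'> are
  conjugate to each other, while K(Z) = <K,K> is real. So the diagonal value is unambiguous and the
  definite description denotes it.\<close>

lemma Kdiag_eq:
  assumes K: "reproducing Z K"
  shows "Kdiag n m \<mu> \<nu> \<alpha> Z = K Z"
proof -
  have uniq: "K' Z = K Z" if K': "reproducing Z K'" for K'
  proof -
    have "K' Z = ip K' K" "K Z = ip K K'"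
      "K Z = ip K K" using K K' by (auto simp: reproducing_def)
    moreover have "ip K' K = cnj (ip K K')"
      "ip K K = cnj (ip K K)"
      by (intro Hinner_commute; use K K' in \<open>simp add: reproducing_def\<close>)+
    ultimately show ?thesis by metis
  qed
  show ?thesis unfolding Kdiag_def
  proof (rule the_equality)
    show "\<exists>KZ\<in>H. (\<forall>f\<in>H. ip f KZ = f Z) \<and> K Z = KZ Z"
      using K unfolding reproducing_def by blast
    fix k assume "\<exists>KZ\<in>H. (\<forall>f\<in>H. ip f KZ = f Z) \<and> k = KZ Z"
    then obtain K' where "reproducing Z K'" "k = K' Z" unfolding reproducing_def by blast
    then show "k = K Z" using uniq by simp
  qed
qed

end

section \<open>Closure properties of separately holomorphic functions\<close>

lemma holo_several_const: "holo_several N U (\<lambda>_. c)"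
  by (simp add: holo_several_def)

lemma holo_several_coordinate: "holo_several N U (\<lambda>X. X k)"
  unfolding holo_several_def
proof (intro conjI ballI allI impI continuous_on_coordinate)
  fix Z :: "nat \<Rightarrow> complex" and i
  show "(\<lambda>\<zeta>. (Z(i := \<zeta>)) k) field_differentiable at (Z i)"
    by (cases "k = i") (auto intro: derivative_intros simp: field_differentiable_ident)
qed

lemma holo_several_add: "holo_several N U f \<Longrightarrow> holo_several N U g \<Longrightarrow> holo_several N U (\<lambda>X. f X + g X)"
  and holo_several_mult: "holo_several N U f \<Longrightarrow> holo_several N U g \<Longrightarrow> holo_several N U (\<lambda>X. f X * g X)"
  unfolding holo_several_def by (auto intro!: continuous_intros field_differentiable_add field_differentiable_mult)

lemma holo_several_outer:
  assumes f: "holo_several N U f" and g: "g holomorphic_on S" and S: "open S" and fS: "\<And>X. X \<in> U \<Longrightarrow> f X \<in> S"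
  shows "holo_several N U (\<lambda>X. g (f X))"
  unfolding holo_several_def
proof (intro conjI ballI allI impI)
  show "continuous_on U (\<lambda>X. g (f X))"
    by (rule continuous_on_compose2[OF holomorphic_on_imp_continuous_on[OF g]])
      (use f fS in \<open>auto simp: holo_several_def\<close>)
  fix Z i assume Z: "Z \<in> U" "i < N"
  have 1: "(\<lambda>\<zeta>. f (Z(i := \<zeta>))) field_differentiable at (Z i)" using f Z by (auto simp: holo_several_def)
  have "g field_differentiable at (f (Z(i := Z i)))"
    using g S fS[OF Z(1)] by (auto simp: holomorphic_on_open field_differentiable_def)
  from field_differentiable_compose[OF 1 this]
  show "(\<lambda>\<zeta>. g (f (Z(i := \<zeta>)))) field_differentiable at (Z i)" unfolding o_def .
qed

text \<open>Openness supplies a small disc in each coordinate on which the functions agree, which is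
  all that a one-variable derivative sees.\<close>

lemma holo_several_cong:
  assumes U: "open (res N -` U)" and c: "U \<subseteq> cspace N" and eq: "\<And>X. X \<in> U \<Longrightarrow> f X = g X" and g: "holo_several N U g"
  shows "holo_several N U f"
  unfolding holo_several_def
proof (intro conjI ballI allI impI)
  show "continuous_on U f" using g eq by (subst continuous_on_cong[OF refl eq]) (auto simp: holo_several_def)
  fix Z i assume Z: "Z \<in> U" "i < N"
  obtain \<epsilon> where \<epsilon>: "\<epsilon> > 0" "\<And>\<zeta>. \<zeta> \<in> ball (Z i) \<epsilon> \<Longrightarrow> Z(i := \<zeta>) \<in> U"
    using fun_upd_in_open_slice[OF U c Z] by blast
  have "(\<lambda>\<zeta>. g (Z(i := \<zeta>))) field_differentiable at (Z i)" using g Z by (auto simp: holo_several_def)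
  then show "(\<lambda>\<zeta>. f (Z(i := \<zeta>))) field_differentiable at (Z i)"
    by (rule field_differentiable_transform_within[OF \<epsilon>(1), rotated 2]) (use \<epsilon> eq in \<open>auto simp: dist_commute\<close>)
qed

lemma measurable_into_lebesgue_CN:
  assumes "\<And>k. k < N \<Longrightarrow> (\<lambda>x. f x k) \<in> borel_measurable M" "\<And>x. x \<in> space M \<Longrightarrow> f x \<in> cspace N"
  shows "f \<in> M \<rightarrow>\<^sub>M lebesgue_CN N"
  unfolding lebesgue_CN_def
  by (rule measurable_PiM_single') (use assms in \<open>auto simp: cspace_def\<close>)

context hartogs
begin

lemma M_nn_integral: "G \<in> borel_measurable \<Lambda> \<Longrightarrow> (\<integral>\<^sup>+X. G X \<partial>M) = (\<integral>\<^sup>+X. ennreal (V X) * G X \<partial>\<Lambda>)"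
  unfolding M_def by (rule nn_integral_density) measurable

section \<open>Unitary symmetries\<close>

text \<open>J is the multiplier of the weighted composition operator f -> J (f o T). The last
  clause, for nonnegative G, is what makes that operator isometric; measurability of J is listed
  separately because its holomorphy concerns the domain only.\<close>

definition autom :: "((nat \<Rightarrow> complex) \<Rightarrow> nat \<Rightarrow> complex) \<Rightarrow> ((nat \<Rightarrow> complex) \<Rightarrow> complex) \<Rightarrow> bool" where
  "autom T J \<longleftrightarrow> T ` D \<subseteq> D \<and> T \<in> \<Lambda> \<rightarrow>\<^sub>M \<Lambda> \<and> (\<forall>k<N. holo_several N D (\<lambda>X. T X k)) \<and>
     holo_several N D J \<and> J \<in> borel_measurable \<Lambda> \<and>
     (\<forall>G\<in>borel_measurable \<Lambda>. (\<integral>\<^sup>+X. G (T X) * ennreal ((cmod (J X))\<^sup>2) \<partial>M) = (\<integral>\<^sup>+X. G X \<partial>M))"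

lemma autom_nn_integral:
  assumes "autom T J" "G \<in> borel_measurable \<Lambda>"
  shows "(\<integral>\<^sup>+X. G (T X) * ennreal ((cmod (J X))\<^sup>2) \<partial>M) = (\<integral>\<^sup>+X. G X \<partial>M)"
  using assms(1)[unfolded autom_def] assms(2) by simp

definition pull :: "((nat \<Rightarrow> complex) \<Rightarrow> nat \<Rightarrow> complex) \<Rightarrow> ((nat \<Rightarrow> complex) \<Rightarrow> complex) \<Rightarrow> ((nat \<Rightarrow> complex) \<Rightarrow> complex) \<Rightarrow> (nat \<Rightarrow> complex) \<Rightarrow> complex" where
  "pull T J f X = (if X \<in> D then J X * f (T X) else 0)"

lemma pull_in_H:
  assumes T: "autom T J" and f: "f \<in> H"
  shows "pull T J f \<in> H"
proof -
  have fh: "holo_several N D f" using f by (simp add: mem_H_iff)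
  note [measurable] = H_measurable[OF f]
  have Th: "holo_several N D (\<lambda>X. J X * f (T X))"
    by (intro holo_several_mult holo_several_compose[OF open_res_D D_cspace fh]) (use T in \<open>auto simp: autom_def\<close>)
  have "holo_several N D (pull T J f)"
    by (rule holo_several_cong[OF open_res_D D_cspace _ Th]) (simp add: pull_def)
  moreover have "L2 (pull T J f) < \<infinity>"
  proof -
    have "L2 (pull T J f) = (\<integral>\<^sup>+X. ennreal ((cmod (f (T X)))\<^sup>2) * ennreal ((cmod (J X))\<^sup>2) \<partial>M)"
      by (rule nn_integral_cong_AE) (use AE_M_D in \<open>auto simp: pull_def norm_mult power_mult_distrib ennreal_mult mult.commute\<close>)
    also have "\<dots> = L2 f"
    proof -
      have "(\<lambda>X. ennreal ((cmod (f X))\<^sup>2)) \<in> borel_measurable \<Lambda>" by measurable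
      from autom_nn_integral[OF T this] show ?thesis .
    qed
    finally show ?thesis using f by (simp add: mem_H_iff)
  qed
  ultimately show ?thesis by (simp add: mem_H_iff pull_def)
qed

text \<open>Tested on indicators, the defining clause says that weighting \<open>M\<close> by the
  squared modulus of J and pushing forward along T gives \<open>M\<close> again. The transformation
  formula for image measures then covers complex integrands.\<close>

lemma autom_integral:
  fixes h :: "(nat \<Rightarrow> complex) \<Rightarrow> complex"
  assumes T: "autom T J" and h: "h \<in> borel_measurable \<Lambda>"
  shows "(\<integral>X. h (T X) * of_real ((cmod (J X))\<^sup>2) \<partial>M) = (\<integral>X. h X \<partial>M)"
proof -
  have Tm: "T \<in> M \<rightarrow>\<^sub>M \<Lambda>" and Jm: "J \<in> borel_measurable M"
    using T by (simp_all add: autom_def measurable_cong_sets[OF sets_M refl])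
  have hm: "h \<in> borel_measurable M" using h by (simp add: measurable_cong_sets[OF sets_M refl])
  define Q where "Q = density M (\<lambda>X. ennreal ((cmod (J X))\<^sup>2))"
  have TQ: "T \<in> Q \<rightarrow>\<^sub>M \<Lambda>" using Tm by (simp add: Q_def)
  have "distr Q \<Lambda> T = M"
  proof (rule measure_eqI)
    fix A assume "A \<in> sets (distr Q \<Lambda> T)"
    then have A: "A \<in> sets \<Lambda>" by simp
    have "emeasure (distr Q \<Lambda> T) A = (\<integral>\<^sup>+X. indicator A (T X) \<partial>Q)"
      using TQ A by (simp flip: nn_integral_distr)
    also have "\<dots> = (\<integral>\<^sup>+X. ennreal ((cmod (J X))\<^sup>2) * indicator A (T X) \<partial>M)"
      unfolding Q_def using Jm Tm A by (intro nn_integral_density) auto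
    also have "\<dots> = (\<integral>\<^sup>+X. indicator A X \<partial>M)"
      using T A unfolding autom_def by (simp add: mult.commute[of "ennreal _"])
    also have "\<dots> = emeasure M A" using A by (simp add: sets_M)
    finally show "emeasure (distr Q \<Lambda> T) A = emeasure M A" .
  qed (simp add: sets_M)
  then have "(\<integral>X. h X \<partial>M) = (\<integral>X. h (T X) \<partial>Q)"
    using integral_distr[OF TQ h] by simp
  also have "\<dots> = (\<integral>X. (cmod (J X))\<^sup>2 *\<^sub>R h (T X) \<partial>M)"
    unfolding Q_def by (rule integral_density) (use Jm measurable_compose[OF Tm h] in auto)
  finally show ?thesis by (simp add: scaleR_conv_of_real mult.commute)
qed

lemma Hinner_pull:
  assumes T: "autom T J" and f: "f \<in> H" and g: "g \<in> H"
  shows "ip (pull T J f) (pull T J g) = ip f g"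
proof -
  note m = H_measurable[OF f] H_measurable[OF g]
  note [measurable] = m H_measurable[OF pull_in_H[OF T f]] H_measurable[OF pull_in_H[OF T g]]
  have c: "(\<lambda>X. cnj (h X)) \<in> borel_measurable \<Lambda>" if "h \<in> borel_measurable \<Lambda>" for h
    using that by (rule measurable_compose) (intro borel_measurable_continuous_onI continuous_intros)
  have fg: "(\<lambda>X. f X * cnj (g X)) \<in> borel_measurable \<Lambda>" using m c by measurable
  have Tm: "T \<in> \<Lambda> \<rightarrow>\<^sub>M \<Lambda>" "J \<in> borel_measurable \<Lambda>" using T by (auto simp: autom_def)
  have "ip (pull T J f) (pull T J g) = (\<integral>X. pull T J f X * cnj (pull T J g X) \<partial>M)"
    by (rule Hinner_eq) measurable
  also have "\<dots> = (\<integral>X. (f (T X) * cnj (g (T X))) * of_real ((cmod (J X))\<^sup>2) \<partial>M)"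
  proof (rule integral_cong_AE)
    show "(\<lambda>X. pull T J f X * cnj (pull T J g X)) \<in> borel_measurable M"
      using c[of "pull T J g"] by measurable
    show "(\<lambda>X. f (T X) * cnj (g (T X)) * of_real ((cmod (J X))\<^sup>2)) \<in> borel_measurable M"
      using measurable_compose[OF Tm(1) fg] Tm(2) by measurable
    show "AE X in M. pull T J f X * cnj (pull T J g X) = f (T X) * cnj (g (T X)) * of_real ((cmod (J X))\<^sup>2)"
      using AE_M_D by eventually_elim (simp add: pull_def complex_norm_square mult_ac del: of_real_power)
  qed
  also have "\<dots> = (\<integral>X. f X * cnj (g X) \<partial>M)" by (rule autom_integral[OF T fg])
  also have "\<dots> = ip f g" by (rule Hinner_eq[symmetric]) (rule m)+
  finally show ?thesis .
qed

text \<open>The second pair is a one-sided inverse on the domain, multiplier included. The last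
  clause says that the squared modulus of J exactly compensates the change of e^(-\<alpha>\<Phi>)
  under T; this is why the \<epsilon>-function is invariant.\<close>

definition isometry :: "((nat \<Rightarrow> complex) \<Rightarrow> nat \<Rightarrow> complex) \<Rightarrow> ((nat \<Rightarrow> complex) \<Rightarrow> complex) \<Rightarrow>
    ((nat \<Rightarrow> complex) \<Rightarrow> nat \<Rightarrow> complex) \<Rightarrow> ((nat \<Rightarrow> complex) \<Rightarrow> complex) \<Rightarrow> bool" where
  "isometry T J T' J' \<longleftrightarrow> autom T J \<and> autom T' J' \<and>
     (\<forall>X\<in>D. T' (T X) = X \<and> J X * J' (T X) = 1 \<and> s (T X) = s X \<and>
       wexp X * (cmod (J X))\<^sup>2 = wexp (T X))"

lemma isometry_pull_pull:
  assumes T: "isometry T J T' J'" and f: "f \<in> H"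
  shows "pull T J (pull T' J' f) = f"
proof
  fix X
  show "pull T J (pull T' J' f) X = f X"
  proof (cases "X \<in> D")
    case True
    moreover have "T X \<in> D" using T True by (auto simp: isometry_def autom_def)
    ultimately have "pull T J (pull T' J' f) X = (J X * J' (T X)) * f (T' (T X))"
      by (simp add: pull_def)
    then show ?thesis using T True by (simp add: isometry_def)
  next
    case False
    then show ?thesis using f by (simp add: pull_def mem_H_iff)
  qed
qed

text \<open>Kept as a relation so that it carries the existence of a representer along with the
  value; both are transported by the symmetries.\<close>

definition eps_at :: "(nat \<Rightarrow> complex) \<Rightarrow> complex \<Rightarrow> bool" where
  "eps_at Z e \<longleftrightarrow> (\<exists>K. reproducing Z K \<and> e = of_real (wexp Z) * K Z)"

lemma rawnsley_eps_at: "eps_at Z e \<Longrightarrow> rawnsley_eps n m \<mu> \<nu> \<alpha> Z = e"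
  by (auto simp: eps_at_def rawnsley_eps_def Kdiag_eq)

lemma H_scale: "f \<in> H \<Longrightarrow> (\<lambda>X. c * f X) \<in> H"
proof -
  assume f: "f \<in> H"
  note [measurable] = H_measurable[OF f]
  have "(\<integral>\<^sup>+X. ennreal ((cmod (c * f X))\<^sup>2) \<partial>M) = (\<integral>\<^sup>+X. ennreal ((cmod c)\<^sup>2) * ennreal ((cmod (f X))\<^sup>2) \<partial>M)"
    by (simp add: norm_mult power_mult_distrib ennreal_mult)
  also have "\<dots> = ennreal ((cmod c)\<^sup>2) * L2 f"
    by (rule nn_integral_cmult) measurable
  also have "\<dots> < \<infinity>" using f by (simp add: mem_H_iff ennreal_mult_less_top)
  finally show ?thesis using f by (auto simp: mem_H_iff intro: holo_several_mult holo_several_const)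
qed

text \<open>With U the operator \<open>pull T J\<close>, the representer at Z is the conjugate of
  J(Z) times U K, where K represents evaluation at T Z. Indeed, with h =
  \<open>pull T' J' f\<close>, J(Z) <f, U K> = J(Z) <h, K> = J(Z) h(T Z) = f(Z). Evaluating at Z
  produces the factor |J(Z)|^2, which turns e^(-\<alpha>\<Phi>(Z)) into e^(-\<alpha>\<Phi>(T
  Z)).\<close>

lemma eps_at_transfer:
  assumes T: "isometry T J T' J'" and Z: "Z \<in> D" and e: "eps_at (T Z) e"
  shows "eps_at Z e"
proof -
  obtain K where K: "reproducing (T Z) K" and eK: "e = of_real (wexp (T Z)) * K (T Z)"
    using e by (auto simp: eps_at_def)
  have TJ: "autom T J" "autom T' J'" using T by (auto simp: isometry_def)
  have KH: "K \<in> H" using K by (simp add: reproducing_def)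
  define K' where "K' = (\<lambda>X. cnj (J Z) * pull T J K X)"
  have PK: "pull T J K \<in> H" by (rule pull_in_H[OF TJ(1) KH])
  then have K'H: "K' \<in> H" unfolding K'_def by (rule H_scale)
  have "ip f K' = f Z" if f: "f \<in> H" for f
  proof -
    let ?g = "pull T' J' f"
    have g: "?g \<in> H" by (rule pull_in_H[OF TJ(2) f])
    have "ip f K' = (\<integral>X. J Z * (f X * cnj (pull T J K X)) \<partial>M)"
      unfolding Hinner_eq[OF H_measurable[OF f] H_measurable[OF K'H]] by (simp add: K'_def mult_ac)
    also have "\<dots> = J Z * ip f (pull T J K)"
      unfolding Hinner_eq[OF H_measurable[OF f] H_measurable[OF PK]] by (rule integral_mult_right_zero)
    also have "ip f (pull T J K) = ip (pull T J ?g) (pull T J K)"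
      by (simp add: isometry_pull_pull[OF T f])
    also have "\<dots> = ?g (T Z)" using Hinner_pull[OF TJ(1) g KH] K g by (simp add: reproducing_def)
    also have "J Z * ?g (T Z) = pull T J ?g Z" using Z by (simp add: pull_def[of T J])
    also have "\<dots> = f Z" by (simp add: isometry_pull_pull[OF T f])
    finally show ?thesis .
  qed
  then have "reproducing Z K'" using K'H by (simp add: reproducing_def)
  moreover have "of_real (wexp Z) * K' Z = of_real (wexp Z * (cmod (J Z))\<^sup>2) * K (T Z)"
    using Z by (simp add: K'_def pull_def complex_norm_square mult_ac del: of_real_power)
  ultimately show ?thesis unfolding eps_at_def eK using T Z by (metis isometry_def)
qed

text \<open>The counterpart for a trivial space: it is the vanishing of all functions at a point
  that is carried along.\<close>

lemma vanish_transfer: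
  assumes T: "isometry T J T' J'" and Z: "Z \<in> D" and v: "\<forall>f\<in>H. f (T Z) = 0"
  shows "\<forall>f\<in>H. f Z = 0"
proof
  fix f assume f: "f \<in> H"
  have "pull T' J' f \<in> H" using T f by (intro pull_in_H) (auto simp: isometry_def)
  then have "pull T J (pull T' J' f) Z = 0" using v by (simp add: pull_def[of T J])
  then show "f Z = 0" by (simp add: isometry_pull_pull[OF T f])
qed

end

section \<open>Coordinate changes and their Jacobians\<close>

definition scale_w :: "nat \<Rightarrow> nat \<Rightarrow> ((nat \<Rightarrow> complex) \<Rightarrow> complex) \<Rightarrow> (nat \<Rightarrow> complex) \<Rightarrow> nat \<Rightarrow> complex" where
  "scale_w n r e X = (\<lambda>k. if n \<le> k \<and> k < n + r then e X * X k else X k)"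

lemma measurable_scale_w:
  assumes "n + r \<le> N" and [measurable]: "e \<in> borel_measurable (lebesgue_CN N)"
  shows "scale_w n r e \<in> lebesgue_CN N \<rightarrow>\<^sub>M lebesgue_CN N"
proof (rule measurable_into_lebesgue_CN)
  show "(\<lambda>X. scale_w n r e X k) \<in> borel_measurable (lebesgue_CN N)" if "k < N" for k
    unfolding scale_w_def using that by (cases "n \<le> k \<and> k < n + r") simp_all
qed (use assms in \<open>auto simp: scale_w_def cspace_def PiE_def extensional_def\<close>)

text \<open>The factor e is free of the coordinates from n on, so the w-coordinates can be scaled
  one after the other, each contributing the squared modulus of e. The number r of scaled
  coordinates is the induction variable.\<close>

lemma nn_integral_scale_w:
  assumes r: "n + r \<le> N" and e: "e \<in> borel_measurable (lebesgue_CN N)" and e0: "\<And>X. e X \<noteq> 0"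
    and ei: "\<And>X j \<zeta>. n \<le> j \<Longrightarrow> e (X(j := \<zeta>)) = e X"
    and F: "F \<in> borel_measurable (lebesgue_CN N)"
  shows "(\<integral>\<^sup>+X. F (scale_w n r e X) * ennreal ((cmod (e X)) ^ (2 * r)) \<partial>lebesgue_CN N) = (\<integral>\<^sup>+X. F X \<partial>lebesgue_CN N)"
  using r
proof (induction r)
  case 0
  have "scale_w n 0 e X = X" for X by (auto simp: scale_w_def fun_eq_iff)
  then show ?case by simp
next
  case (Suc r)
  define G where "G = (\<lambda>X. F (scale_w n r e X) * ennreal ((cmod (e X)) ^ (2 * r)))"
  have G: "G \<in> borel_measurable (lebesgue_CN N)"
  proof -
    have "scale_w n r e \<in> lebesgue_CN N \<rightarrow>\<^sub>M lebesgue_CN N"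
      by (rule measurable_scale_w[OF _ e]) (use Suc in simp)
    note [measurable] = measurable_compose[OF this F] e
    show ?thesis unfolding G_def by measurable
  qed
  have sc: "scale_w n r e (X(n + r := e X * X (n + r))) = scale_w n (Suc r) e X" for X
    unfolding scale_w_def ei[OF le_add1] by (auto simp: fun_eq_iff less_Suc_eq)
  have "(\<integral>\<^sup>+X. F (scale_w n (Suc r) e X) * ennreal ((cmod (e X)) ^ (2 * Suc r)) \<partial>lebesgue_CN N) =
      (\<integral>\<^sup>+X. G (X(n + r := 0 + e X * X (n + r))) * ennreal ((cmod (e X))\<^sup>2) \<partial>lebesgue_CN N)"
    by (intro nn_integral_cong) (simp add: G_def sc ei mult.assoc ennreal_mult[symmetric] power_add[symmetric])
  also have "\<dots> = (\<integral>\<^sup>+X. G X \<partial>lebesgue_CN N)"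
    by (rule nn_integral_lebesgue_CN_affine[OF _ G e]) (use e0 ei Suc in auto)
  also have "\<dots> = (\<integral>\<^sup>+X. F X \<partial>lebesgue_CN N)" using Suc by (simp add: G_def)
  finally show ?case .
qed

lemma nn_integral_translate:
  assumes i: "i < N" and F: "F \<in> borel_measurable (lebesgue_CN N)"
  shows "(\<integral>\<^sup>+X. F (X(i := X i + b)) \<partial>lebesgue_CN N) = (\<integral>\<^sup>+X. F X \<partial>lebesgue_CN N)"
  using nn_integral_lebesgue_CN_affine[OF i F, of "\<lambda>_. 1" "\<lambda>_. b"] by (simp add: add.commute)

text \<open>The matrix is factored into two triangular steps. Coordinate i first becomes c X_i + d
  X_j; then j is replaced by the combination of the new i and the old j with coefficients - cnj d /
  c and 1 / c. The Jacobians of the two steps cancel, and the factorization is where c must be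
  nonzero.\<close>

lemma nn_integral_unitary_pair:
  fixes c d :: complex
  assumes i: "i < N" and j: "j < N" "i \<noteq> j" and F: "F \<in> borel_measurable (lebesgue_CN N)"
    and c: "c \<noteq> 0" and cd: "(cmod c)\<^sup>2 + (cmod d)\<^sup>2 = 1"
  shows "(\<integral>\<^sup>+X. F (X(i := c * X i + d * X j, j := - cnj d * X i + cnj c * X j)) \<partial>lebesgue_CN N) = (\<integral>\<^sup>+X. F X \<partial>lebesgue_CN N)"
proof -
  define B where "B = (\<lambda>X :: nat \<Rightarrow> complex. X(j := (- cnj d / c) * X i + (1 / c) * X j))"
  have ij[measurable]: "(\<lambda>X. X i) \<in> borel_measurable (lebesgue_CN N)" "(\<lambda>X. X j) \<in> borel_measurable (lebesgue_CN N)"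
    using i j by simp_all
  have B: "B \<in> lebesgue_CN N \<rightarrow>\<^sub>M lebesgue_CN N"
    unfolding B_def by (rule measurable_lebesgue_CN_fun_upd[OF j(1)]) auto
  have FB: "(\<lambda>X. F (B X) * ennreal ((cmod (1 / c))\<^sup>2)) \<in> borel_measurable (lebesgue_CN N)"
    using measurable_compose[OF B F] by measurable
  have cdn: "c * cnj c + d * cnj d = 1"
    using cd by (metis complex_norm_square of_real_1 of_real_add)
  have eq: "B (X(i := d * X j + c * X i)) = X(i := c * X i + d * X j, j := - cnj d * X i + cnj c * X j)" for X
  proof -
    have "(- cnj d / c) * (d * X j + c * X i) + (1 / c) * X j = - cnj d * X i + ((1 - d * cnj d) / c) * X j"
      using c by (simp add: field_simps)
    also have "(1 - d * cnj d) / c = cnj c" using cdn c by (simp add: field_simps)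
    finally show ?thesis using j by (auto simp: B_def fun_eq_iff add.commute)
  qed
  have "(\<integral>\<^sup>+X. F X \<partial>lebesgue_CN N) = (\<integral>\<^sup>+X. F (B X) * ennreal ((cmod (1 / c))\<^sup>2) \<partial>lebesgue_CN N)"
    unfolding B_def
    by (rule nn_integral_lebesgue_CN_affine[symmetric, OF j(1) F, of "\<lambda>_. 1 / c" "\<lambda>X. (- cnj d / c) * X i"]) (use c j in auto)
  also have "\<dots> = (\<integral>\<^sup>+X. (F (B (X(i := d * X j + c * X i))) * ennreal ((cmod (1 / c))\<^sup>2)) * ennreal ((cmod c)\<^sup>2) \<partial>lebesgue_CN N)"
    by (rule nn_integral_lebesgue_CN_affine[symmetric, OF i FB, of "\<lambda>_. c" "\<lambda>X. d * X j"]) (use c j in auto)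
  also have "\<dots> = (\<integral>\<^sup>+X. F (X(i := c * X i + d * X j, j := - cnj d * X i + cnj c * X j)) \<partial>lebesgue_CN N)"
  proof (intro nn_integral_cong)
    fix X
    have "ennreal ((cmod (1 / c))\<^sup>2) * ennreal ((cmod c)\<^sup>2) = 1"
      using c by (simp add: ennreal_mult[symmetric] norm_divide power_divide)
    then show "(F (B (X(i := d * X j + c * X i))) * ennreal ((cmod (1 / c))\<^sup>2)) * ennreal ((cmod c)\<^sup>2) =
       F (X(i := c * X i + d * X j, j := - cnj d * X i + cnj c * X j))"
      unfolding eq mult.assoc by simp
  qed
  finally show ?thesis ..
qed

lemma znorm2_fun_upd:
  "znorm2 n (X(i := x)) = znorm2 n X + (if i < n then (cmod x)\<^sup>2 - (cmod (X i))\<^sup>2 else 0)"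
proof -
  have "(cmod ((X(i := x)) k))\<^sup>2 = (cmod (X k))\<^sup>2 + (if k = i then (cmod x)\<^sup>2 - (cmod (X i))\<^sup>2 else 0)" for k
    by auto
  then show ?thesis by (simp add: znorm2_def sum.distrib)
qed

lemma wnorm2_fun_upd:
  assumes "i < n + m"
  shows "wnorm2 n m (X(i := x)) = wnorm2 n m X + (if i < n then 0 else (cmod x)\<^sup>2 - (cmod (X i))\<^sup>2)"
proof -
  have "(cmod ((X(i := x)) (n + k)))\<^sup>2 = (cmod (X (n + k)))\<^sup>2 + (if k = i - n then (if i < n then 0 else (cmod x)\<^sup>2 - (cmod (X i))\<^sup>2) else 0)" for k
    by auto
  then show ?thesis using assms by (auto simp: wnorm2_def sum.distrib)
qed

section \<open>Rotations in w and Heisenberg translations in z\<close>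

context hartogs
begin

definition "givens j c d X = X(n := c * X n + d * X j, j := - cnj d * X n + cnj c * X j)"

lemma givens_norm:
  assumes j: "n < j" "j < N" and cd: "(cmod c)\<^sup>2 + (cmod d)\<^sup>2 = 1"
  shows "znorm2 n (givens j c d X) = znorm2 n X" "wnorm2 n m (givens j c d X) = wnorm2 n m X"
    "s (givens j c d X) = s X" "V (givens j c d X) = V X"
proof -
  show z: "znorm2 n (givens j c d X) = znorm2 n X" using j by (simp add: givens_def znorm2_fun_upd)
  have "(cmod (c * X n + d * X j))\<^sup>2 + (cmod (- cnj d * X n + cnj c * X j))\<^sup>2 = ((cmod c)\<^sup>2 + (cmod d)\<^sup>2) * ((cmod (X n))\<^sup>2 + (cmod (X j))\<^sup>2)"
    unfolding cmod_power2 by (simp add: power2_eq_square algebra_simps)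
  then have "(cmod (c * X n + d * X j))\<^sup>2 + (cmod (- cnj d * X n + cnj c * X j))\<^sup>2 = (cmod (X n))\<^sup>2 + (cmod (X j))\<^sup>2"
    using cd by simp
  then show w: "wnorm2 n m (givens j c d X) = wnorm2 n m X"
    using j m1 by (simp add: givens_def wnorm2_fun_upd)
  show "s (givens j c d X) = s X" "V (givens j c d X) = V X" by (simp_all add: s_def V_def z w)
qed

lemma givens_cspace: "n < j \<Longrightarrow> j < N \<Longrightarrow> X \<in> cspace N \<Longrightarrow> givens j c d X \<in> cspace N"
  by (auto simp: givens_def cspace_def PiE_def extensional_def)

lemma autom_givens:
  assumes j: "n < j" "j < N" and cd: "(cmod c)\<^sup>2 + (cmod d)\<^sup>2 = 1" and c: "c \<noteq> 0"
  shows "autom (givens j c d) (\<lambda>_. 1)"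
  unfolding autom_def
proof (intro conjI allI impI ballI)
  show "givens j c d ` D \<subseteq> D" using j cd by (auto simp: mem_D_iff givens_norm givens_cspace)
  have m: "(\<lambda>X. X n) \<in> borel_measurable \<Lambda>" "(\<lambda>X. X j) \<in> borel_measurable \<Lambda>" using j m1 by simp_all
  show T: "givens j c d \<in> \<Lambda> \<rightarrow>\<^sub>M \<Lambda>"
    unfolding givens_def
    by (intro measurable_lebesgue_CN_fun_upd) (use j m1 m in \<open>auto intro!: borel_measurable_add borel_measurable_times\<close>)
  show "holo_several N D (\<lambda>X. givens j c d X k)" if "k < N" for k
  proof -
    have "holo_several N D (\<lambda>X. p * X n + q * X j)" for p q
      by (intro holo_several_add holo_several_mult holo_several_const holo_several_coordinate)
    from this[of c d] this[of "- cnj d" "cnj c"] show ?thesis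
      unfolding givens_def fun_upd_def
      by (cases "k = j"; cases "k = n") (simp_all add: holo_several_coordinate)
  qed
  show "holo_several N D (\<lambda>_. 1)" by (rule holo_several_const)
  fix G :: "(nat \<Rightarrow> complex) \<Rightarrow> ennreal" assume G[measurable]: "G \<in> borel_measurable \<Lambda>"
  have GT: "(\<lambda>X. G (givens j c d X)) \<in> borel_measurable \<Lambda>" by (rule measurable_compose[OF T G])
  have VG: "(\<lambda>X. ennreal (V X) * G X) \<in> borel_measurable \<Lambda>" by measurable
  have "(\<integral>\<^sup>+X. G (givens j c d X) * ennreal ((cmod 1)\<^sup>2) \<partial>M) = (\<integral>\<^sup>+X. ennreal (V (givens j c d X)) * G (givens j c d X) \<partial>\<Lambda>)"
    using M_nn_integral[OF GT] givens_norm(4)[OF j cd] by simp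
  also have "\<dots> = (\<integral>\<^sup>+X. ennreal (V X) * G X \<partial>\<Lambda>)"
    unfolding givens_def using nn_integral_unitary_pair[OF _ _ _ VG c cd, of n j] j by simp
  also have "\<dots> = (\<integral>\<^sup>+X. G X \<partial>M)" by (rule M_nn_integral[OF G, symmetric])
  finally show "(\<integral>\<^sup>+X. G (givens j c d X) * ennreal ((cmod 1)\<^sup>2) \<partial>M) = (\<integral>\<^sup>+X. G X \<partial>M)" .
qed simp

lemma isometry_givens:
  assumes j: "n < j" "j < N" and cd: "(cmod c)\<^sup>2 + (cmod d)\<^sup>2 = 1" and c: "c \<noteq> 0"
  shows "isometry (givens j c d) (\<lambda>_. 1) (givens j (cnj c) (- d)) (\<lambda>_. 1)"
  unfolding isometry_def
proof (intro conjI ballI)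
  fix X assume X: "X \<in> D"
  have cdn: "c * cnj c + d * cnj d = 1"
    using cd by (metis complex_norm_square of_real_1 of_real_add)
  have "cnj c * (c * X n + d * X j) + - d * (- cnj d * X n + cnj c * X j) = (c * cnj c + d * cnj d) * X n"
    "- cnj (- d) * (c * X n + d * X j) + cnj (cnj c) * (- cnj d * X n + cnj c * X j) = (c * cnj c + d * cnj d) * X j"
    by (simp_all add: algebra_simps)
  then show "givens j (cnj c) (- d) (givens j c d X) = X"
    unfolding cdn using j by (auto simp: givens_def fun_eq_iff)
  show "wexp X * (cmod 1)\<^sup>2 = wexp (givens j c d X)"
    using givens_norm[OF j cd] by (simp add: Phi_def)
  show "s (givens j c d X) = s X" by (rule givens_norm(3)[OF j cd])
qed (use autom_givens assms in auto)

text \<open>The Heisenberg translation $(z, w) \mapsto (z + b e_i, e^{-\mu(z_i\bar b + |b|^2/2)} w)$ and the multiplier that makes composition with it unitary.\<close>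

definition "hfac b x = exp (- of_real \<mu> * (x * cnj b + of_real ((cmod b)\<^sup>2) / 2))"
definition "heis i b X = (scale_w n m (\<lambda>X. hfac b (X i)) X)(i := X i + b)"
definition "hmult i b X = exp (- of_real (a * \<mu>) * (X i * cnj b + of_real ((cmod b)\<^sup>2) / 2))"

lemma cmod_hfac: "(cmod (hfac b x))\<^sup>2 = exp (- \<mu> * (2 * Re (x * cnj b) + (cmod b)\<^sup>2))"
  by (simp add: hfac_def norm_exp power2_eq_square exp_add[symmetric] algebra_simps)

lemma cmod_hmult: "(cmod (hmult i b X))\<^sup>2 = exp (- (a * \<mu>) * (2 * Re (X i * cnj b) + (cmod b)\<^sup>2))"
  by (simp add: hmult_def norm_exp power2_eq_square exp_add[symmetric] algebra_simps)

text \<open>Translation changes the squared norm of z by 2 Re(z_i cnj b) + |b|^2, and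
  \<open>hfac\<close> rescales w so that s is preserved. In the last identity the exponent m - a of
  \<open>V\<close> meets - m from scaling the m coordinates of w; the remaining - a dictates the
  multiplier \<open>hmult\<close>.\<close>

lemma heis_norm:
  assumes i: "i < n"
  shows "znorm2 n (heis i b X) = znorm2 n X + (2 * Re (X i * cnj b) + (cmod b)\<^sup>2)"
    and "wnorm2 n m (heis i b X) = exp (- \<mu> * (2 * Re (X i * cnj b) + (cmod b)\<^sup>2)) * wnorm2 n m X"
    and "s (heis i b X) = s X"
    and "V (heis i b X) * (cmod (hfac b (X i))) ^ (2 * m) = V X * (cmod (hmult i b X))\<^sup>2"
proof -
  let ?r = "2 * Re (X i * cnj b) + (cmod b)\<^sup>2"
  have zs: "znorm2 n (scale_w n m (\<lambda>X. hfac b (X i)) X) = znorm2 n X" by (simp add: znorm2_def scale_w_def)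
  have si: "scale_w n m (\<lambda>X. hfac b (X i)) X i = X i" using i by (simp add: scale_w_def)
  have "(cmod (X i + b))\<^sup>2 = (cmod (X i))\<^sup>2 + ?r"
    unfolding cmod_power2 by (simp add: power2_eq_square algebra_simps)
  then show z: "znorm2 n (heis i b X) = znorm2 n X + ?r"
    using i by (simp add: heis_def znorm2_fun_upd zs si)
  have "wnorm2 n m (scale_w n m (\<lambda>X. hfac b (X i)) X) = exp (- \<mu> * ?r) * wnorm2 n m X"
    by (simp add: wnorm2_def scale_w_def norm_mult power_mult_distrib cmod_hfac sum_distrib_left)
  then show w: "wnorm2 n m (heis i b X) = exp (- \<mu> * ?r) * wnorm2 n m X"
    using i by (simp add: heis_def wnorm2_fun_upd)
  have "exp (- \<mu> * ?r) * exp (\<mu> * (znorm2 n X + ?r)) = exp (\<mu> * znorm2 n X)"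
    by (simp flip: exp_add) (simp add: algebra_simps)
  then show s: "s (heis i b X) = s X" unfolding s_def z w by (simp add: mult_ac)
  have "(cmod (hfac b (X i))) ^ (2 * m) = exp (- \<mu> * ?r) ^ m"
    by (simp add: power_mult cmod_hfac)
  also have "\<dots> = exp (- (m * \<mu>) * ?r)" by (simp flip: exp_of_nat_mult)
  finally have "(cmod (hfac b (X i))) ^ (2 * m) = exp (- (m * \<mu>) * ?r)" .
  moreover have "exp ((real m - a) * \<mu> * (znorm2 n X + ?r)) * exp (- (m * \<mu>) * ?r) = exp ((real m - a) * \<mu> * znorm2 n X) * exp (- (a * \<mu>) * ?r)"
    by (simp flip: exp_add) (simp add: algebra_simps)
  ultimately show "V (heis i b X) * (cmod (hfac b (X i))) ^ (2 * m) = V X * (cmod (hmult i b X))\<^sup>2"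
    unfolding V_def s z cmod_hmult by (simp add: mult_ac)
qed

lemma hfac_nonzero: "hfac b x \<noteq> 0" by (simp add: hfac_def)

lemma hfac_hol: "hfac b holomorphic_on UNIV"
  unfolding hfac_def by (intro holomorphic_intros)

lemma hfac_measurable: "hfac b \<in> borel_measurable borel"
  by (intro borel_measurable_continuous_onI holomorphic_on_imp_continuous_on hfac_hol)

lemma autom_heis:
  assumes i: "i < n"
  shows "autom (heis i b) (hmult i b)"
  unfolding autom_def
proof (intro conjI allI impI ballI)
  have "heis i b X \<in> cspace N" if "X \<in> cspace N" for X
    using that i by (auto simp: heis_def scale_w_def cspace_def PiE_def extensional_def)
  then show "heis i b ` D \<subseteq> D" using i by (auto simp: mem_D_iff heis_norm)
  have mi: "(\<lambda>X. X i) \<in> borel_measurable \<Lambda>" using i by simp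
  have me: "(\<lambda>X. hfac b (X i)) \<in> borel_measurable \<Lambda>" by (rule measurable_compose[OF mi hfac_measurable])
  have sc: "scale_w n m (\<lambda>X. hfac b (X i)) \<in> \<Lambda> \<rightarrow>\<^sub>M \<Lambda>"
    by (rule measurable_scale_w[OF _ me]) simp
  show T: "heis i b \<in> \<Lambda> \<rightarrow>\<^sub>M \<Lambda>"
    unfolding heis_def by (rule measurable_lebesgue_CN_fun_upd) (use i sc mi in auto)
  have hol_e: "holo_several N D (\<lambda>X. hfac b (X i))"
    by (rule holo_several_outer[OF holo_several_coordinate hfac_hol]) auto
  show "holo_several N D (\<lambda>X. heis i b X k)" if "k < N" for k
    unfolding heis_def fun_upd_def scale_w_def
    by (cases "k = i"; cases "n \<le> k \<and> k < n + m")
      (use hol_e in \<open>auto intro!: holo_several_add holo_several_mult holo_several_const holo_several_coordinate\<close>)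
  have "(\<lambda>x. exp (- complex_of_real (a * \<mu>) * (x * cnj b + of_real ((cmod b)\<^sup>2) / 2))) holomorphic_on UNIV"
    by (intro holomorphic_intros)
  then show "holo_several N D (hmult i b)"
    unfolding hmult_def by (rule holo_several_outer[OF holo_several_coordinate]) auto
  show J: "hmult i b \<in> borel_measurable \<Lambda>"
    unfolding hmult_def using mi by (intro measurable_compose[OF mi] borel_measurable_continuous_onI continuous_intros)
  fix G :: "(nat \<Rightarrow> complex) \<Rightarrow> ennreal" assume G[measurable]: "G \<in> borel_measurable \<Lambda>"
  have GT: "(\<lambda>X. G (heis i b X) * ennreal ((cmod (hmult i b X))\<^sup>2)) \<in> borel_measurable \<Lambda>"
    using measurable_compose[OF T G] J by measurable
  define F where "F = (\<lambda>X. ennreal (V X) * G X)"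
  have F: "F \<in> borel_measurable \<Lambda>" unfolding F_def by measurable
  have Fs: "(\<lambda>X. F (X(i := X i + b))) \<in> borel_measurable \<Lambda>"
    by (rule measurable_compose[OF _ F], rule measurable_lebesgue_CN_fun_upd) (use i mi in auto)
  have "(\<integral>\<^sup>+X. G (heis i b X) * ennreal ((cmod (hmult i b X))\<^sup>2) \<partial>M) = (\<integral>\<^sup>+X. ennreal (V X) * (G (heis i b X) * ennreal ((cmod (hmult i b X))\<^sup>2)) \<partial>\<Lambda>)"
    by (rule M_nn_integral[OF GT])
  \<comment> \<open>Scaling w leaves z_i alone, so the translation is a scaling with the factor
    evaluated at the old z_i, followed by a shift of coordinate i. The two are undone in
    turn.\<close>
  also have "\<dots> = (\<integral>\<^sup>+X. F ((scale_w n m (\<lambda>X. hfac b (X i)) X)(i := scale_w n m (\<lambda>X. hfac b (X i)) X i + b)) * ennreal ((cmod (hfac b (X i))) ^ (2 * m)) \<partial>\<Lambda>)"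
  proof (rule nn_integral_cong)
    fix X
    have si: "scale_w n m (\<lambda>X. hfac b (X i)) X i = X i" using i by (simp add: scale_w_def)
    have "F (heis i b X) * ennreal ((cmod (hfac b (X i))) ^ (2 * m)) = ennreal (V (heis i b X) * (cmod (hfac b (X i))) ^ (2 * m)) * G (heis i b X)"
      by (simp add: F_def ennreal_mult V_nonneg mult_ac)
    also have "\<dots> = ennreal (V X) * (G (heis i b X) * ennreal ((cmod (hmult i b X))\<^sup>2))"
      unfolding heis_norm(4)[OF i] by (simp add: ennreal_mult V_nonneg mult_ac)
    finally show "ennreal (V X) * (G (heis i b X) * ennreal ((cmod (hmult i b X))\<^sup>2)) =
      F ((scale_w n m (\<lambda>X. hfac b (X i)) X)(i := scale_w n m (\<lambda>X. hfac b (X i)) X i + b)) * ennreal ((cmod (hfac b (X i))) ^ (2 * m))"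
      unfolding si heis_def[symmetric] ..
  qed
  also have "\<dots> = (\<integral>\<^sup>+X. F (X(i := X i + b)) \<partial>\<Lambda>)"
    by (rule nn_integral_scale_w[OF _ me hfac_nonzero _ Fs]) (use i in auto)
  also have "\<dots> = (\<integral>\<^sup>+X. F X \<partial>\<Lambda>)" by (rule nn_integral_translate[OF _ F]) (use i in simp)
  also have "\<dots> = (\<integral>\<^sup>+X. G X \<partial>M)" unfolding F_def by (rule M_nn_integral[OF G, symmetric])
  finally show "(\<integral>\<^sup>+X. G (heis i b X) * ennreal ((cmod (hmult i b X))\<^sup>2) \<partial>M) = (\<integral>\<^sup>+X. G X \<partial>M)" .
qed

lemma isometry_heis:
  assumes i: "i < n"
  shows "isometry (heis i b) (hmult i b) (heis i (- b)) (hmult i (- b))"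
  unfolding isometry_def
proof (intro conjI ballI)
  fix X assume X: "X \<in> D"
  have bb: "b * cnj b = of_real ((cmod b)\<^sup>2)" by (simp only: complex_norm_square)
  have hi: "heis i b X i = X i + b" by (simp add: heis_def)
  \<comment> \<open>The half in |b|^2 / 2 is what makes the translations by b and - b inverse: the
    cross term - |b|^2 cancels the two halves.\<close>
  have "hfac (- b) (X i + b) * hfac b (X i) = 1"
    unfolding hfac_def exp_add[symmetric] using bb by (simp add: algebra_simps)
  then have hh: "hfac (- b) (X i + b) * (hfac b (X i) * x) = x" for x by (simp flip: mult.assoc)
  show "heis i (- b) (heis i b X) = X"
    using i by (auto simp: heis_def scale_w_def fun_eq_iff hh)
  show "hmult i b X * hmult i (- b) (heis i b X) = 1"
    unfolding hmult_def exp_add[symmetric] hi using bb by (simp add: algebra_simps)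
  show s: "s (heis i b X) = s X" by (rule heis_norm(3)[OF i])
  have TX: "heis i b X \<in> D" using autom_heis[OF i, of b] X by (auto simp: autom_def)
  show "wexp X * (cmod (hmult i b X))\<^sup>2 = wexp (heis i b X)"
    unfolding exp_Phi[OF X] exp_Phi[OF TX] cmod_hmult s heis_norm(1)[OF i]
    by (simp add: exp_add[symmetric] mult_ac) (simp add: algebra_simps exp_add[symmetric])
qed (use autom_heis[OF i] in auto)

end

context hartogs
begin

section \<open>Reproducing kernels\<close>

definition "Z0 \<tau> = (\<lambda>k. if k < N then (if k = n then \<tau> else 0) else undefined :: complex)"

lemma Z0_norm: "znorm2 n (Z0 \<tau>) = 0" "wnorm2 n m (Z0 \<tau>) = (cmod \<tau>)\<^sup>2" "s (Z0 \<tau>) = (cmod \<tau>)\<^sup>2"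
proof -
  show z: "znorm2 n (Z0 \<tau>) = 0" by (simp add: znorm2_def Z0_def)
  have "wnorm2 n m (Z0 \<tau>) = (\<Sum>i<m. if i = 0 then (cmod \<tau>)\<^sup>2 else 0)"
    unfolding wnorm2_def by (intro sum.cong) (auto simp: Z0_def)
  then show w: "wnorm2 n m (Z0 \<tau>) = (cmod \<tau>)\<^sup>2" using m1 by simp
  show "s (Z0 \<tau>) = (cmod \<tau>)\<^sup>2" by (simp add: s_def z w)
qed

lemma Z0_cspace: "Z0 \<tau> \<in> cspace N"
  by (auto simp: Z0_def cspace_def PiE_def extensional_def)

lemma Z0_D: "Z0 \<tau> \<in> D \<longleftrightarrow> cmod \<tau> < 1"
  by (simp add: mem_D_iff Z0_norm Z0_cspace power_less_one_iff abs_square_less_1)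

lemma isometry_D: "isometry T J T' J' \<Longrightarrow> X \<in> D \<Longrightarrow> T X \<in> D"
  by (auto simp: isometry_def autom_def)

section \<open>Moving a point to the first w-axis\<close>

definition "nonzero_coords Z = {k. k < N \<and> k \<noteq> n \<and> Z k \<noteq> (0::complex)}"

lemma finite_nonzero_coords: "finite (nonzero_coords Z)" by (simp add: nonzero_coords_def)

lemma kill_w_coordinate:
  assumes Z: "Z \<in> D" and k: "k \<in> nonzero_coords Z" "n < k" and Zn: "Z n \<noteq> 0"
  obtains T J T' J' where "isometry T J T' J'" "nonzero_coords (T Z) \<subseteq> nonzero_coords Z - {k}"
proof -
  define r where "r = sqrt ((cmod (Z n))\<^sup>2 + (cmod (Z k))\<^sup>2)"
  have r: "r > 0" using Zn by (simp add: r_def sum_power2_gt_zero_iff)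
  have r2: "r\<^sup>2 = (cmod (Z n))\<^sup>2 + (cmod (Z k))\<^sup>2" by (simp add: r_def)
  \<comment> \<open>The pair (c, d) is the conjugate of the normalized vector (Z_n, Z_k). The
    rotation then sends (Z_n, Z_k) to (r, 0).\<close>
  define c d where "c = cnj (Z n) / of_real r" and "d = cnj (Z k) / of_real r"
  have kN: "k < N" using k by (simp add: nonzero_coords_def)
  have cd: "(cmod c)\<^sup>2 + (cmod d)\<^sup>2 = 1"
    using r by (simp add: c_def d_def norm_divide power_divide flip: add_divide_distrib r2)
  have "isometry (givens k c d) (\<lambda>_. 1) (givens k (cnj c) (- d)) (\<lambda>_. 1)"
    by (rule isometry_givens[OF k(2) kN cd]) (use Zn r in \<open>simp add: c_def\<close>)
  moreover have "givens k c d Z k = 0" using k by (simp add: givens_def c_def d_def)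
  then have "nonzero_coords (givens k c d Z) \<subseteq> nonzero_coords Z - {k}" by (auto simp: nonzero_coords_def givens_def split: if_splits)
  ultimately show ?thesis using that by blast
qed

text \<open>Induction on the number of nonzero coordinates besides the first $w$-coordinate: a translation kills a $z$-coordinate, a Givens rotation a $w$-coordinate.\<close>

lemma reduce_to_Z0:
  assumes step: "\<And>Z T J T' J'. isometry T J T' J' \<Longrightarrow> Z \<in> D \<Longrightarrow> P (T Z) \<Longrightarrow> P Z"
    and base: "\<And>\<tau>. cmod \<tau> < 1 \<Longrightarrow> P (Z0 \<tau>)" and Z: "Z \<in> D"
  shows "P Z"
  using Z
proof (induction "card (nonzero_coords Z)" arbitrary: Z rule: less_induct)
  case less
  have IH: "P W" if "W \<in> D" "nonzero_coords W \<subseteq> nonzero_coords Z - {k}" "k \<in> nonzero_coords Z" for W k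
  proof (rule less.hyps[OF _ that(1)])
    show "card (nonzero_coords W) < card (nonzero_coords Z)" using that by (intro psubset_card_mono finite_nonzero_coords) auto
  qed
  show ?case
  proof (cases "nonzero_coords Z = {}")
    case True
    have "Z \<in> cspace N" using less.prems by (simp add: mem_D_iff)
    then have "Z k = Z0 (Z n) k" for k
      using True by (cases "k < N") (auto simp: Z0_def nonzero_coords_def cspace_def PiE_def extensional_def)
    then have ZZ: "Z0 (Z n) = Z" by (intro ext) (rule sym)
    have "P (Z0 (Z n))" by (rule base) (use less.prems Z0_D[of "Z n"] in \<open>simp only: ZZ\<close>)
    then show ?thesis by (simp only: ZZ)
  next
    case False
    then obtain k where k: "k \<in> nonzero_coords Z" by blast
    show ?thesis
    proof (cases "k < n")
      case True
      have iso: "isometry (heis k (- Z k)) (hmult k (- Z k)) (heis k (- (- Z k))) (hmult k (- (- Z k)))"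
        by (rule isometry_heis[OF True])
      have "nonzero_coords (heis k (- Z k) Z) \<subseteq> nonzero_coords Z - {k}"
        by (auto simp: nonzero_coords_def heis_def scale_w_def split: if_splits)
      then have "P (heis k (- Z k) Z)" by (rule IH[OF isometry_D[OF iso less.prems] _ k])
      then show ?thesis by (rule step[OF iso less.prems])
    next
      case False
      then have kn: "n < k" "k < N" using k by (auto simp: nonzero_coords_def)
      have main: "P W" if W: "W \<in> D" "k \<in> nonzero_coords W" "W n \<noteq> 0" "nonzero_coords W \<subseteq> nonzero_coords Z" for W
      proof -
        obtain T J T' J' where T: "isometry T J T' J'" "nonzero_coords (T W) \<subseteq> nonzero_coords W - {k}"
          using kill_w_coordinate[OF W(1,2) kn(1) W(3)] by blast
        have "P (T W)" by (rule IH[OF isometry_D[OF T(1) W(1)] _ k]) (use T W in blast)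
        then show "P W" by (rule step[OF T(1) W(1)])
      qed
      show ?thesis
      proof (cases "Z n = 0")
        case False
        then show ?thesis using main less.prems k by blast
      next
        case True
        \<comment> \<open>If Z_n = 0, the rotation that kills Z_k would have c = 0, which is
          excluded. A rotation by 45 degrees first makes coordinate n nonzero; that coordinate is
          not counted, so the induction measure does not grow.\<close>
        define c where "c = complex_of_real (1 / sqrt 2)"
        have c: "c \<noteq> 0" "(cmod c)\<^sup>2 + (cmod c)\<^sup>2 = 1" by (simp_all add: c_def norm_divide power_divide)
        have iso: "isometry (givens k c c) (\<lambda>_. 1) (givens k (cnj c) (- c)) (\<lambda>_. 1)"
          by (rule isometry_givens[OF kn c(2,1)])
        have Zk: "Z k \<noteq> 0" using k by (simp add: nonzero_coords_def)
        have "P (givens k c c Z)"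
        proof (rule main)
          show "givens k c c Z \<in> D" by (rule isometry_D[OF iso less.prems])
          show "k \<in> nonzero_coords (givens k c c Z)" "givens k c c Z n \<noteq> 0" "nonzero_coords (givens k c c Z) \<subseteq> nonzero_coords Z"
            using True Zk c kn by (auto simp: nonzero_coords_def givens_def split: if_splits)
        qed
        then show ?thesis by (rule step[OF iso less.prems])
      qed
    qed
  qed
qed

section \<open>Averages over the phase of one coordinate\<close>

definition "phase i \<theta> X = X(i := cis (2 * pi * \<theta>) * X i)" for X :: "nat \<Rightarrow> complex"

lemma phase_norm:
  assumes i: "i < N"
  shows "znorm2 n (phase i \<theta> X) = znorm2 n X" "wnorm2 n m (phase i \<theta> X) = wnorm2 n m X"
    "s (phase i \<theta> X) = s X" "V (phase i \<theta> X) = V X"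
proof -
  show z: "znorm2 n (phase i \<theta> X) = znorm2 n X" by (simp add: phase_def znorm2_fun_upd norm_mult)
  show w: "wnorm2 n m (phase i \<theta> X) = wnorm2 n m X" using i by (simp add: phase_def wnorm2_fun_upd norm_mult)
  show "s (phase i \<theta> X) = s X" "V (phase i \<theta> X) = V X" by (simp_all add: s_def V_def z w)
qed

lemma measurable_M_eq: "borel_measurable M = borel_measurable \<Lambda>"
  by (rule measurable_cong_sets) (simp_all add: sets_M)

lemma measurable_M_M: "M' \<rightarrow>\<^sub>M M = M' \<rightarrow>\<^sub>M \<Lambda>"
  by (rule measurable_cong_sets) (simp_all add: sets_M)

lemma phase_measurable:
  assumes i: "i < N"
  shows "phase i \<theta> \<in> M \<rightarrow>\<^sub>M M" "(\<lambda>p. phase i (fst p) (snd p)) \<in> unit_interval \<Otimes>\<^sub>M M \<rightarrow>\<^sub>M M"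
proof -
  have [measurable]: "(\<lambda>X. X i) \<in> borel_measurable M" unfolding measurable_M_eq using i by simp
  have s: "(\<lambda>X. X) \<in> M \<rightarrow>\<^sub>M \<Lambda>" by (simp flip: measurable_M_M)
  show "phase i \<theta> \<in> M \<rightarrow>\<^sub>M M"
    unfolding phase_def measurable_M_M by (rule measurable_lebesgue_CN_fun_upd[OF i s]) measurable
  have [measurable]: "(\<lambda>\<theta>. \<theta>) \<in> borel_measurable unit_interval"
    unfolding unit_interval_def by (rule measurable_restrict_space1) simp
  have [measurable]: "cis \<in> borel_measurable borel"
    by (intro borel_measurable_continuous_onI continuous_intros)
  have "(\<lambda>p. snd p) \<in> unit_interval \<Otimes>\<^sub>M M \<rightarrow>\<^sub>M \<Lambda>" by (simp flip: measurable_M_M)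
  then show "(\<lambda>p. phase i (fst p) (snd p)) \<in> unit_interval \<Otimes>\<^sub>M M \<rightarrow>\<^sub>M M"
    unfolding phase_def measurable_M_M by (rule measurable_lebesgue_CN_fun_upd[OF i]) measurable
qed

lemma phase_invariant:
  assumes i: "i < N" and F: "F \<in> borel_measurable M"
  shows "(\<integral>\<^sup>+X. F (phase i \<theta> X) \<partial>M) = (\<integral>\<^sup>+X. F X \<partial>M)"
proof -
  have F': "F \<in> borel_measurable \<Lambda>" using F by (simp add: measurable_M_eq)
  note [measurable] = F'
  have FR: "(\<lambda>X. F (phase i \<theta> X)) \<in> borel_measurable \<Lambda>"
    using measurable_compose[OF phase_measurable(1)[OF i] F] by (simp add: measurable_M_eq)
  have VF: "(\<lambda>X. ennreal (V X) * F X) \<in> borel_measurable \<Lambda>" by measurable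
  have "(\<integral>\<^sup>+X. F (phase i \<theta> X) \<partial>M) = (\<integral>\<^sup>+X. ennreal (V (phase i \<theta> X)) * F (phase i \<theta> X) \<partial>\<Lambda>)"
    by (simp add: M_nn_integral[OF FR] phase_norm(4)[OF i])
  also have "\<dots> = (\<integral>\<^sup>+X. ennreal (V X) * F X \<partial>\<Lambda>)"
    using nn_integral_lebesgue_CN_affine[OF i VF, of "\<lambda>_. cis (2 * pi * \<theta>)" "\<lambda>_. 0"] by (simp add: phase_def)
  also have "\<dots> = (\<integral>\<^sup>+X. F X \<partial>M)" by (rule M_nn_integral[OF F', symmetric])
  finally show ?thesis .
qed

lemma M_nn_average:
  assumes "i < N" "G \<in> borel_measurable \<Lambda>"
  shows "(\<integral>\<^sup>+X. G X \<partial>M) = (\<integral>\<^sup>+X. \<integral>\<^sup>+\<theta>. G (phase i \<theta> X) \<partial>unit_interval \<partial>M)"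
  by (rule nn_integral_average[OF prob_space_unit_interval sigma_finite_M phase_measurable(2) phase_invariant])
    (use assms in \<open>simp_all add: measurable_M_eq\<close>)

lemma M_average:
  assumes "i < N" "integrable M (G :: _ \<Rightarrow> complex)"
  shows "(\<integral>X. G X \<partial>M) = (\<integral>X. \<integral>\<theta>. G (phase i \<theta> X) \<partial>unit_interval \<partial>M)"
  by (rule integral_average[OF prob_space_unit_interval sigma_finite_M phase_measurable(2) phase_measurable(1) phase_invariant])
    (use assms in simp_all)

text \<open>The domain is a complete Reinhardt domain: lowering the modulus of a coordinate lowers
  both squared norms, hence s.\<close>

lemma slice_mono:
  assumes "X(i := \<zeta>') \<in> D" "i < N" "cmod \<zeta> \<le> cmod \<zeta>'"
  shows "X(i := \<zeta>) \<in> D"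
proof -
  have c: "X(i := \<zeta>) \<in> cspace N"
    using assms(1,2) D_cspace by (force simp: cspace_def PiE_def extensional_def)
  have *: "(cmod \<zeta>)\<^sup>2 \<le> (cmod \<zeta>')\<^sup>2" using assms by (intro power_mono) auto
  have "znorm2 n (X(i := \<zeta>)) \<le> znorm2 n (X(i := \<zeta>'))" using * by (simp add: znorm2_fun_upd)
  then have "exp (\<mu> * znorm2 n (X(i := \<zeta>))) \<le> exp (\<mu> * znorm2 n (X(i := \<zeta>')))" using \<mu>0 by simp
  moreover have "wnorm2 n m (X(i := \<zeta>)) \<le> wnorm2 n m (X(i := \<zeta>'))" using * assms by (simp add: wnorm2_fun_upd)
  ultimately have "s (X(i := \<zeta>)) \<le> s (X(i := \<zeta>'))"
    unfolding s_def by (intro mult_mono) (auto simp: wnorm2_nonneg)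
  then show ?thesis using assms(1) c by (simp add: mem_D_iff)
qed

text \<open>Openness yields a point whose i-th coordinate has the same phase and a slightly larger
  modulus; monotonicity in the modulus then fills the whole disc about 0.\<close>

lemma slice_disc:
  assumes X: "X \<in> D" and i: "i < N"
  obtains r where "cmod (X i) < r" "\<And>\<zeta>. \<zeta> \<in> ball 0 r \<Longrightarrow> X(i := \<zeta>) \<in> D"
proof -
  obtain \<epsilon> where \<epsilon>: "\<epsilon> > 0" "\<And>\<zeta>. \<zeta> \<in> ball (X i) \<epsilon> \<Longrightarrow> X(i := \<zeta>) \<in> D"
    using fun_upd_in_open_slice[OF open_res_D D_cspace X i] by blast
  define u where "u = (if X i = 0 then 1 else sgn (X i))"
  have u: "cmod u = 1" "X i = of_real (cmod (X i)) * u"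
    by (auto simp: u_def norm_sgn) (simp add: sgn_div_norm scaleR_conv_of_real)
  define \<zeta>' where "\<zeta>' = of_real (cmod (X i) + \<epsilon> / 2) * u"
  have "\<zeta>' - X i = of_real (\<epsilon> / 2) * u" using u(2) by (simp add: \<zeta>'_def algebra_simps)
  then have "cmod (\<zeta>' - X i) = cmod (of_real (\<epsilon> / 2)) * cmod u" by (simp only: norm_mult)
  then have "dist (X i) \<zeta>' < \<epsilon>" using u(1) \<epsilon>(1) by (simp add: dist_norm norm_minus_commute[of "X i"])
  then have 1: "X(i := \<zeta>') \<in> D" using \<epsilon> by simp
  have "cmod \<zeta>' = cmod (X i) + \<epsilon> / 2"
    using u(1) \<epsilon>(1) by (simp add: \<zeta>'_def norm_mult del: of_real_add of_real_divide)
  then show ?thesis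
    using that[of "cmod (X i) + \<epsilon> / 2"] slice_mono[OF 1 i] \<epsilon>(1) by auto
qed

lemma slice_holomorphic:
  assumes f: "holo_several N D f" and i: "i < N" and X: "\<And>\<zeta>. \<zeta> \<in> S \<Longrightarrow> X(i := \<zeta>) \<in> D"
  shows "(\<lambda>\<zeta>. f (X(i := \<zeta>))) holomorphic_on S"
proof -
  have "(\<lambda>\<zeta>. f (X(i := \<zeta>))) field_differentiable at \<zeta>" if "\<zeta> \<in> S" for \<zeta>
  proof -
    have "(\<lambda>\<zeta>'. f ((X(i := \<zeta>))(i := \<zeta>'))) field_differentiable at ((X(i := \<zeta>)) i)"
      using f X[OF that] i unfolding holo_several_def by blast
    then show ?thesis by simp
  qed
  then show ?thesis by (meson field_differentiable_at_within holomorphic_on_def)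
qed

section \<open>Averaging out coordinates by setting them to zero\<close>

definition zero_out :: "nat set \<Rightarrow> ((nat \<Rightarrow> complex) \<Rightarrow> complex) \<Rightarrow> (nat \<Rightarrow> complex) \<Rightarrow> complex" where
  "zero_out S f X = (if X \<in> D then f (\<lambda>k. if k \<in> S then 0 else X k) else 0)"

lemma fun_upd_zero_D: "X \<in> D \<Longrightarrow> i < N \<Longrightarrow> X(i := 0) \<in> D"
  using slice_mono[of X i "X i" 0] by simp

lemma phase_D: "i < N \<Longrightarrow> X \<in> D \<Longrightarrow> phase i \<theta> X \<in> D"
  by (auto simp: mem_D_iff phase_norm) (auto simp: phase_def cspace_def PiE_def extensional_def)

text \<open>By the mean value property, setting coordinate i to 0 is averaging f over the phase of
  that coordinate. The k = 0 case of the Bessel bound, integrated against the phase-invariant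
  measure, shows that the norm does not increase.\<close>

lemma zero_out_single:
  assumes f: "f \<in> H" and i: "i < N"
  shows "zero_out {i} f \<in> H" "L2 (zero_out {i} f) \<le> L2 f"
proof -
  have fh: "holo_several N D f" using f by (simp add: mem_H_iff)
  note [measurable] = H_measurable[OF f]
  have eq: "(\<lambda>k. if k = i then 0 else X k) = X(i := 0)" for X :: "nat \<Rightarrow> complex" by auto
  show le: "L2 (zero_out {i} f) \<le> L2 f"
  proof -
    have m: "(\<lambda>X. ennreal ((cmod (f X))\<^sup>2)) \<in> borel_measurable \<Lambda>" by measurable
    have "L2 (zero_out {i} f) \<le> (\<integral>\<^sup>+X. \<integral>\<^sup>+\<theta>. ennreal ((cmod (f (phase i \<theta> X)))\<^sup>2) \<partial>unit_interval \<partial>M)"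
    proof (rule nn_integral_mono_AE)
      show "AE X in M. ennreal ((cmod (zero_out {i} f X))\<^sup>2) \<le> (\<integral>\<^sup>+\<theta>. ennreal ((cmod (f (phase i \<theta> X)))\<^sup>2) \<partial>unit_interval)"
        using AE_M_D
      proof eventually_elim
        case (elim X)
        obtain r where r: "cmod (X i) < r" "\<And>\<zeta>. \<zeta> \<in> ball 0 r \<Longrightarrow> X(i := \<zeta>) \<in> D"
          using slice_disc[OF elim i] by blast
        from Taylor_coefficient_square_le[OF slice_holomorphic[OF fh i r(2)] r(1), of 0]
        show ?case using elim by (simp add: zero_out_def eq phase_def)
      qed
    qed
    also have "\<dots> = L2 f" by (rule M_nn_average[OF i m, symmetric])
    finally show ?thesis .
  qed
  have "holo_several N D (\<lambda>X. f (X(i := 0)))"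
  proof (rule holo_several_compose[OF open_res_D D_cspace fh])
    show "holo_several N D (\<lambda>X. (X(i := 0)) k)" for k
      by (cases "k = i") (simp_all add: holo_several_const holo_several_coordinate)
  qed (rule fun_upd_zero_D[OF _ i])
  then have "holo_several N D (zero_out {i} f)"
    by (rule holo_several_cong[OF open_res_D D_cspace, rotated]) (simp add: zero_out_def eq)
  moreover have "L2 f < \<infinity>" using f by (simp add: mem_H_iff)
  ultimately show "zero_out {i} f \<in> H" using le by (auto simp: mem_H_iff zero_out_def elim: le_less_trans)
qed

lemma zero_out_insert:
  assumes "i < N"
  shows "zero_out (insert i S) f = zero_out {i} (zero_out S f)"
proof
  fix X :: "nat \<Rightarrow> complex"
  have e1: "(\<lambda>k. if k = i then 0 else X k) = X(i := 0)" by auto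
  have e2: "(\<lambda>k. if k \<in> S then 0 else (X(i := 0)) k) = (\<lambda>k. if k \<in> insert i S then 0 else X k)" by auto
  show "zero_out (insert i S) f X = zero_out {i} (zero_out S f) X"
  proof (cases "X \<in> D")
    case True
    then have "zero_out {i} (zero_out S f) X = zero_out S f (X(i := 0))" by (simp add: zero_out_def[of "{i}"] e1)
    also have "\<dots> = f (\<lambda>k. if k \<in> insert i S then 0 else X k)"
      unfolding zero_out_def e2 using fun_upd_zero_D[OF True assms] by (rule if_P)
    finally show ?thesis using True unfolding zero_out_def[of "insert i S"] by simp
  qed (simp add: zero_out_def)
qed

lemma zero_out_H:
  assumes f: "f \<in> H" and S: "S \<subseteq> {..<N}"
  shows "zero_out S f \<in> H \<and> L2 (zero_out S f) \<le> L2 f"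
  using finite_subset[OF S finite_lessThan] S
proof (induction S rule: finite_induct)
  case empty
  have "zero_out {} f = f" using f by (auto simp: zero_out_def mem_H_iff)
  then show ?case using f by simp
next
  case (insert i S)
  then have i: "i < N" by auto
  have IH: "zero_out S f \<in> H" "L2 (zero_out S f) \<le> L2 f"
    using insert by auto
  note eq = zero_out_insert[OF i, of S f]
  show ?case
    using zero_out_single(1)[OF IH(1) i] order_trans[OF zero_out_single(2)[OF IH(1) i] IH(2)]
    by (subst (1 2) eq) (rule conjI)
qed

text \<open>On a finite measure space square integrability gives integrability, here through |f| <=
  1 + |f|^2.\<close>

lemma H_integrable:
  assumes fin: "emeasure M (space M) < \<infinity>" and f: "f \<in> H"
  shows "integrable M f"
proof -
  have [measurable]: "f \<in> borel_measurable M" using H_measurable[OF f] by (simp add: measurable_M_eq)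
  have "(\<integral>\<^sup>+X. ennreal (cmod (f X)) \<partial>M) \<le> (\<integral>\<^sup>+X. 1 + ennreal ((cmod (f X))\<^sup>2) \<partial>M)"
  proof (rule nn_integral_mono)
    fix X
    have "cmod (f X) \<le> 1 + (cmod (f X))\<^sup>2"
    proof -
      have "2 * cmod (f X) \<le> (cmod (f X))\<^sup>2 + 1" using sum_squares_bound[of "cmod (f X)" 1] by simp
      moreover have "0 \<le> cmod (f X)" by simp
      ultimately show ?thesis by linarith
    qed
    then have "ennreal (cmod (f X)) \<le> ennreal (1 + (cmod (f X))\<^sup>2)" by (rule ennreal_leI)
    then show "ennreal (cmod (f X)) \<le> 1 + ennreal ((cmod (f X))\<^sup>2)" by simp
  qed
  also have "\<dots> = emeasure M (space M) + L2 f"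
    by (subst nn_integral_add) auto
  also have "\<dots> < \<infinity>" using fin f by (simp add: mem_H_iff)
  finally show ?thesis by (simp add: integrable_iff_bounded)
qed

lemma integrable_times_bounded:
  fixes f g :: "(nat \<Rightarrow> complex) \<Rightarrow> complex"
  assumes f: "integrable M f" and g: "g \<in> borel_measurable \<Lambda>" and b: "\<And>X. cmod (g X) \<le> B"
  shows "integrable M (\<lambda>X. f X * g X)"
proof (rule Bochner_Integration.integrable_bound[of M "\<lambda>X. of_real B * f X"])
  show "integrable M (\<lambda>X. of_real B * f X)" using f by simp
  show "(\<lambda>X. f X * g X) \<in> borel_measurable M" using f g by (auto simp: measurable_M_eq)
  have "B \<ge> 0" using b[of undefined] norm_ge_zero order_trans by blast
  then show "AE X in M. norm (f X * g X) \<le> norm (of_real B * f X)"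
    using b by (intro AE_I2) (simp add: norm_mult mult.commute[of B] mult_left_mono)
qed

text \<open>If g does not see the phases of the coordinates in S, replacing f by its phase average
  leaves the integral of f g unchanged. Boundedness of g makes the integrals converge absolutely, as
  Fubini demands.\<close>

lemma integral_zero_out:
  assumes fin: "emeasure M (space M) < \<infinity>" and f: "f \<in> H" and S: "S \<subseteq> {..<N}"
    and g: "g \<in> borel_measurable \<Lambda>" and b: "\<And>X. cmod (g X) \<le> B"
    and inv: "\<And>X i \<theta>. i \<in> S \<Longrightarrow> g (phase i \<theta> X) = g X"
  shows "(\<integral>X. zero_out S f X * g X \<partial>M) = (\<integral>X. f X * g X \<partial>M)"
  using finite_subset[OF S finite_lessThan] S inv
proof (induction S rule: finite_induct)
  case empty
  have "zero_out {} f = f" using f by (auto simp: zero_out_def mem_H_iff)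
  then show ?case by simp
next
  case (insert i S)
  let ?f = "zero_out S f"
  have i: "i < N" using insert by auto
  have fH: "?f \<in> H" using zero_out_H[OF f] insert by auto
  have fh: "holo_several N D ?f" using fH by (simp add: mem_H_iff)
  have zm: "zero_out {i} ?f \<in> borel_measurable \<Lambda>" by (rule H_measurable[OF zero_out_single(1)[OF fH i]])
  have int: "integrable M (\<lambda>X. ?f X * g X)"
    by (rule integrable_times_bounded[OF H_integrable[OF fin fH] g b])
  have "(\<integral>X. ?f X * g X \<partial>M) = (\<integral>X. \<integral>\<theta>. ?f (phase i \<theta> X) * g (phase i \<theta> X) \<partial>unit_interval \<partial>M)"
    by (rule M_average[OF i int])
  also have "\<dots> = (\<integral>X. \<integral>\<theta>. ?f (phase i \<theta> X) * g X \<partial>unit_interval \<partial>M)" using insert.prems by simp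
  also have "\<dots> = (\<integral>X. (\<integral>\<theta>. ?f (phase i \<theta> X) \<partial>unit_interval) * g X \<partial>M)" by simp
  also have "\<dots> = (\<integral>X. zero_out {i} ?f X * g X \<partial>M)"
  proof (rule integral_cong_AE)
    have 1: "AE X in M. (\<integral>\<theta>. ?f (phase i \<theta> X) \<partial>unit_interval) = zero_out {i} ?f X"
      using AE_M_D
    proof eventually_elim
      case (elim X)
      obtain r where r: "cmod (X i) < r" "\<And>\<zeta>. \<zeta> \<in> ball 0 r \<Longrightarrow> X(i := \<zeta>) \<in> D"
        using slice_disc[OF elim i] by blast
      have eq: "(\<lambda>k. if k \<in> {i} then 0 else X k) = X(i := 0)" by auto
      from Taylor_coefficient_rotation_average(1)[OF slice_holomorphic[OF fh i r(2)] r(1), of 0]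
      show ?case using elim unfolding zero_out_def[of "{i}"] eq by (simp add: phase_def)
    qed
    then show "AE X in M. (\<integral>\<theta>. ?f (phase i \<theta> X) \<partial>unit_interval) * g X = zero_out {i} ?f X * g X" by eventually_elim simp
    show "(\<lambda>X. zero_out {i} ?f X * g X) \<in> borel_measurable M" using zm g by (simp add: measurable_M_eq)
    have "(\<lambda>p. ?f (phase i (snd p) (fst p))) \<in> borel_measurable (M \<Otimes>\<^sub>M unit_interval)"
      using measurable_compose[OF measurable_compose[OF measurable_pair_swap' phase_measurable(2)[OF i]], of ?f borel] H_measurable[OF fH]
      by (simp add: case_prod_unfold measurable_M_eq)
    then have "(\<lambda>X. \<integral>\<theta>. ?f (phase i \<theta> X) \<partial>unit_interval) \<in> borel_measurable M"
      by (intro sigma_finite_measure.borel_measurable_lebesgue_integral prob_space_imp_sigma_finite prob_space_unit_interval)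
        (simp add: case_prod_unfold)
    then show "(\<lambda>X. (\<integral>\<theta>. ?f (phase i \<theta> X) \<partial>unit_interval) * g X) \<in> borel_measurable M"
      using g by (simp add: measurable_M_eq)
  qed
  finally have "(\<integral>X. ?f X * g X \<partial>M) = (\<integral>X. zero_out (insert i S) f X * g X \<partial>M)"
    by (subst zero_out_insert[OF i])
  moreover have "(\<integral>X. ?f X * g X \<partial>M) = (\<integral>X. f X * g X \<partial>M)"
    by (rule insert.IH) (use insert.prems in auto)
  ultimately show ?case by (rule trans[OF sym])
qed

end

text \<open>A basic open box around X inside U has nonempty open sides, each of positive area. Sides
  beyond N contain the coordinate \<open>undefined\<close> of X, so the box over the first N
  coordinates lies in U.\<close>

lemma emeasure_lebesgue_CN_open_pos:
  assumes U: "open U" and X: "X \<in> U" "X \<in> cspace N"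
  shows "emeasure (lebesgue_CN N) (U \<inter> cspace N) > 0"
proof -
  have "openin (product_topology (\<lambda>_. euclidean) UNIV) U" using U by (simp add: open_fun_def)
  from product_topology_open_contains_basis[OF this X(1)]
  obtain B where B: "X \<in> Pi\<^sub>E UNIV B" "\<And>i. open (B i)" "Pi\<^sub>E UNIV B \<subseteq> U"
    by (auto simp flip: open_openin)
  have sub: "Pi\<^sub>E {..<N} B \<subseteq> U \<inter> cspace N"
  proof
    fix Y assume Y: "Y \<in> Pi\<^sub>E {..<N} B"
    have "Y i \<in> B i" for i
    proof (cases "i < N")
      case False
      then have "Y i = X i" using Y X(2) by (auto simp: PiE_def extensional_def cspace_def)
      then show ?thesis using B(1) by (auto simp: PiE_def)
    qed (use Y in auto)
    then have "Y \<in> Pi\<^sub>E UNIV B" by (auto simp: PiE_def)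
    then show "Y \<in> U \<inter> cspace N" using B(3) Y by (auto simp: cspace_def PiE_def)
  qed
  have "U \<in> sets borel" using U by simp
  then have m: "U \<inter> cspace N \<in> sets (lebesgue_CN N)"
    using measurable_sets[OF measurable_lebesgue_CN_ident, of U N] by (simp add: vimage_def Int_def)
  have pos: "emeasure lborel (B i) \<noteq> 0" for i
  proof
    assume "emeasure lborel (B i) = 0"
    then have "negligible (B i)" using B(2)[of i]
      by (simp add: negligible_iff_null_sets null_sets_def emeasure_completion)
    then show False using open_not_negligible[OF B(2)[of i]] B(1) by (auto simp: PiE_def)
  qed
  have "emeasure (lebesgue_CN N) (Pi\<^sub>E {..<N} B) = (\<Prod>i<N. emeasure lborel (B i))"
    unfolding lebesgue_CN_def by (rule CN.emeasure_PiM) (use B in auto)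
  also have "\<dots> > 0" using pos by (simp add: zero_less_iff_neq_zero)
  also have "emeasure (lebesgue_CN N) (Pi\<^sub>E {..<N} B) \<le> emeasure (lebesgue_CN N) (U \<inter> cspace N)"
    by (rule emeasure_mono[OF sub m])
  finally show ?thesis .
qed

section \<open>Taylor coefficients in the first w-coordinate\<close>

context hartogs
begin

lemma n_less_N: "n < N" using m1 by simp

lemma cmod_Xn_less_1:
  assumes X: "X \<in> D" shows "cmod (X n) < 1"
proof -
  have "(cmod (X n))\<^sup>2 \<le> wnorm2 n m X"
    unfolding wnorm2_def using m1 by (intro order_trans[OF _ member_le_sum[of 0 "{..<m}" "\<lambda>i. (cmod (X (n + i)))\<^sup>2"]]) auto
  also have "\<dots> \<le> s X"
    unfolding s_def using wnorm2_nonneg[of n m X] znorm2_nonneg[of n X] \<mu>0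
    by (intro mult_le_cancel_left1[THEN iffD2]) auto
  also have "s X < 1" using X by (simp add: mem_D_iff)
  finally show ?thesis by (simp add: abs_square_less_1)
qed

lemma measurable_Xn [measurable]: "(\<lambda>X. X n) \<in> borel_measurable M"
  unfolding measurable_M_eq using n_less_N by simp

definition "slice f \<zeta> = f (Z0 \<zeta>)" for f :: "(nat \<Rightarrow> complex) \<Rightarrow> complex"
abbreviation "coef f k \<equiv> (deriv ^^ k) (slice f) 0 / fact k"
abbreviation "others \<equiv> {..<N} - {n}"

lemma slice_hol:
  assumes "f \<in> H" shows "slice f holomorphic_on ball 0 1"
proof -
  have eq: "(Z0 0)(n := \<zeta>) = Z0 \<zeta>" for \<zeta> using n_less_N by (auto simp: Z0_def)
  have "(\<lambda>\<zeta>. f ((Z0 0)(n := \<zeta>))) holomorphic_on ball 0 1"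
    by (rule slice_holomorphic[OF _ n_less_N]) (use assms in \<open>auto simp: mem_H_iff eq Z0_D\<close>)
  then show ?thesis by (simp add: eq slice_def[abs_def])
qed

lemma zero_out_others:
  assumes X: "X \<in> D" shows "zero_out others f X = slice f (X n)"
proof -
  have "X \<in> cspace N" using X by (simp add: mem_D_iff)
  then have "(\<lambda>k. if k \<in> others then 0 else X k) = Z0 (X n)"
    using n_less_N by (auto simp: Z0_def fun_eq_iff cspace_def PiE_def extensional_def)
  then show ?thesis using X by (simp add: zero_out_def slice_def)
qed

lemma slice_sums:
  assumes f: "f \<in> H" and \<tau>: "cmod \<tau> < 1"
  shows "(\<lambda>k. coef f k * \<tau> ^ k) sums f (Z0 \<tau>)"
  using holomorphic_power_series[OF slice_hol[OF f], of \<tau>] \<tau> by (simp add: slice_def)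

text \<open>Averaging out the other coordinates leaves a function of w_1 alone without raising the
  norm; on it the Bessel bound isolates the monomial of degree k. The estimate is in extended reals
  and remains meaningful when the moment is infinite.\<close>

lemma coef_square_le:
  assumes f: "f \<in> H"
  shows "ennreal ((cmod (coef f k))\<^sup>2) * (\<integral>\<^sup>+X. ennreal (cmod (X n) ^ (2 * k)) \<partial>M) \<le> L2 f"
proof -
  define g where "g = zero_out others f"
  have gH: "g \<in> H" "L2 g \<le> L2 f"
    unfolding g_def using zero_out_H[OF f, of others] by auto
  note [measurable] = H_measurable[OF gH(1)]
  have gm: "(\<lambda>X. ennreal ((cmod (g X))\<^sup>2)) \<in> borel_measurable \<Lambda>" by measurable
  have "ennreal ((cmod (coef f k))\<^sup>2) * (\<integral>\<^sup>+X. ennreal (cmod (X n) ^ (2 * k)) \<partial>M) = (\<integral>\<^sup>+X. ennreal ((cmod (coef f k * X n ^ k))\<^sup>2) \<partial>M)"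
  proof -
    have "ennreal ((cmod c)\<^sup>2) * ennreal (cmod x ^ (2 * k)) = ennreal ((cmod (c * x ^ k))\<^sup>2)" for c x :: complex
      by (simp add: ennreal_mult[symmetric] norm_mult norm_power power_mult_distrib power_mult[symmetric] mult.commute)
    then show ?thesis by (subst nn_integral_cmult[symmetric]) simp_all
  qed
  also have "\<dots> \<le> (\<integral>\<^sup>+X. \<integral>\<^sup>+\<theta>. ennreal ((cmod (g (phase n \<theta> X)))\<^sup>2) \<partial>unit_interval \<partial>M)"
  proof (rule nn_integral_mono_AE)
    show "AE X in M. ennreal ((cmod (coef f k * X n ^ k))\<^sup>2) \<le> (\<integral>\<^sup>+\<theta>. ennreal ((cmod (g (phase n \<theta> X)))\<^sup>2) \<partial>unit_interval)"
      using AE_M_D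
    proof eventually_elim
      case (elim X)
      have "g (phase n \<theta> X) = slice f (cis (2 * pi * \<theta>) * X n)" for \<theta>
        unfolding g_def zero_out_others[OF phase_D[OF n_less_N elim]] by (simp add: phase_def)
      then show ?case using Taylor_coefficient_square_le[OF slice_hol[OF f] cmod_Xn_less_1[OF elim], of k] by simp
    qed
  qed
  also have "\<dots> = L2 g" by (rule M_nn_average[OF n_less_N gm, symmetric])
  finally show ?thesis using gH(2) by (rule order_trans)
qed

text \<open>An infinite moment forces the coefficient to vanish, since the squared norm of f is
  finite. So f vanishes on the first w-axis, and the symmetries carry this to every point.\<close>

lemma H_trivial:
  assumes inf: "\<And>k. (\<integral>\<^sup>+X. ennreal (cmod (X n) ^ (2 * k)) \<partial>M) = \<infinity>" and Z: "Z \<in> D"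
  shows "\<forall>f\<in>H. f Z = 0"
proof (rule reduce_to_Z0[OF _ _ Z])
  fix Z T J T' J' assume "isometry T J T' J'" "Z \<in> D" "\<forall>f\<in>H. f (T Z) = 0"
  then show "\<forall>f\<in>H. f Z = 0" by (rule vanish_transfer)
next
  fix \<tau> :: complex assume \<tau>: "cmod \<tau> < 1"
  show "\<forall>f\<in>H. f (Z0 \<tau>) = 0"
  proof
    fix f assume f: "f \<in> H"
    have "coef f k = 0" for k
    proof (rule ccontr)
      assume "coef f k \<noteq> 0"
      then have "ennreal ((cmod (coef f k))\<^sup>2) * (\<integral>\<^sup>+X. ennreal (cmod (X n) ^ (2 * k)) \<partial>M) = \<infinity>"
        unfolding inf by (simp add: ennreal_mult_top)
      then have "L2 f = \<infinity>"
        using coef_square_le[OF f, of k] by (simp add: top_unique)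
      then show False using f by (simp add: mem_H_iff)
    qed
    then have "(\<lambda>k. 0) sums f (Z0 \<tau>)" using slice_sums[OF f \<tau>] by simp
    then show "f (Z0 \<tau>) = 0" by (simp add: sums_iff)
  qed
qed

end

section \<open>The kernel on the first w-axis when the weight has finite mass\<close>

locale hartogs_finite = hartogs +
  assumes fin: "emeasure M (space M) < \<infinity>"
begin

definition "moment k = (\<integral>X. cmod (X n) ^ (2 * k) \<partial>M)"

text \<open>Finite mass puts bounded holomorphic functions into the space: this serves the
  constants, which show it is not zero, and the candidate kernels.\<close>

lemma H_bounded:
  assumes f: "holo_several N D f" and f0: "\<And>X. X \<notin> D \<Longrightarrow> f X = 0" and b: "\<And>X. cmod (f X) \<le> B"
  shows "f \<in> H"
proof -
  have "L2 f \<le> (\<integral>\<^sup>+X. ennreal (B\<^sup>2) \<partial>M)"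
    using b by (intro nn_integral_mono ennreal_leI power_mono) auto
  also have "\<dots> < \<infinity>" using fin by (simp add: ennreal_mult_less_top)
  finally show ?thesis using f f0 by (simp add: mem_H_iff)
qed

lemma integrable_bounded_AE:
  fixes g :: "(nat \<Rightarrow> complex) \<Rightarrow> 'b::{banach, second_countable_topology}"
  assumes "g \<in> borel_measurable M" "AE X in M. norm (g X) \<le> B"
  shows "integrable M g"
proof -
  interpret finite_measure M by (rule finite_measureI) (use fin in auto)
  show ?thesis using integrable_const_bound[OF assms(2,1)] .
qed

lemma integrable_moment: "integrable M (\<lambda>X. cmod (X n) ^ (2 * k))"
proof (rule integrable_bounded_AE[where B = 1])
  show "AE X in M. norm (cmod (X n) ^ (2 * k)) \<le> 1"
    using AE_M_D by eventually_elim (simp add: norm_power power_le_one less_imp_le cmod_Xn_less_1)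
qed measurable

lemma nn_moment: "(\<integral>\<^sup>+X. ennreal (cmod (X n) ^ (2 * k)) \<partial>M) = ennreal (moment k)"
  unfolding moment_def by (rule nn_integral_eq_integral[OF integrable_moment]) auto

text \<open>The weighted measure charges $\{|w_1| > r\}$ for every $r < 1$, so the kernel series has radius of convergence at least 1.\<close>

lemma moment_lower:
  assumes r: "0 < r" "r < 1"
  obtains c where "c > 0" "\<And>k. moment k \<ge> c * r ^ (2 * k)"
proof -
  define U where "U = {X. s X < 1 \<and> r < cmod (X n)}"
  have "continuous_on UNIV s"
    unfolding s_def by (intro continuous_intros continuous_on_znorm2 continuous_on_wnorm2)
  then have "open ({X. s X < 1} \<inter> {X. r < cmod (X n)})"
    by (intro open_Int open_Collect_less continuous_intros continuous_on_coordinate)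
  then have U: "open U" by (simp add: U_def Int_def)
  \<comment> \<open>The point (0, t e_1) with r < t < 1 shows that the open set \<open>U\<close>
    meets the carrier, hence has positive measure; the density is positive on it.\<close>
  obtain t where t: "r < t" "t < 1" using dense r by blast
  have "Z0 (of_real t) \<in> U" using t r n_less_N
    by (simp add: U_def Z0_norm abs_square_less_1) (simp add: Z0_def)
  then have pos: "emeasure \<Lambda> (U \<inter> cspace N) > 0" by (rule emeasure_lebesgue_CN_open_pos[OF U _ Z0_cspace])
  have "U \<in> sets borel" using U by simp
  then have Um: "U \<inter> cspace N \<in> sets \<Lambda>"
    using measurable_sets[OF measurable_lebesgue_CN_ident, of U N] by (simp add: vimage_def Int_def)
  then have UmM: "U \<inter> cspace N \<in> sets M" by (simp add: sets_M)
  have Mpos: "emeasure M (U \<inter> cspace N) \<noteq> 0"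
  proof
    assume "emeasure M (U \<inter> cspace N) = 0"
    then have "U \<inter> cspace N \<in> null_sets (density \<Lambda> (\<lambda>X. ennreal (V X)))"
      using UmM by (simp add: null_sets_def M_def)
    then have "AE X in \<Lambda>. X \<in> U \<inter> cspace N \<longrightarrow> ennreal (V X) = 0"
      by (subst (asm) null_sets_density_iff) auto
    then have "AE X in \<Lambda>. X \<notin> U \<inter> cspace N"
    proof eventually_elim
      case (elim X)
      have "V X > 0" if "X \<in> U" using that by (simp add: U_def V_def kappa_pos s_nonneg)
      then show ?case using elim by (auto simp: ennreal_eq_0_iff)
    qed
    then have "U \<inter> cspace N \<in> null_sets \<Lambda>" using AE_iff_null_sets[OF Um] by simp
    then show False using pos by (simp add: null_sets_def)
  qed
  define c where "c = measure M (U \<inter> cspace N)"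
  interpret finite_measure M by (rule finite_measureI) (use fin in auto)
  have c: "c > 0" using Mpos by (simp add: c_def emeasure_eq_measure zero_less_measure_iff)
  moreover have "moment k \<ge> c * r ^ (2 * k)" for k
  proof -
    have "c * r ^ (2 * k) = (\<integral>X. r ^ (2 * k) * indicator (U \<inter> cspace N) X \<partial>M)"
      using UmM by (simp add: c_def)
    also have "\<dots> \<le> moment k"
      unfolding moment_def
    proof (rule integral_mono[OF _ integrable_moment])
      show "integrable M (\<lambda>X. r ^ (2 * k) * indicator (U \<inter> cspace N) X)" using UmM by (simp add: emeasure_eq_measure)
      show "r ^ (2 * k) * indicator (U \<inter> cspace N) X \<le> cmod (X n) ^ (2 * k)" for X
        using r by (auto simp: indicator_def U_def intro: power_mono)
    qed
    finally show ?thesis .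
  qed
  ultimately show ?thesis using that by blast
qed

lemma moment_pos: "moment k > 0"
proof -
  obtain c where "c > 0" "moment k \<ge> c * (1 / 2) ^ (2 * k)" using moment_lower[of "1 / 2"] by auto
  moreover have "c * (1 / 2) ^ (2 * k) > 0" using \<open>c > 0\<close> by simp
  ultimately show ?thesis by linarith
qed

lemma summable_kernel:
  assumes x: "0 \<le> x" "x < 1"
  shows "summable (\<lambda>k. x ^ k / moment k)"
proof -
  \<comment> \<open>A number strictly between x and 1 gives the geometric majorant (x / q)^k. The
    lower bound is taken at sqrt q because the moments carry even powers.\<close>
  define q where "q = (1 + x) / 2"
  have q: "x < q" "q < 1" "0 < q" using x by (auto simp: q_def)
  obtain c where c: "c > 0" "\<And>k. moment k \<ge> c * (sqrt q) ^ (2 * k)" using moment_lower[of "sqrt q"] q by auto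
  have sq: "(sqrt q) ^ (2 * k) = q ^ k" for k using q by (simp add: power_mult)
  show ?thesis
  proof (rule summable_comparison_test')
    show "summable (\<lambda>k. (1 / c) * (x / q) ^ k)" using q x by (intro summable_mult summable_geometric) auto
    show "norm (x ^ k / moment k) \<le> (1 / c) * (x / q) ^ k" if "k \<ge> 0" for k
    proof -
      have "x ^ k / moment k \<le> x ^ k / (c * q ^ k)"
        using c(2)[of k] c(1) q x moment_pos[of k] by (intro divide_left_mono) (auto simp: sq)
      then show ?thesis using x moment_pos[of k] by (simp add: power_divide field_simps)
    qed
  qed
qed

definition "kern \<xi> = (\<Sum>k. \<xi> ^ k / of_real (moment k))" for \<xi> :: complex

lemma kern_sums:
  assumes "cmod \<xi> < 1"
  shows "(\<lambda>k. \<xi> ^ k / of_real (moment k)) sums kern \<xi>"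
proof -
  have "summable (\<lambda>k. norm (\<xi> ^ k / of_real (moment k)))"
    using summable_kernel[of "cmod \<xi>"] assms moment_pos by (simp add: norm_divide norm_power less_imp_le)
  from summable_sums[OF summable_norm_cancel[OF this]] show ?thesis unfolding kern_def .
qed

lemma kern_bound:
  assumes "cmod \<xi> \<le> x" "x < 1"
  shows "cmod (kern \<xi>) \<le> (\<Sum>k. x ^ k / moment k)"
proof -
  have x: "0 \<le> x" using assms norm_ge_zero order_trans by blast
  have le: "norm (\<xi> ^ k / of_real (moment k)) \<le> x ^ k / moment k" for k
    using moment_pos[of k] assms by (simp add: norm_divide norm_power divide_right_mono power_mono)
  show ?thesis unfolding kern_def by (rule norm_suminf_le) (use le summable_kernel[OF x assms(2)] in auto)
qed

end

context hartogs_finite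
begin

lemma kern_holomorphic: "kern holomorphic_on ball 0 1"
proof (rule power_series_holomorphic)
  fix w :: complex assume "w \<in> ball 0 1"
  then show "(\<lambda>k. (1 / of_real (moment k)) * (w - 0) ^ k) sums kern w" using kern_sums[of w] by simp
qed

definition "K \<tau> X = (if X \<in> D then kern (cnj \<tau> * X n) else 0)"

lemma K_arg:
  assumes "cmod \<tau> < 1" "X \<in> D"
  shows "cmod (cnj \<tau> * X n) \<le> cmod \<tau>" "cmod (cnj \<tau> * X n) < 1"
proof -
  show "cmod (cnj \<tau> * X n) \<le> cmod \<tau>"
    using cmod_Xn_less_1[OF assms(2)] by (simp add: norm_mult mult_left_le)
  then show "cmod (cnj \<tau> * X n) < 1" using assms(1) by simp
qed

lemma K_bounded:
  assumes "cmod \<tau> < 1"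
  shows "cmod (K \<tau> X) \<le> (\<Sum>k. cmod \<tau> ^ k / moment k)"
proof -
  have "0 \<le> (\<Sum>k. cmod \<tau> ^ k / moment k)" 
    by (rule order_trans[OF norm_ge_zero kern_bound[of 0]]) (use assms in auto)
  then show ?thesis using kern_bound[OF K_arg(1)[OF assms] assms] by (simp add: K_def)
qed

lemma K_in_H:
  assumes \<tau>: "cmod \<tau> < 1" shows "K \<tau> \<in> H"
proof (rule H_bounded[OF _ _ K_bounded[OF \<tau>]])
  have "holo_several N D (\<lambda>X. kern (cnj \<tau> * X n))"
    by (rule holo_several_outer[OF _ kern_holomorphic])
      (use K_arg(2)[OF \<tau>] in \<open>auto intro: holo_several_mult holo_several_const holo_several_coordinate\<close>)
  then show "holo_several N D (K \<tau>)"
    by (rule holo_several_cong[OF open_res_D D_cspace, rotated]) (simp add: K_def)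
qed (simp add: K_def)

lemma phase_D_iff:
  assumes i: "i < N" shows "phase i \<theta> X \<in> D \<longleftrightarrow> X \<in> D"
proof -
  have "phase i \<theta> X \<in> cspace N \<longleftrightarrow> X \<in> cspace N"
    using i by (auto simp: phase_def cspace_def PiE_def extensional_def)
  then show ?thesis by (simp add: mem_D_iff phase_norm[OF i])
qed

text \<open>Orthogonality of monomials: after averaging out the other coordinates, the phase average
  of slice f (w_1) against the k-th power of the conjugate of w_1 extracts the k-th Taylor term,
  leaving |w_1|^(2k) to be integrated.\<close>

lemma integral_coef:
  assumes f: "f \<in> H"
  shows "(\<integral>X. zero_out others f X * cnj (X n) ^ k \<partial>M) = coef f k * of_real (moment k)"
    and "integrable M (\<lambda>X. zero_out others f X * cnj (X n) ^ k)"
proof -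
  let ?g = "zero_out others f"
  have gH: "?g \<in> H" using zero_out_H[OF f, of others] by auto
  have gm: "?g \<in> borel_measurable M" using H_measurable[OF gH] by (simp add: measurable_M_eq)
  have cm: "(\<lambda>X. cnj (X n) ^ k) \<in> borel_measurable M"
    by (rule measurable_compose[OF measurable_Xn]) (intro borel_measurable_continuous_onI continuous_intros)
  show int: "integrable M (\<lambda>X. ?g X * cnj (X n) ^ k)"
  proof (rule Bochner_Integration.integrable_bound[OF H_integrable[OF fin gH]])
    show "(\<lambda>X. ?g X * cnj (X n) ^ k) \<in> borel_measurable M" using gm cm by measurable
    show "AE X in M. norm (?g X * cnj (X n) ^ k) \<le> norm (?g X)"
      using AE_M_D by eventually_elim (simp add: norm_mult norm_power mult_left_le power_le_one less_imp_le cmod_Xn_less_1)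
  qed
  have "(\<integral>X. ?g X * cnj (X n) ^ k \<partial>M) = (\<integral>X. \<integral>\<theta>. ?g (phase n \<theta> X) * cnj (phase n \<theta> X n) ^ k \<partial>unit_interval \<partial>M)"
    by (rule M_average[OF n_less_N int])
  also have "\<dots> = (\<integral>X. coef f k * of_real (cmod (X n) ^ (2 * k)) \<partial>M)"
  proof (rule integral_cong_AE)
    show 1: "AE X in M. (\<integral>\<theta>. ?g (phase n \<theta> X) * cnj (phase n \<theta> X n) ^ k \<partial>unit_interval) = coef f k * of_real (cmod (X n) ^ (2 * k))"
      using AE_M_D
    proof eventually_elim
      case (elim X)
      have c: "cnj (cis (2 * pi * \<theta>)) ^ k = cis (- (2 * pi * \<theta> * real k))" for \<theta>
        by (simp add: cis_cnj Complex.DeMoivre mult_ac)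
      have "?g (phase n \<theta> X) * cnj (phase n \<theta> X n) ^ k = (slice f (cis (2 * pi * \<theta>) * X n) * cis (- (2 * pi * \<theta> * real k))) * cnj (X n) ^ k" for \<theta>
        unfolding zero_out_others[OF phase_D[OF n_less_N elim]] c[symmetric] by (simp add: phase_def power_mult_distrib mult_ac)
      then have "(\<integral>\<theta>. ?g (phase n \<theta> X) * cnj (phase n \<theta> X n) ^ k \<partial>unit_interval) = (coef f k * X n ^ k) * cnj (X n) ^ k"
        using Taylor_coefficient_rotation_average(1)[OF slice_hol[OF f] cmod_Xn_less_1[OF elim], of k] by simp
      also have "\<dots> = coef f k * (X n * cnj (X n)) ^ k" by (simp add: power_mult_distrib)
      also have "X n * cnj (X n) = of_real ((cmod (X n))\<^sup>2)" by (simp only: complex_norm_square)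
      finally show ?case by (simp add: power_mult)
    qed
    have "(\<lambda>p. ?g (phase n (snd p) (fst p)) * cnj (phase n (snd p) (fst p) n) ^ k) \<in> borel_measurable (M \<Otimes>\<^sub>M unit_interval)"
      using measurable_compose[OF measurable_compose[OF measurable_pair_swap' phase_measurable(2)[OF n_less_N]], of "\<lambda>X. ?g X * cnj (X n) ^ k" borel] borel_measurable_integrable[OF int]
      by (simp add: case_prod_unfold)
    then show "(\<lambda>X. \<integral>\<theta>. ?g (phase n \<theta> X) * cnj (phase n \<theta> X n) ^ k \<partial>unit_interval) \<in> borel_measurable M"
      by (intro sigma_finite_measure.borel_measurable_lebesgue_integral prob_space_imp_sigma_finite prob_space_unit_interval)
        (simp add: case_prod_unfold)
    show "(\<lambda>X. coef f k * of_real (cmod (X n) ^ (2 * k))) \<in> borel_measurable M" by measurable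
  qed
  also have "\<dots> = coef f k * (\<integral>X. of_real (cmod (X n) ^ (2 * k)) \<partial>M)" by (rule integral_mult_right_zero)
  also have "(\<integral>X. complex_of_real (cmod (X n) ^ (2 * k)) \<partial>M) = of_real (moment k)"
    unfolding moment_def by (rule integral_of_real[OF integrable_moment])
  finally show "(\<integral>X. ?g X * cnj (X n) ^ k \<partial>M) = coef f k * of_real (moment k)" .
qed

text \<open>The conjugated kernel is integrated term by term against the averaged function g, and
  the k-th term gives the k-th Taylor term of f along the axis. Since |w_1| < 1, the L1 norms are
  bounded by |\<tau>|^k / M_k times the L1 norm of g, which is summable. As the kernel depends on
  w_1 only, g may then be replaced by f.\<close>

lemma reproducing_Z0:
  assumes \<tau>: "cmod \<tau> < 1"
  shows "reproducing (Z0 \<tau>) (K \<tau>)"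
  unfolding reproducing_def
proof (intro conjI ballI)
  show KH: "K \<tau> \<in> H" by (rule K_in_H[OF \<tau>])
  fix f assume f: "f \<in> H"
  let ?g = "zero_out others f"
  have gH: "?g \<in> H" using zero_out_H[OF f, of others] by auto
  have Km: "(\<lambda>X. cnj (K \<tau> X)) \<in> borel_measurable \<Lambda>"
    using H_measurable[OF KH] by (rule measurable_compose) (intro borel_measurable_continuous_onI continuous_intros)
  define u where "u = (\<lambda>k X. (\<tau> ^ k / of_real (moment k)) * (?g X * cnj (X n) ^ k))"
  have ui: "integrable M (u k)" for k unfolding u_def using integral_coef(2)[OF f, of k] by simp
  have us: "(\<lambda>k. norm (u k X)) = (\<lambda>k. (cmod (cnj \<tau> * X n) ^ k / moment k) * cmod (?g X))" for X
    using moment_pos by (auto simp: u_def norm_mult norm_divide norm_power power_mult_distrib less_imp_le)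
  have summ: "summable (\<lambda>k. norm (u k X))" for X
  proof (cases "X \<in> D")
    case True
    then show ?thesis unfolding us by (intro summable_mult2 summable_kernel) (use K_arg[OF \<tau>] in auto)
  qed (simp add: u_def zero_out_def)
  have usum: "(\<Sum>k. u k X) = ?g X * cnj (K \<tau> X)" for X
  proof (cases "X \<in> D")
    case True
    have "(\<lambda>k. (cnj \<tau> * X n) ^ k / of_real (moment k)) sums kern (cnj \<tau> * X n)" by (rule kern_sums[OF K_arg(2)[OF \<tau> True]])
    then have "(\<lambda>k. cnj ((cnj \<tau> * X n) ^ k / of_real (moment k))) sums cnj (kern (cnj \<tau> * X n))" by (simp only: sums_cnj)
    then have "(\<lambda>k. ?g X * cnj ((cnj \<tau> * X n) ^ k / of_real (moment k))) sums (?g X * cnj (kern (cnj \<tau> * X n)))" by (rule sums_mult)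
    then show ?thesis using True by (simp add: u_def K_def power_mult_distrib mult_ac sums_iff)
  qed (simp add: u_def zero_out_def)
  have "(\<lambda>k. \<integral>X. u k X \<partial>M) sums (\<integral>X. (\<Sum>k. u k X) \<partial>M)"
  proof (rule sums_integral[OF ui])
    show "AE X in M. summable (\<lambda>k. norm (u k X))" using summ by simp
    define C where "C = (\<integral>X. cmod (?g X) \<partial>M)"
    have le: "(\<integral>X. norm (u k X) \<partial>M) \<le> (cmod \<tau> ^ k / moment k) * C" for k
    proof -
      have "(\<integral>X. norm (u k X) \<partial>M) \<le> (\<integral>X. (cmod \<tau> ^ k / moment k) * cmod (?g X) \<partial>M)"
      proof (rule integral_mono_AE)
        show "integrable M (\<lambda>X. norm (u k X))" using ui by simp
        show "integrable M (\<lambda>X. (cmod \<tau> ^ k / moment k) * cmod (?g X))" using H_integrable[OF fin gH] by simp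
        show "AE X in M. norm (u k X) \<le> (cmod \<tau> ^ k / moment k) * cmod (?g X)"
          using AE_M_D
        proof eventually_elim
          case (elim X)
          have "norm (u k X) = (cmod (cnj \<tau> * X n) ^ k / moment k) * cmod (?g X)" by (rule fun_cong[OF us])
          also have "\<dots> \<le> (cmod \<tau> ^ k / moment k) * cmod (?g X)"
            using K_arg(1)[OF \<tau> elim] moment_pos[of k] by (intro mult_right_mono divide_right_mono power_mono) auto
          finally show ?case .
        qed
      qed
      then show ?thesis by (simp add: C_def)
    qed
    have sC: "summable (\<lambda>k. (cmod \<tau> ^ k / moment k) * C)"
      by (intro summable_mult2 summable_kernel) (use \<tau> in auto)
    show "summable (\<lambda>k. \<integral>X. norm (u k X) \<partial>M)"
    proof (rule summable_comparison_test'[OF sC, of 0])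
      fix k
      have "0 \<le> (\<integral>X. norm (u k X) \<partial>M)" by simp
      then show "norm (\<integral>X. norm (u k X) \<partial>M) \<le> (cmod \<tau> ^ k / moment k) * C" using le[of k] by simp
    qed
  qed
  moreover have "(\<integral>X. u k X \<partial>M) = coef f k * \<tau> ^ k" for k
  proof -
    have "(\<integral>X. u k X \<partial>M) = (\<tau> ^ k / of_real (moment k)) * (\<integral>X. ?g X * cnj (X n) ^ k \<partial>M)"
      unfolding u_def by (rule integral_mult_right_zero)
    also have "\<dots> = coef f k * \<tau> ^ k" unfolding integral_coef(1)[OF f] using moment_pos[of k] by simp
    finally show ?thesis .
  qed
  ultimately have "(\<lambda>k. coef f k * \<tau> ^ k) sums (\<integral>X. ?g X * cnj (K \<tau> X) \<partial>M)" unfolding usum by simp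
  then have "f (Z0 \<tau>) = (\<integral>X. ?g X * cnj (K \<tau> X) \<partial>M)" using slice_sums[OF f \<tau>] by (rule sums_unique2[symmetric])
  also have "\<dots> = (\<integral>X. f X * cnj (K \<tau> X) \<partial>M)"
  proof (rule integral_zero_out[OF fin f _ Km])
    show "cmod (cnj (K \<tau> X)) \<le> (\<Sum>k. cmod \<tau> ^ k / moment k)" for X using K_bounded[OF \<tau>] by simp
    show "cnj (K \<tau> (phase i \<theta> X)) = cnj (K \<tau> X)" if "i \<in> others" for X i \<theta>
      using that phase_D_iff[of i] by (simp add: K_def) (simp add: phase_def)
  qed auto
  also have "\<dots> = ip f (K \<tau>)" by (rule Hinner_eq[symmetric]) (rule H_measurable, fact)+
  finally show "ip f (K \<tau>) = f (Z0 \<tau>)" ..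
qed

definition "kern_real \<sigma> = (\<Sum>k. \<sigma> ^ k / moment k)"

lemma kern_of_real:
  assumes "0 \<le> \<sigma>" "\<sigma> < 1" shows "kern (of_real \<sigma>) = of_real (kern_real \<sigma>)"
proof -
  have "(\<lambda>k. \<sigma> ^ k / moment k) sums kern_real \<sigma>"
    unfolding kern_real_def by (rule summable_sums[OF summable_kernel[OF assms]])
  then have "(\<lambda>k. complex_of_real (\<sigma> ^ k / moment k)) sums of_real (kern_real \<sigma>)" by (simp only: sums_of_real_iff)
  moreover have "(\<lambda>k. complex_of_real (\<sigma> ^ k / moment k)) sums kern (of_real \<sigma>)"
    using kern_sums[of "of_real \<sigma>"] assms by simp
  ultimately show ?thesis using sums_unique2 by blast
qed

lemma eps_at_all:
  assumes Z: "Z \<in> D"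
  shows "eps_at Z (of_real ((1 - s Z) powr \<alpha> * kern_real (s Z)))"
proof (rule reduce_to_Z0[OF _ _ Z])
  fix Z T J T' J' assume T: "isometry T J T' J'" "Z \<in> D" and e: "eps_at (T Z) (of_real ((1 - s (T Z)) powr \<alpha> * kern_real (s (T Z))))"
  have "s (T Z) = s Z" using T by (simp add: isometry_def)
  then show "eps_at Z (of_real ((1 - s Z) powr \<alpha> * kern_real (s Z)))"
    using eps_at_transfer[OF T e] by simp
next
  fix \<tau> :: complex assume \<tau>: "cmod \<tau> < 1"
  have ZD: "Z0 \<tau> \<in> D" using \<tau> by (simp add: Z0_D)
  have "cnj \<tau> * Z0 \<tau> n = of_real ((cmod \<tau>)\<^sup>2)"
    using n_less_N by (simp add: Z0_def complex_norm_square mult.commute del: of_real_power)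
  moreover have "(cmod \<tau>)\<^sup>2 < 1" using \<tau> by (simp add: abs_square_less_1)
  ultimately have "K \<tau> (Z0 \<tau>) = of_real (kern_real ((cmod \<tau>)\<^sup>2))"
    using ZD kern_of_real[of "(cmod \<tau>)\<^sup>2"] by (simp add: K_def del: of_real_power)
  then show "eps_at (Z0 \<tau>) (of_real ((1 - s (Z0 \<tau>)) powr \<alpha> * kern_real (s (Z0 \<tau>))))"
    unfolding eps_at_def exp_Phi[OF ZD] Z0_norm using reproducing_Z0[OF \<tau>] by (intro exI[of _ "K \<tau>"]) simp
qed

lemma balanced_iff:
  "balanced n m \<mu> \<nu> \<alpha> \<longleftrightarrow> (\<exists>c>0. \<forall>\<sigma>. 0 \<le> \<sigma> \<and> \<sigma> < 1 \<longrightarrow> (1 - \<sigma>) powr \<alpha> * kern_real \<sigma> = c)"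
proof -
  have e: "rawnsley_eps n m \<mu> \<nu> \<alpha> Z = of_real ((1 - s Z) powr \<alpha> * kern_real (s Z))" if "Z \<in> D" for Z
    by (rule rawnsley_eps_at[OF eps_at_all[OF that]])
  have ex: "\<exists>Z\<in>D. s Z = \<sigma>" if "0 \<le> \<sigma>" "\<sigma> < 1" for \<sigma>
    using that by (intro bexI[of _ "Z0 (of_real (sqrt \<sigma>))"]) (auto simp: Z0_norm Z0_D)
  \<comment> \<open>The constant 1, extended by zero, is the nonzero element that balancedness asks
    for.\<close>
  have "(\<lambda>X. if X \<in> D then 1 else 0) \<in> H"
    by (rule H_bounded[of _ 1]) (auto intro: holo_several_cong[OF open_res_D D_cspace _ holo_several_const])
  moreover have "Z0 0 \<in> D" by (simp add: Z0_D)
  ultimately have nt: "\<exists>f\<in>H. \<exists>Z\<in>D. f Z \<noteq> 0" by (intro bexI) auto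
  have "(\<forall>Z\<in>D. rawnsley_eps n m \<mu> \<nu> \<alpha> Z = of_real c) \<longleftrightarrow> (\<forall>\<sigma>. 0 \<le> \<sigma> \<and> \<sigma> < 1 \<longrightarrow> (1 - \<sigma>) powr \<alpha> * kern_real \<sigma> = c)" for c
  proof -
    have "(\<forall>Z\<in>D. rawnsley_eps n m \<mu> \<nu> \<alpha> Z = of_real c) \<longleftrightarrow> (\<forall>Z\<in>D. (1 - s Z) powr \<alpha> * kern_real (s Z) = c)"
      using e by (simp del: of_real_mult)
    also have "\<dots> \<longleftrightarrow> (\<forall>\<sigma>. 0 \<le> \<sigma> \<and> \<sigma> < 1 \<longrightarrow> (1 - \<sigma>) powr \<alpha> * kern_real \<sigma> = c)"
      using ex by (auto simp: mem_D_iff s_nonneg)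
    finally show ?thesis .
  qed
  then show ?thesis unfolding balanced_def using nt by auto
qed

end

lemma (in hartogs) not_balanced:
  assumes "\<And>k. (\<integral>\<^sup>+X. ennreal (cmod (X n) ^ (2 * k)) \<partial>M) = \<infinity>"
  shows "\<not> balanced n m \<mu> \<nu> \<alpha>"
  using H_trivial[OF assms] by (auto simp: balanced_def)

section \<open>Norms of monomials\<close>

lemma nn_integral_lebesgue_CN_Suc:
  assumes "G \<in> borel_measurable (lebesgue_CN (Suc N))"
  shows "(\<integral>\<^sup>+X. G X \<partial>lebesgue_CN (Suc N)) = (\<integral>\<^sup>+X. \<integral>\<^sup>+\<zeta>. G (X(N := \<zeta>)) \<partial>lborel \<partial>lebesgue_CN N)"
proof -
  have "{..<Suc N} - {N} = {..<N}" by auto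
  then show ?thesis using nn_integral_lebesgue_CN_fibre[OF lessI assms] by (simp add: lebesgue_CN_def)
qed

lemma nn_integral_exp_halfline:
  assumes "c > 0"
  shows "(\<integral>\<^sup>+x. ennreal (exp (- c * x)) * indicator {0..} x \<partial>lborel) = ennreal (1 / c)"
proof -
  have "((\<lambda>x. - exp (- c * x) / c) \<longlongrightarrow> 0) at_top"
    using assms by real_asymp
  then have "(\<integral>\<^sup>+x. ennreal (exp (- c * x)) * indicator {0..} x \<partial>lborel) = ennreal (0 - (- exp (- c * 0) / c))"
    using assms by (intro nn_integral_FTC_atLeast) (auto intro!: derivative_eq_intros)
  then show ?thesis by simp
qed

lemma nn_integral_monomial_Icc:
  assumes "0 \<le> \<rho>"
  shows "(\<integral>\<^sup>+x. ennreal (x ^ p) * indicator {0..\<rho>} x \<partial>lborel) = ennreal (\<rho> ^ Suc p / Suc p)"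
proof -
  have "(\<integral>\<^sup>+x. ennreal (x ^ p) * indicator {0..\<rho>} x \<partial>lborel) = ennreal (\<rho> ^ Suc p / Suc p - 0 ^ Suc p / Suc p)"
  proof (rule nn_integral_FTC_Icc[OF _ _ _ assms])
    fix x :: real assume "x \<in> {0..\<rho>}"
    show "((\<lambda>x. x ^ Suc p / real (Suc p)) has_real_derivative x ^ p) (at x)"
      using DERIV_cdivide[OF DERIV_pow[of "Suc p" x], of "real (Suc p)"] by simp
  qed auto
  then show ?thesis by simp
qed

lemma borel_measurable_CN_norm2 [measurable]:
  "znorm2 n \<in> borel_measurable (lebesgue_CN N)" "wnorm2 n m \<in> borel_measurable (lebesgue_CN N)"
  by (auto intro: borel_measurable_lebesgue_CN)

lemma nn_integral_gaussian:
  assumes c: "c > 0"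
  shows "(\<integral>\<^sup>+X. ennreal (exp (- c * znorm2 n X)) \<partial>lebesgue_CN n) = ennreal ((pi / c) ^ n)"
proof (induction n)
  case 0
  have "cspace 0 = {\<lambda>_. undefined}" by (auto simp: cspace_def)
  then show ?case
    by (simp add: znorm2_def lebesgue_CN_def PiM_empty)
next
  case (Suc n)
  have z: "znorm2 (Suc n) (X(n := \<zeta>)) = znorm2 n X + (cmod \<zeta>)\<^sup>2" for X \<zeta>
  proof -
    have "(\<Sum>i<n. (cmod ((X(n := \<zeta>)) i))\<^sup>2) = znorm2 n X" unfolding znorm2_def by (intro sum.cong) auto
    then show ?thesis by (simp add: znorm2_def)
  qed
  have one: "(\<integral>\<^sup>+\<zeta>. ennreal (exp (- c * (cmod \<zeta>)\<^sup>2)) \<partial>lborel) = ennreal (pi / c)"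
    using nn_integral_complex_norm_square[of "\<lambda>x. ennreal (exp (- c * x))"] nn_integral_exp_halfline[OF c] c
    by (simp add: ennreal_mult[symmetric])
  have "(\<integral>\<^sup>+X. ennreal (exp (- c * znorm2 (Suc n) X)) \<partial>lebesgue_CN (Suc n)) =
     (\<integral>\<^sup>+X. \<integral>\<^sup>+\<zeta>. ennreal (exp (- c * znorm2 n X)) * ennreal (exp (- c * (cmod \<zeta>)\<^sup>2)) \<partial>lborel \<partial>lebesgue_CN n)"
    by (subst nn_integral_lebesgue_CN_Suc) (auto simp: z ennreal_mult[symmetric] exp_add[symmetric] algebra_simps)
  also have "\<dots> = (\<integral>\<^sup>+X. ennreal (exp (- c * znorm2 n X)) * ennreal (pi / c) \<partial>lebesgue_CN n)"
    by (subst nn_integral_cmult) (simp_all add: one[simplified])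
  also have "\<dots> = ennreal ((pi / c) ^ n) * ennreal (pi / c)"
    by (subst nn_integral_multc) (simp_all add: Suc[simplified])
  also have "\<dots> = ennreal ((pi / c) ^ Suc n)" using c by (simp add: ennreal_mult[symmetric] mult.commute)
  finally show ?case .
qed

text \<open>The number of w-coordinates is m + 1 here. Weighted by |w_1|^(2k), the squared norm of w
  has density proportional to x^(k+m). One more coordinate convolves this with the constant pi on
  the half-line, and integrating x^(k+m) over [0, y] produces the next power and the factor 1 /
  (k+m+1).\<close>

lemma nn_integral_radial:
  fixes v :: "real \<Rightarrow> ennreal"
  assumes c: "c > 0" and v: "v \<in> borel_measurable borel"
  shows "(\<integral>\<^sup>+X. ennreal (exp (- c * znorm2 n X) * cmod (X n) ^ (2 * k)) * v (wnorm2 n (Suc m) X) \<partial>lebesgue_CN (n + Suc m)) =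
    ennreal ((pi / c) ^ n * pi ^ Suc m * fact k / fact (k + m)) * (\<integral>\<^sup>+x. v x * (ennreal (x ^ (k + m)) * indicator {0..} x) \<partial>lborel)"
  using v
proof (induction m arbitrary: v)
  case 0
  note [measurable] = 0
  have z: "znorm2 n (X(n := \<zeta>)) = znorm2 n X" for X \<zeta> by (simp add: znorm2_fun_upd)
  have w: "wnorm2 n (Suc 0) (X(n := \<zeta>)) = (cmod \<zeta>)\<^sup>2" for X \<zeta> by (simp add: wnorm2_def)
  have "(\<integral>\<^sup>+X. ennreal (exp (- c * znorm2 n X) * cmod (X n) ^ (2 * k)) * v (wnorm2 n (Suc 0) X) \<partial>lebesgue_CN (Suc n)) =
    (\<integral>\<^sup>+X. \<integral>\<^sup>+\<zeta>. ennreal (exp (- c * znorm2 n X)) * (v ((cmod \<zeta>)\<^sup>2) * ennreal (((cmod \<zeta>)\<^sup>2) ^ k)) \<partial>lborel \<partial>lebesgue_CN n)"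
    by (subst nn_integral_lebesgue_CN_Suc) (measurable, simp add: z w ennreal_mult mult_ac flip: power_mult)
  also have "\<dots> = (\<integral>\<^sup>+X. ennreal (exp (- c * znorm2 n X)) * (ennreal pi * (\<integral>\<^sup>+x. v x * ennreal (x ^ k) * indicator {0..} x \<partial>lborel)) \<partial>lebesgue_CN n)"
    using nn_integral_complex_norm_square[of "\<lambda>x. v x * ennreal (x ^ k)"]
    by (subst nn_integral_cmult) simp_all
  also have "\<dots> = ennreal ((pi / c) ^ n) * (ennreal pi * (\<integral>\<^sup>+x. v x * ennreal (x ^ k) * indicator {0..} x \<partial>lborel))"
    by (subst nn_integral_multc) (simp_all add: nn_integral_gaussian[OF c, simplified])
  finally show ?case using c by (simp add: ennreal_mult mult_ac)
next
  case (Suc m)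
  note [measurable] = Suc.prems
  \<comment> \<open>Integrating over the last coordinate replaces v by this function of the
    remaining squared norm. The density of |\<zeta>|^2 is the constant pi.\<close>
  define v' where "v' = (\<lambda>x. ennreal pi * (\<integral>\<^sup>+y. v (x + y) * indicator {0..} y \<partial>lborel))"
  have [measurable]: "v' \<in> borel_measurable borel" unfolding v'_def by measurable
  have "(\<lambda>p. v (snd p) * (ennreal (fst p ^ (k + m)) * (indicator {0..} (fst p) * indicator {0..} (snd p - fst p)) * indicator {0..} (snd p))) \<in> borel_measurable (lborel \<Otimes>\<^sub>M (lborel :: real measure))"
    by measurable
  moreover have "(\<lambda>p. v (snd p) * (ennreal (fst p ^ (k + m)) * (indicator {0..} (fst p) * indicator {0..} (snd p - fst p)) * indicator {0..} (snd p))) = (\<lambda>p. v (snd p) * (ennreal (fst p ^ (k + m)) * indicator {0..snd p} (fst p) * indicator {0..} (snd p)))"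
    by (auto simp: indicator_def fun_eq_iff)
  ultimately have vm: "(\<lambda>(x, y). v y * (ennreal (x ^ (k + m)) * indicator {0..y} x * indicator {0..} y)) \<in> borel_measurable (lborel \<Otimes>\<^sub>M (lborel :: real measure))"
    by (simp add: case_prod_unfold)
  have z: "znorm2 n (X(n + Suc m := \<zeta>)) = znorm2 n X" for X \<zeta> by (simp add: znorm2_fun_upd)
  have w: "wnorm2 n (Suc (Suc m)) (X(n + Suc m := \<zeta>)) = wnorm2 n (Suc m) X + (cmod \<zeta>)\<^sup>2" for X \<zeta>
  proof -
    have "(\<Sum>i<Suc m. (cmod ((X(n + Suc m := \<zeta>)) (n + i)))\<^sup>2) = wnorm2 n (Suc m) X" unfolding wnorm2_def by (intro sum.cong) auto
    then show ?thesis by (simp add: wnorm2_def)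
  qed
  have [measurable]: "(\<lambda>X. X n) \<in> borel_measurable (lebesgue_CN (Suc (n + Suc m)))" by simp
  have "(\<integral>\<^sup>+X. ennreal (exp (- c * znorm2 n X) * cmod (X n) ^ (2 * k)) * v (wnorm2 n (Suc (Suc m)) X) \<partial>lebesgue_CN (n + Suc (Suc m))) =
    (\<integral>\<^sup>+X. \<integral>\<^sup>+\<zeta>. ennreal (exp (- c * znorm2 n X) * cmod (X n) ^ (2 * k)) * v (wnorm2 n (Suc m) X + (cmod \<zeta>)\<^sup>2) \<partial>lborel \<partial>lebesgue_CN (n + Suc m))"
    unfolding add_Suc_right[of n "Suc m"] by (subst nn_integral_lebesgue_CN_Suc) (measurable, simp only: z w, simp)
  also have "\<dots> = (\<integral>\<^sup>+X. ennreal (exp (- c * znorm2 n X) * cmod (X n) ^ (2 * k)) * v' (wnorm2 n (Suc m) X) \<partial>lebesgue_CN (n + Suc m))"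
  proof (rule nn_integral_cong)
    fix X
    show "(\<integral>\<^sup>+\<zeta>. ennreal (exp (- c * znorm2 n X) * cmod (X n) ^ (2 * k)) * v (wnorm2 n (Suc m) X + (cmod \<zeta>)\<^sup>2) \<partial>lborel) =
      ennreal (exp (- c * znorm2 n X) * cmod (X n) ^ (2 * k)) * v' (wnorm2 n (Suc m) X)"
      using nn_integral_complex_norm_square[of "\<lambda>y. v (wnorm2 n (Suc m) X + y)"]
      by (subst nn_integral_cmult) (simp_all add: v'_def)
  qed
  also have "\<dots> = ennreal ((pi / c) ^ n * pi ^ Suc m * fact k / fact (k + m)) * (\<integral>\<^sup>+x. v' x * (ennreal (x ^ (k + m)) * indicator {0..} x) \<partial>lborel)"
    by (rule Suc.IH) measurable
  also have "(\<integral>\<^sup>+x. v' x * (ennreal (x ^ (k + m)) * indicator {0..} x) \<partial>lborel) =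
    (\<integral>\<^sup>+x. ennreal pi * (\<integral>\<^sup>+y. v y * (ennreal (x ^ (k + m)) * indicator {0..y} x * indicator {0..} y) \<partial>lborel) \<partial>lborel)"
  proof (rule nn_integral_cong)
    fix x :: real
    have "(\<integral>\<^sup>+y. v (x + y) * indicator {0..} y \<partial>lborel) = (\<integral>\<^sup>+y. v y * indicator {x..} y \<partial>lborel)"
      by (subst (2) nn_integral_real_affine[where c = 1 and t = x]) (auto simp: indicator_def intro!: nn_integral_cong)
    then have "v' x * (ennreal (x ^ (k + m)) * indicator {0..} x) = ennreal pi * ((\<integral>\<^sup>+y. v y * indicator {x..} y \<partial>lborel) * (ennreal (x ^ (k + m)) * indicator {0..} x))"
      by (simp add: v'_def mult.assoc)
    also have "(\<integral>\<^sup>+y. v y * indicator {x..} y \<partial>lborel) * (ennreal (x ^ (k + m)) * indicator {0..} x) = (\<integral>\<^sup>+y. v y * indicator {x..} y * (ennreal (x ^ (k + m)) * indicator {0..} x) \<partial>lborel)"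
      by (rule nn_integral_multc[symmetric]) measurable
    also have "\<dots> = (\<integral>\<^sup>+y. v y * (ennreal (x ^ (k + m)) * indicator {0..y} x * indicator {0..} y) \<partial>lborel)"
      by (intro nn_integral_cong) (auto simp: indicator_def)
    finally show "v' x * (ennreal (x ^ (k + m)) * indicator {0..} x) = ennreal pi * (\<integral>\<^sup>+y. v y * (ennreal (x ^ (k + m)) * indicator {0..y} x * indicator {0..} y) \<partial>lborel)" .
  qed
  also have "\<dots> = ennreal pi * (\<integral>\<^sup>+x. \<integral>\<^sup>+y. v y * (ennreal (x ^ (k + m)) * indicator {0..y} x * indicator {0..} y) \<partial>lborel \<partial>lborel)"
  proof (rule nn_integral_cmult)
    show "(\<lambda>x. \<integral>\<^sup>+y. v y * (ennreal (x ^ (k + m)) * indicator {0..y} x * indicator {0..} y) \<partial>lborel) \<in> borel_measurable (lborel :: real measure)"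
      by (rule lborel.borel_measurable_nn_integral[OF vm])
  qed
  also have "(\<integral>\<^sup>+x. \<integral>\<^sup>+y. v y * (ennreal (x ^ (k + m)) * indicator {0..y} x * indicator {0..} y) \<partial>lborel \<partial>lborel) =
     (\<integral>\<^sup>+y. \<integral>\<^sup>+x. v y * (ennreal (x ^ (k + m)) * indicator {0..y} x * indicator {0..} y) \<partial>lborel \<partial>lborel)"
    by (rule lborel_pair.Fubini'[symmetric, OF vm])
  also have "\<dots> = (\<integral>\<^sup>+y. (v y * (ennreal (y ^ (k + Suc m)) * indicator {0..} y)) * ennreal (1 / Suc (k + m)) \<partial>lborel)"
  proof (rule nn_integral_cong)
    fix y :: real
    have "(\<integral>\<^sup>+x. v y * (ennreal (x ^ (k + m)) * indicator {0..y} x * indicator {0..} y) \<partial>lborel) = v y * ((\<integral>\<^sup>+x. ennreal (x ^ (k + m)) * indicator {0..y} x \<partial>lborel) * indicator {0..} y)"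
      by (subst nn_integral_cmult, measurable) (subst nn_integral_multc, measurable)
    also have "\<dots> = v y * (ennreal (y ^ (k + Suc m)) * indicator {0..} y) * ennreal (1 / Suc (k + m))"
    proof (cases "0 \<le> y")
      case True
      have "ennreal (y ^ Suc (k + m) / Suc (k + m)) = ennreal (y ^ (k + Suc m)) * ennreal (1 / Suc (k + m))"
        using True by (subst ennreal_mult[symmetric]) auto
      then show ?thesis using True by (simp only: nn_integral_monomial_Icc[OF True] indicator_simps) (simp add: mult_ac)
    qed simp
    finally show "(\<integral>\<^sup>+x. v y * (ennreal (x ^ (k + m)) * indicator {0..y} x * indicator {0..} y) \<partial>lborel) =
       v y * (ennreal (y ^ (k + Suc m)) * indicator {0..} y) * ennreal (1 / Suc (k + m))" .
  qed
  also have "\<dots> = (\<integral>\<^sup>+y. v y * (ennreal (y ^ (k + Suc m)) * indicator {0..} y) \<partial>lborel) * ennreal (1 / Suc (k + m))"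
    by (rule nn_integral_multc) measurable
  finally have "(\<integral>\<^sup>+X. ennreal (exp (- c * znorm2 n X) * cmod (X n) ^ (2 * k)) * v (wnorm2 n (Suc (Suc m)) X) \<partial>lebesgue_CN (n + Suc (Suc m))) =
    ennreal ((pi / c) ^ n * pi ^ Suc m * fact k / fact (k + m)) * (ennreal pi * ((\<integral>\<^sup>+y. v y * (ennreal (y ^ (k + Suc m)) * indicator {0..} y) \<partial>lborel) * ennreal (1 / Suc (k + m))))" .
  also have "\<dots> = (ennreal ((pi / c) ^ n * pi ^ Suc m * fact k / fact (k + m)) * ennreal pi * ennreal (1 / Suc (k + m))) * (\<integral>\<^sup>+y. v y * (ennreal (y ^ (k + Suc m)) * indicator {0..} y) \<partial>lborel)"
    by (simp only: mult_ac)
  also have "ennreal ((pi / c) ^ n * pi ^ Suc m * fact k / fact (k + m)) * ennreal pi * ennreal (1 / Suc (k + m)) = ennreal ((pi / c) ^ n * pi ^ Suc m * fact k / fact (k + m) * pi * (1 / Suc (k + m)))"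
    using c by (simp only: ennreal_mult[symmetric] divide_nonneg_nonneg mult_nonneg_nonneg pi_ge_zero zero_le_power fact_ge_zero less_imp_le of_nat_0_le_iff zero_le_one)
  also have "(pi / c) ^ n * pi ^ Suc m * fact k / fact (k + m) * pi * (1 / Suc (k + m)) = (pi / c) ^ n * pi ^ Suc (Suc m) * fact k / fact (k + Suc m)"
    by (simp add: mult_ac)
  finally show ?case .
qed

lemma nn_integral_inverse_halfopen:
  "(\<integral>\<^sup>+x. ennreal (1 / (1 - x)) * indicator {1/2..<1} x \<partial>lborel) = \<infinity>"
proof -
  have "ennreal (real i) \<le> (\<integral>\<^sup>+x. ennreal (1 / (1 - x)) * indicator {1/2..<1} x \<partial>lborel)" for i :: nat
  proof -
    \<comment> \<open>Chosen so that the primitive - ln (1 - x) grows by exactly i between 1/2 and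
      b.\<close>
    define b where "b = 1 - exp (- real i) / 2"
    have b: "1 / 2 \<le> b" "b < 1" by (simp_all add: b_def)
    define f where "f = (\<lambda>x :: real. if x < 1 then 1 / (1 - x) else 0)"
    have [measurable]: "f \<in> borel_measurable borel" unfolding f_def by measurable
    have "(\<integral>\<^sup>+x. ennreal (f x) * indicator {1/2..b} x \<partial>lborel) = ennreal (- ln (1 - b) - (- ln (1 - 1/2)))"
      by (rule nn_integral_FTC_Icc) (use b in \<open>auto simp: f_def intro!: derivative_eq_intros\<close>)
    also have "- ln (1 - b) - (- ln (1 - 1/2)) = real i" by (simp add: b_def ln_div)
    finally have "ennreal (real i) = (\<integral>\<^sup>+x. ennreal (f x) * indicator {1/2..b} x \<partial>lborel)" ..
    also have "\<dots> \<le> (\<integral>\<^sup>+x. ennreal (1 / (1 - x)) * indicator {1/2..<1} x \<partial>lborel)"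
      by (rule nn_integral_mono) (use b in \<open>auto simp: f_def indicator_def\<close>)
    finally show ?thesis .
  qed
  note le = this
  show ?thesis
  proof (rule ccontr)
    assume "\<not> ?thesis"
    then obtain i where "(\<integral>\<^sup>+x. ennreal (1 / (1 - x)) * indicator {1/2..<1} x \<partial>lborel) < of_nat i"
      using ennreal_Ex_less_of_nat less_top by fastforce
    then show False using le[of i] by (simp add: ennreal_of_nat_eq_real_of_nat)
  qed
qed

section \<open>Moments as sums of Beta values\<close>

context hartogs
begin

definition "\<beta> = \<alpha> - real N"
definition "w0 \<sigma> = (1 - \<sigma>) powr \<alpha> * (\<nu> + 1 / (1 - \<sigma>)) ^ n / (1 - \<sigma>) ^ (m + 1)"

lemma kappa_w0: "\<kappa> \<sigma> = (if 0 \<le> \<sigma> \<and> \<sigma> < 1 then \<mu> ^ n / pi ^ N * w0 \<sigma> else 0)"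
proof (cases "0 \<le> \<sigma> \<and> \<sigma> < 1")
  case True
  then show ?thesis unfolding \<kappa>_def w0_def if_P[OF True] by (simp add: power_mult_distrib mult_ac)
qed (auto simp: \<kappa>_def)

lemma w0_nonneg:
  assumes "0 \<le> x" "x < 1" shows "0 \<le> w0 x"
proof -
  have "0 < \<mu> ^ n / pi ^ N * w0 x" using kappa_pos[OF assms] assms by (simp only: kappa_w0 simp_thms if_True)
  moreover have "0 < \<mu> ^ n / pi ^ N" using \<mu>0 by simp
  ultimately show ?thesis by (rule less_imp_le[OF zero_less_mult_pos])
qed

lemma measurable_w0 [measurable]: "w0 \<in> borel_measurable borel"
  unfolding w0_def by measurable

abbreviation "w0_int k \<equiv> (\<integral>\<^sup>+x. ennreal (w0 x * x ^ (k + (m - 1))) * indicator {0..<1} x \<partial>lborel)"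

text \<open>Scaling w by e^(- \<mu>|z|^2 / 2) turns s into the squared norm of w, so the integral
  splits into a Gaussian in z and a radial integral in w. Exponent m - a from the weight, - k from
  the monomial and - m from the Jacobian leave - (a+k); the powers of \<mu> and pi then
  cancel.\<close>

lemma moment_nn:
  "(\<integral>\<^sup>+X. ennreal (cmod (X n) ^ (2 * k)) \<partial>M) =
    ennreal (fact k / fact (k + (m - 1)) / (a + real k) ^ n) * w0_int k"
proof -
  define c where "c = (a + real k) * \<mu>"
  have c: "c > 0" using a0 \<mu>0 by (simp add: c_def add_pos_nonneg)
  define e where "e = (\<lambda>X. complex_of_real (exp (- \<mu> * znorm2 n X / 2)))"
  have e2: "(cmod (e X))\<^sup>2 = exp (- \<mu> * znorm2 n X)" for X
    by (simp add: e_def power2_eq_square exp_add[symmetric])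
  have em: "e \<in> borel_measurable \<Lambda>" unfolding e_def by measurable
  define F where "F = (\<lambda>X. ennreal (V X) * ennreal (cmod (X n) ^ (2 * k)))"
  have xm: "(\<lambda>X. X n) \<in> borel_measurable \<Lambda>" using n_less_N by simp
  have gm: "(\<lambda>X. ennreal (cmod (X n) ^ (2 * k))) \<in> borel_measurable \<Lambda>" using xm by measurable
  have F: "F \<in> borel_measurable \<Lambda>" unfolding F_def using xm by measurable
  have eq: "F (scale_w n m e X) * ennreal (cmod (e X) ^ (2 * m)) = ennreal (exp (- c * znorm2 n X) * cmod (X n) ^ (2 * k)) * ennreal (\<kappa> (wnorm2 n m X))" for X
  proof -
    have z: "znorm2 n (scale_w n m e X) = znorm2 n X" by (simp add: znorm2_def scale_w_def)
    have w: "wnorm2 n m (scale_w n m e X) = exp (- \<mu> * znorm2 n X) * wnorm2 n m X"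
      by (simp add: wnorm2_def scale_w_def norm_mult power_mult_distrib e2 sum_distrib_left)
    have s: "s (scale_w n m e X) = wnorm2 n m X"
    proof -
      have "exp (- \<mu> * znorm2 n X) * exp (\<mu> * znorm2 n X) = 1" by (simp flip: exp_add)
      then show ?thesis unfolding s_def z w by (simp add: mult_ac)
    qed
    have xn: "cmod (scale_w n m e X n) ^ (2 * k) = exp (- \<mu> * znorm2 n X) ^ k * cmod (X n) ^ (2 * k)"
      using m1 by (simp add: scale_w_def norm_mult power_mult_distrib power_mult e2)
    have em: "cmod (e X) ^ (2 * m) = exp (- \<mu> * znorm2 n X) ^ m" by (simp add: power_mult e2)
    have "exp ((real m - a) * \<mu> * znorm2 n X) * exp (- \<mu> * znorm2 n X) ^ k * exp (- \<mu> * znorm2 n X) ^ m = exp (- c * znorm2 n X)"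
      by (simp add: exp_of_nat_mult[symmetric] exp_add[symmetric] c_def algebra_simps)
    then have "V (scale_w n m e X) * cmod (scale_w n m e X n) ^ (2 * k) * cmod (e X) ^ (2 * m) = exp (- c * znorm2 n X) * cmod (X n) ^ (2 * k) * \<kappa> (wnorm2 n m X)"
      unfolding V_def z s xn em by (simp add: mult_ac)
    then show ?thesis by (simp add: F_def ennreal_mult[symmetric] V_nonneg kappa_nonneg)
  qed
  have km: "(\<lambda>x. ennreal (\<kappa> x)) \<in> borel_measurable borel" using measurable_kappa by measurable
  have m': "Suc (m - 1) = m" using m1 by simp
  have "(\<integral>\<^sup>+X. ennreal (cmod (X n) ^ (2 * k)) \<partial>M) = (\<integral>\<^sup>+X. F X \<partial>\<Lambda>)"
    unfolding F_def by (rule M_nn_integral[OF gm])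
  also have "\<dots> = (\<integral>\<^sup>+X. F (scale_w n m e X) * ennreal (cmod (e X) ^ (2 * m)) \<partial>\<Lambda>)"
    by (rule nn_integral_scale_w[symmetric, OF _ em _ _ F]) (auto simp: e_def znorm2_fun_upd)
  also have "\<dots> = ennreal ((pi / c) ^ n * pi ^ m * fact k / fact (k + (m - 1))) * (\<integral>\<^sup>+x. ennreal (\<kappa> x) * (ennreal (x ^ (k + (m - 1))) * indicator {0..} x) \<partial>lborel)"
    unfolding eq using nn_integral_radial[OF c km, of n "m - 1" k] unfolding m' .
  also have "(\<integral>\<^sup>+x. ennreal (\<kappa> x) * (ennreal (x ^ (k + (m - 1))) * indicator {0..} x) \<partial>lborel) =
    (\<integral>\<^sup>+x. ennreal (\<mu> ^ n / pi ^ N) * (ennreal (w0 x * x ^ (k + (m - 1))) * indicator {0..<1} x) \<partial>lborel)"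
  proof (rule nn_integral_cong)
    fix x :: real
    have A: "\<mu> ^ n / pi ^ N \<ge> 0" using \<mu>0 by simp
    show "ennreal (\<kappa> x) * (ennreal (x ^ (k + (m - 1))) * indicator {0..} x) = ennreal (\<mu> ^ n / pi ^ N) * (ennreal (w0 x * x ^ (k + (m - 1))) * indicator {0..<1} x)"
    proof (cases "0 \<le> x \<and> x < 1")
      case True
      then have "ennreal (\<kappa> x) * ennreal (x ^ (k + (m - 1))) = ennreal (\<mu> ^ n / pi ^ N) * ennreal (w0 x * x ^ (k + (m - 1)))"
        unfolding kappa_w0 if_P[OF True] ennreal_mult[OF A w0_nonneg[OF conjunct1[OF True] conjunct2[OF True]]]
        by (subst ennreal_mult) (auto simp: w0_nonneg mult.assoc)
      then show ?thesis using True by simp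
    qed (auto simp: \<kappa>_def indicator_def)
  qed
  also have "\<dots> = ennreal (\<mu> ^ n / pi ^ N) * w0_int k"
    by (rule nn_integral_cmult) measurable
  also have "ennreal ((pi / c) ^ n * pi ^ m * fact k / fact (k + (m - 1))) * (ennreal (\<mu> ^ n / pi ^ N) * w0_int k) =
    ennreal ((pi / c) ^ n * pi ^ m * fact k / fact (k + (m - 1)) * (\<mu> ^ n / pi ^ N)) * w0_int k"
  proof -
    have "ennreal ((pi / c) ^ n * pi ^ m * fact k / fact (k + (m - 1)) * (\<mu> ^ n / pi ^ N)) = ennreal ((pi / c) ^ n * pi ^ m * fact k / fact (k + (m - 1))) * ennreal (\<mu> ^ n / pi ^ N)"
      by (rule ennreal_mult) (use c \<mu>0 in auto)
    then show ?thesis by (simp only: mult.assoc)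
  qed
  also have "(pi / c) ^ n * pi ^ m * fact k / fact (k + (m - 1)) * (\<mu> ^ n / pi ^ N) = fact k / fact (k + (m - 1)) / (a + real k) ^ n"
  proof -
    have "(pi / c) ^ n * pi ^ m * (\<mu> ^ n / pi ^ N) = 1 / (a + real k) ^ n"
      using \<mu>0 by (simp add: c_def power_mult_distrib power_divide power_add)
    then have "((pi / c) ^ n * pi ^ m * (\<mu> ^ n / pi ^ N)) * (fact k / fact (k + (m - 1))) = 1 / (a + real k) ^ n * (fact k / fact (k + (m - 1)))"
      by (rule arg_cong)
    then show ?thesis by (simp add: mult_ac)
  qed
  finally show ?thesis .
qed

text \<open>Taking (1-x)^(-n) out of (\<nu> + 1/(1-x))^n makes the boundary exponent \<alpha> -
  (m+1) - n = \<beta> - 1 visible. It decides integrability at x = 1 and leaves a polynomial in 1 -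
  x.\<close>

lemma w0_factor:
  assumes "0 \<le> x" "x < 1"
  shows "w0 x = (1 - x) powr (\<beta> - 1) * (1 + \<nu> * (1 - x)) ^ n"
proof -
  have x: "1 - x > 0" using assms by simp
  have "(\<nu> + 1 / (1 - x)) ^ n = (1 + \<nu> * (1 - x)) ^ n / (1 - x) ^ n"
  proof -
    have "\<nu> + 1 / (1 - x) = (1 + \<nu> * (1 - x)) / (1 - x)" using x by (simp add: add_divide_distrib)
    then show ?thesis by (simp only: power_divide)
  qed
  then have "w0 x = (1 - x) powr \<alpha> / (1 - x) ^ (N + 1) * (1 + \<nu> * (1 - x)) ^ n"
    by (simp add: w0_def power_add mult_ac)
  also have "(1 - x) powr \<alpha> / (1 - x) ^ (N + 1) = (1 - x) powr (\<beta> - 1)"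
  proof -
    have "\<beta> - 1 = \<alpha> - real (N + 1)" by (simp add: \<beta>_def)
    then have "(1 - x) powr (\<beta> - 1) = (1 - x) powr \<alpha> / (1 - x) powr real (N + 1)" by (simp only: powr_diff)
    then show ?thesis by (simp only: powr_realpow[OF x])
  qed
  finally show ?thesis .
qed

lemma w0_sum:
  assumes "0 \<le> x" "x < 1"
  shows "w0 x = (\<Sum>j\<le>n. real (n choose j) * \<nu> ^ j * (1 - x) powr (\<beta> + real j - 1))"
proof -
  have x: "1 - x > 0" using assms by simp
  have "(1 + \<nu> * (1 - x)) ^ n = (\<nu> * (1 - x) + 1) ^ n" by (simp add: add.commute)
  also have "\<dots> = (\<Sum>j\<le>n. real (n choose j) * (\<nu> * (1 - x)) ^ j)" by (simp add: binomial_ring)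
  finally have "w0 x = (\<Sum>j\<le>n. (1 - x) powr (\<beta> - 1) * (real (n choose j) * (\<nu> * (1 - x)) ^ j))"
    unfolding w0_factor[OF assms] by (simp add: sum_distrib_left)
  also have "\<dots> = (\<Sum>j\<le>n. real (n choose j) * \<nu> ^ j * (1 - x) powr (\<beta> + real j - 1))"
  proof (rule sum.cong[OF refl])
    fix j
    have "(1 - x) powr (\<beta> + real j - 1) = (1 - x) powr (\<beta> - 1) * (1 - x) ^ j"
      using x by (simp add: powr_realpow[symmetric] flip: powr_add) (simp add: algebra_simps)
    then show "(1 - x) powr (\<beta> - 1) * (real (n choose j) * (\<nu> * (1 - x)) ^ j) = real (n choose j) * \<nu> ^ j * (1 - x) powr (\<beta> + real j - 1)"
      by (simp add: power_mult_distrib)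
  qed
  finally show ?thesis .
qed

definition "Bsum k = (\<Sum>j\<le>n. real (n choose j) * \<nu> ^ j * Beta (real (k + m)) (\<beta> + real j))"

lemma nn_integral_w0:
  assumes \<beta>: "\<beta> > 0"
  shows "w0_int k = ennreal (Bsum k)" and "Bsum k \<ge> 0"
proof -
  have km: "real (k + m) > 0" using m1 by simp
  have 1: "((\<lambda>x. \<Sum>j\<le>n. (real (n choose j) * \<nu> ^ j) * (x powr (real (k + m) - 1) * (1 - x) powr (\<beta> + real j - 1))) has_integral Bsum k) {0..1}"
    unfolding Bsum_def
    by (intro has_integral_sum has_integral_mult_right has_integral_Beta_real) (use \<beta> km in \<open>auto simp: add_pos_nonneg\<close>)
  have eq: "(\<Sum>j\<le>n. (real (n choose j) * \<nu> ^ j) * (x powr (real (k + m) - 1) * (1 - x) powr (\<beta> + real j - 1))) = w0 x * x ^ (k + (m - 1))"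
    if "x \<in> {0<..<1}" for x
  proof -
    have "real (k + m) - 1 = real (k + (m - 1))" using m1 by simp
    then have "x powr (real (k + m) - 1) = x ^ (k + (m - 1))" using that by (simp only: powr_realpow greaterThanLessThan_iff)
    then show ?thesis using that by (simp add: w0_sum sum_distrib_left mult_ac)
  qed
  have 2: "((\<lambda>x. w0 x * x ^ (k + (m - 1))) has_integral Bsum k) {0<..<1}"
    using 1 unfolding has_integral_Icc_iff_Ioo by (rule has_integral_eq[rotated]) (rule eq)
  have nn: "0 \<le> w0 x * x ^ (k + (m - 1))" if "x \<in> {0<..<1}" for x using that w0_nonneg[of x] by simp
  show "Bsum k \<ge> 0" using has_integral_nonneg[OF 2 nn] .
  have "w0_int k = (\<integral>\<^sup>+x. ennreal (w0 x * x ^ (k + (m - 1))) * indicator {0<..<1} x \<partial>lborel)"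
  proof (rule nn_integral_cong_AE)
    show "AE x in lborel. ennreal (w0 x * x ^ (k + (m - 1))) * indicator {0..<1} x = ennreal (w0 x * x ^ (k + (m - 1))) * indicator {0<..<1} x"
      using AE_lborel_singleton[of 0] by eventually_elim (auto simp: indicator_def)
  qed
  also have "\<dots> = ennreal (Bsum k)" by (rule nn_integral_has_integral_lebesgue'[OF nn 2])
  finally show "w0_int k = ennreal (Bsum k)" .
qed

lemma nn_integral_w0_infinite:
  assumes \<beta>: "\<beta> \<le> 0"
  shows "w0_int k = \<infinity>"
proof -
  \<comment> \<open>A lower bound on [1/2, 1) for the factors other than the power of 1 - x: 1 +
    \<nu>(1-x) lies between 1 and 1 + \<nu>, both positive. For \<beta> <= 0 the remaining factor is
    at least 1/(1-x), whose integral diverges.\<close>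
  define c where "c = min 1 (1 + \<nu>) ^ n * (1 / 2) ^ (k + (m - 1))"
  have c: "c > 0" using \<nu>1 by (simp add: c_def)
  have "(\<integral>\<^sup>+x. ennreal c * (ennreal (1 / (1 - x)) * indicator {1/2..<1} x) \<partial>lborel) \<le> w0_int k"
  proof (rule nn_integral_mono)
    fix x :: real
    show "ennreal c * (ennreal (1 / (1 - x)) * indicator {1/2..<1} x) \<le> ennreal (w0 x * x ^ (k + (m - 1))) * indicator {0..<1} x"
    proof (cases "x \<in> {1/2..<1}")
      case True
      then have x: "0 \<le> x" "x < 1" "1 / 2 \<le> x" by auto
      have "min 1 (1 + \<nu>) \<le> 1 + \<nu> * (1 - x)"
      proof (cases "\<nu> \<ge> 0")
        case False
        then have "\<nu> * x \<le> 0" using x by (simp add: mult_nonpos_nonneg)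
        then show ?thesis by (simp add: algebra_simps)
      qed (use x in simp)
      then have 1: "min 1 (1 + \<nu>) ^ n \<le> (1 + \<nu> * (1 - x)) ^ n" using \<nu>1 by (intro power_mono) auto
      have "(1 - x) powr (- 1) \<le> (1 - x) powr (\<beta> - 1)" using x \<beta> by (intro powr_mono') auto
      then have 2: "1 / (1 - x) \<le> (1 - x) powr (\<beta> - 1)" using x by (simp add: powr_minus_divide)
      have "(1 / (1 - x)) * min 1 (1 + \<nu>) ^ n * (1 / 2) ^ (k + (m - 1)) \<le> (1 - x) powr (\<beta> - 1) * (1 + \<nu> * (1 - x)) ^ n * x ^ (k + (m - 1))"
      proof (intro mult_mono)
        show "(1 / 2) ^ (k + (m - 1)) \<le> x ^ (k + (m - 1))" using x by (intro power_mono) auto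
        have "0 \<le> min 1 (1 + \<nu>) ^ n" using \<nu>1 by simp
        then have p: "0 \<le> (1 + \<nu> * (1 - x)) ^ n" using 1 by (rule order_trans)
        then show "0 \<le> (1 - x) powr (\<beta> - 1) * (1 + \<nu> * (1 - x)) ^ n" by simp
      qed (use 1 2 \<nu>1 x in auto)
      then have "c * (1 / (1 - x)) \<le> w0 x * x ^ (k + (m - 1))"
        unfolding w0_factor[OF x(1,2)] c_def by (simp add: mult_ac)
      then show ?thesis using True c x by (simp add: ennreal_mult[symmetric] ennreal_leI)
    qed simp
  qed
  moreover have "(\<integral>\<^sup>+x. ennreal c * (ennreal (1 / (1 - x)) * indicator {1/2..<1} x) \<partial>lborel) = \<infinity>"
    by (subst nn_integral_cmult) (use c in \<open>simp_all add: nn_integral_inverse_halfopen ennreal_mult_top\<close>)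
  ultimately show ?thesis by (simp add: top_unique)
qed

lemma moment_infinite:
  assumes "\<beta> \<le> 0" shows "(\<integral>\<^sup>+X. ennreal (cmod (X n) ^ (2 * k)) \<partial>M) = \<infinity>"
proof -
  have "fact k / fact (k + (m - 1)) / (a + real k) ^ n > 0"
    using a0 by (intro divide_pos_pos zero_less_power) auto
  then have "ennreal (fact k / fact (k + (m - 1)) / (a + real k) ^ n) \<noteq> 0" by (simp only: ennreal_eq_0_iff not_le)
  then show ?thesis unfolding moment_nn nn_integral_w0_infinite[OF assms] infinity_ennreal_def by (simp only: ennreal_mult_top if_False)
qed

lemma moment_finite:
  assumes "\<beta> > 0"
  shows "(\<integral>\<^sup>+X. ennreal (cmod (X n) ^ (2 * k)) \<partial>M) = ennreal (fact k / fact (k + (m - 1)) / (a + real k) ^ n * Bsum k)"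
  unfolding moment_nn nn_integral_w0(1)[OF assms]
  by (rule ennreal_mult[symmetric]) (use a0 nn_integral_w0(2)[OF assms, of k] in auto)

lemma hartogs_finiteI:
  assumes "\<beta> > 0" shows "hartogs_finite n m \<mu> \<nu> \<alpha>"
proof
  show "emeasure M (space M) < \<infinity>" using moment_finite[OF assms, of 0] by simp
qed

end

section \<open>The polynomial identity\<close>

text \<open>The polynomial (t-1)(t-2)...(t-d), which equals \<Gamma>(t)/\<Gamma>(t-d) for t > d.
  Only its three leading coefficients matter below.\<close>

definition qpoly :: "nat \<Rightarrow> real poly" where
  "qpoly d = (\<Prod>l=1..d. [:- real l, 1:])"

lemma qpoly_0: "qpoly 0 = 1" by (simp add: qpoly_def)

lemma qpoly_Suc: "qpoly (Suc d) = qpoly d * [:- real (Suc d), 1:]"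
  by (simp add: qpoly_def prod.atLeast_Suc_atMost_Suc_shift)

lemma coeff_qpoly_Suc:
  "coeff (qpoly (Suc d)) 0 = - real (Suc d) * coeff (qpoly d) 0"
  "coeff (qpoly (Suc d)) (Suc i) = coeff (qpoly d) i - real (Suc d) * coeff (qpoly d) (Suc i)"
  by (simp_all add: qpoly_Suc mult_pCons_right algebra_simps)

lemma coeff_qpoly_gt: "i > d \<Longrightarrow> coeff (qpoly d) i = 0"
proof (induction d arbitrary: i)
  case 0 then show ?case by (simp add: qpoly_0)
next
  case (Suc d) then show ?case by (cases i) (auto simp: coeff_qpoly_Suc)
qed

lemma coeff_qpoly_lead: "coeff (qpoly d) d = 1"
  by (induction d) (simp_all add: qpoly_0 coeff_qpoly_Suc coeff_qpoly_gt)

lemma coeff_qpoly_second: "coeff (qpoly (Suc d)) d = - (real (Suc d) * real (d + 2)) / 2"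
proof (induction d)
  case 0 then show ?case by (simp add: coeff_qpoly_Suc coeff_qpoly_lead)
next
  case (Suc d)
  have "coeff (qpoly (Suc (Suc d))) (Suc d) = coeff (qpoly (Suc d)) d - real (Suc (Suc d)) * coeff (qpoly (Suc d)) (Suc d)"
    by (rule coeff_qpoly_Suc(2))
  then show ?case unfolding Suc.IH coeff_qpoly_lead by (simp add: field_simps)
qed

text \<open>This is the second elementary symmetric function of 1, ..., d+2, obtained from the
  recursion for the coefficients.\<close>

lemma coeff_qpoly_third:
  "coeff (qpoly (Suc (Suc d))) d = real (d + 1) * real (d + 2) * real (d + 3) * (3 * real d + 8) / 24"
proof (induction d)
  case 0 then show ?case using coeff_qpoly_second[of 0] by (simp add: coeff_qpoly_Suc(1)[of "Suc 0"])
next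
  case (Suc d)
  have "coeff (qpoly (Suc (Suc (Suc d)))) (Suc d) = coeff (qpoly (Suc (Suc d))) d - real (Suc (Suc (Suc d))) * coeff (qpoly (Suc (Suc d))) (Suc d)"
    by (rule coeff_qpoly_Suc(2))
  then show ?case unfolding Suc.IH coeff_qpoly_second by (simp add: field_simps)
qed

lemma poly_qpoly_Gamma:
  assumes "x - real d > 0"
  shows "Gamma x = poly (qpoly d) x * Gamma (x - real d)"
  using assms
proof (induction d)
  case 0 then show ?case by (simp add: qpoly_0)
next
  case (Suc d)
  have "Gamma (x - real (Suc d) + 1) = (x - real (Suc d)) * Gamma (x - real (Suc d))"
    using Suc.prems by (intro Gamma_plus1) (auto elim!: nonpos_Ints_cases)
  moreover have "x - real (Suc d) + 1 = x - real d" by simp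
  ultimately have "Gamma x = poly (qpoly d) x * ((x - real (Suc d)) * Gamma (x - real (Suc d)))" using Suc by simp
  moreover have "poly (qpoly (Suc d)) x = poly (qpoly d) x * (x - real (Suc d))"
    by (simp add: qpoly_Suc algebra_simps)
  ultimately show ?case by (simp only: mult.assoc)
qed

text \<open>The variable s is nonnegative, so the two series are compared on [0,1) only. A nonzero
  difference would have an isolated zero at 0, contradicting its vanishing at small positive
  x.\<close>

lemma power_series_eq_on_right:
  fixes p q :: "nat \<Rightarrow> real"
  assumes p: "\<And>x. \<bar>x\<bar> < 1 \<Longrightarrow> summable (\<lambda>k. p k * x ^ k)" and q: "\<And>x. \<bar>x\<bar> < 1 \<Longrightarrow> summable (\<lambda>k. q k * x ^ k)"
    and eq: "\<And>x. 0 \<le> x \<Longrightarrow> x < 1 \<Longrightarrow> (\<Sum>k. p k * x ^ k) = (\<Sum>k. q k * x ^ k)"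
  shows "p k = q k"
proof (rule ccontr)
  assume k: "p k \<noteq> q k"
  define d where "d = (\<lambda>k. p k - q k)"
  define f where "f = (\<lambda>x. \<Sum>k. d k * x ^ k)"
  have ds: "(\<lambda>k. d k * x ^ k) sums ((\<Sum>k. p k * x ^ k) - (\<Sum>k. q k * x ^ k))" if "\<bar>x\<bar> < 1" for x
    unfolding d_def left_diff_distrib using p q that by (intro sums_diff summable_sums)
  then have fs: "(\<lambda>k. d k * x ^ k) sums f x" if "\<bar>x\<bar> < 1" for x
    using that unfolding f_def by (metis sums_unique)
  have f0: "f x = 0" if "0 \<le> x" "x < 1" for x
    using ds[of x] fs[of x] that eq[OF that] sums_unique2 by force
  have "f 0 = d 0" unfolding f_def by simp
  then have "d 0 = 0" using f0[of 0] by simp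
  then have "p 0 = q 0" by (simp add: d_def)
  then have "k \<noteq> 0" using k by (intro notI) simp
  moreover have "d k \<noteq> 0" using k by (simp add: d_def)
  ultimately obtain r where r: "r > 0" "\<And>z. z \<in> cball 0 r - {0} \<Longrightarrow> f z \<noteq> 0"
    using powser_0_nonzero[of 1 0 d f k] fs f0[of 0] by auto
  have "f (min r (1 / 2)) \<noteq> 0" using r by (intro r(2)) auto
  then show False using f0[of "min r (1 / 2)"] r by auto
qed

section \<open>From constancy of the \<epsilon>-function to an identity of polynomials\<close>

context hartogs
begin

text \<open>The left side of the polynomial identity multiplied by \<Gamma>(\<beta>), since
  \<Gamma>(\<beta>+j) is \<Gamma>(\<beta>) times the Pochhammer symbol of \<beta>.\<close>

definition "Ppoly = (\<Sum>j\<le>n. Polynomial.smult (real (n choose j) * \<nu> ^ j * Gamma (\<beta> + real j)) (qpoly (n - j)))"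

text \<open>The denominator of the j-th Beta value is \<Gamma> at k + m + \<beta> + j = \<alpha> + k
  - (n-j). Multiplying by \<Gamma>(\<alpha>+k) clears it and leaves the product given by
  \<open>qpoly (n - j)\<close>.\<close>

lemma Bsum_Ppoly:
  assumes \<beta>: "\<beta> > 0"
  shows "Bsum k * Gamma (\<alpha> + real k) = fact (k + (m - 1)) * poly Ppoly (\<alpha> + real k)"
proof -
  have g: "Gamma (real (k + m)) = fact (k + (m - 1))"
    using m1 Gamma_fact[of "k + (m - 1)", where ?'a = real] by (simp add: of_nat_diff algebra_simps)
  have "Bsum k * Gamma (\<alpha> + real k) = (\<Sum>j\<le>n. fact (k + (m - 1)) * (real (n choose j) * \<nu> ^ j * Gamma (\<beta> + real j) * poly (qpoly (n - j)) (\<alpha> + real k)))"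
    unfolding Bsum_def sum_distrib_right
  proof (rule sum.cong[OF refl])
    fix j assume j: "j \<in> {..n}"
    have e: "\<alpha> + real k - real (n - j) = real (k + m) + (\<beta> + real j)" using j by (simp add: \<beta>_def of_nat_diff)
    have p: "real (k + m) + (\<beta> + real j) > 0" using \<beta> by simp
    have "Gamma (\<alpha> + real k) = poly (qpoly (n - j)) (\<alpha> + real k) * Gamma (real (k + m) + (\<beta> + real j))"
      using poly_qpoly_Gamma[of "\<alpha> + real k" "n - j"] p unfolding e by simp
    moreover have "Gamma (real (k + m) + (\<beta> + real j)) > 0" using p by (rule Gamma_real_pos)
    ultimately show "real (n choose j) * \<nu> ^ j * Beta (real (k + m)) (\<beta> + real j) * Gamma (\<alpha> + real k) =
      fact (k + (m - 1)) * (real (n choose j) * \<nu> ^ j * Gamma (\<beta> + real j) * poly (qpoly (n - j)) (\<alpha> + real k))"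
      unfolding Beta_def g by simp
  qed
  then show ?thesis by (simp add: Ppoly_def poly_sum sum_distrib_left)
qed

text \<open>The binomial series of (1-x)^(-\<alpha>) has coefficients (\<alpha>)_k / k!, so the
  \<epsilon>-function is the constant c exactly when 1/M_k = c (\<alpha>)_k / k! for all k.
  Inserting M_k cancels the factorials and \<Gamma>(\<alpha>+k).\<close>

lemma balanced_iff_poly:
  assumes \<beta>: "\<beta> > 0"
  shows "balanced n m \<mu> \<nu> \<alpha> \<longleftrightarrow> (\<exists>c>0. \<forall>k. c * poly Ppoly (\<alpha> + real k) = Gamma \<alpha> * (a + real k) ^ n)"
proof -
  interpret hartogs_finite n m \<mu> \<nu> \<alpha> by (rule hartogs_finiteI[OF \<beta>])
  have Ga: "Gamma \<alpha> > 0" using \<alpha>0 by (rule Gamma_real_pos)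
  have Gk: "Gamma (\<alpha> + real k) > 0" for k using \<alpha>0 by (intro Gamma_real_pos) simp
  have ak: "a + real k > 0" for k using a0 by simp
  have em: "ennreal (moment k) = ennreal (fact k / fact (k + (m - 1)) / (a + real k) ^ n * Bsum k)" for k
    using nn_moment[of k] moment_finite[OF \<beta>, of k] by simp
  have moment: "moment k = fact k / fact (k + (m - 1)) / (a + real k) ^ n * Bsum k" for k
  proof -
    have "0 \<le> fact k / fact (k + (m - 1)) / (a + real k) ^ n * Bsum k"
      using ak[of k] nn_integral_w0(2)[OF \<beta>, of k] by simp
    then show ?thesis using em[of k] moment_pos[of k] by (simp only: ennreal_inj less_imp_le)
  qed
  have moment_P: "moment k * (a + real k) ^ n * Gamma (\<alpha> + real k) = fact k * poly Ppoly (\<alpha> + real k)" for k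
  proof -
    have "moment k * (a + real k) ^ n = fact k / fact (k + (m - 1)) * Bsum k" using ak[of k] by (simp add: moment)
    then have "moment k * (a + real k) ^ n * Gamma (\<alpha> + real k) = fact k / fact (k + (m - 1)) * (Bsum k * Gamma (\<alpha> + real k))" by simp
    then show ?thesis unfolding Bsum_Ppoly[OF \<beta>] by simp
  qed
  have poch: "pochhammer \<alpha> k = Gamma (\<alpha> + real k) / Gamma \<alpha>" for k
    using \<alpha>0 by (intro pochhammer_Gamma) (auto elim!: nonpos_Ints_cases)
  have iff1: "1 / moment k = c * (pochhammer \<alpha> k / fact k) \<longleftrightarrow> c * poly Ppoly (\<alpha> + real k) = Gamma \<alpha> * (a + real k) ^ n" for c k
  proof -
    have "1 / moment k = c * (pochhammer \<alpha> k / fact k) \<longleftrightarrow> Gamma \<alpha> * fact k = c * (moment k * Gamma (\<alpha> + real k))"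
      unfolding poch using moment_pos[of k] Ga by (simp add: field_simps)
    also have "\<dots> \<longleftrightarrow> Gamma \<alpha> * fact k * (a + real k) ^ n = c * (moment k * Gamma (\<alpha> + real k)) * (a + real k) ^ n"
      using ak[of k] by simp
    also have "c * (moment k * Gamma (\<alpha> + real k)) * (a + real k) ^ n = c * (moment k * (a + real k) ^ n * Gamma (\<alpha> + real k))" by (simp add: mult_ac)
    also have "\<dots> = (c * poly Ppoly (\<alpha> + real k)) * fact k" unfolding moment_P by (simp add: mult_ac)
    also have "Gamma \<alpha> * fact k * (a + real k) ^ n = (Gamma \<alpha> * (a + real k) ^ n) * fact k" by (simp add: mult_ac)
    also have "(Gamma \<alpha> * (a + real k) ^ n) * fact k = (c * poly Ppoly (\<alpha> + real k)) * fact k \<longleftrightarrow> c * poly Ppoly (\<alpha> + real k) = Gamma \<alpha> * (a + real k) ^ n"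
      by auto
    finally show ?thesis .
  qed
  have binom: "(\<lambda>k. (pochhammer \<alpha> k / fact k) * x ^ k) sums (1 - x) powr (- \<alpha>)" if "\<bar>x\<bar> < 1" for x
  proof -
    have "(\<lambda>k. ((- \<alpha>) gchoose k) * (- x) ^ k) sums (1 + (- x)) powr (- \<alpha>)"
      using that by (intro gen_binomial_real) simp
    moreover have "((- \<alpha>) gchoose k) * (- x) ^ k = (pochhammer \<alpha> k / fact k) * x ^ k" for k
    proof -
      have "(- 1) ^ k * ((- x) ^ k) = x ^ k" by (simp flip: power_mult_distrib)
      then show ?thesis by (simp add: gbinomial_pochhammer mult_ac)
    qed
    ultimately show ?thesis by simp
  qed
  have ks: "summable (\<lambda>k. (1 / moment k) * x ^ k)" if "\<bar>x\<bar> < 1" for x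
  proof (rule summable_norm_cancel)
    have "summable (\<lambda>k. \<bar>x\<bar> ^ k / moment k)" by (rule summable_kernel) (use that in auto)
    then show "summable (\<lambda>k. norm ((1 / moment k) * x ^ k))"
      using moment_pos by (simp add: abs_mult power_abs less_imp_le)
  qed
  have kr: "kern_real x = (\<Sum>k. (1 / moment k) * x ^ k)" for x by (simp add: kern_real_def)
  have iff2: "(\<forall>x. 0 \<le> x \<and> x < 1 \<longrightarrow> (1 - x) powr \<alpha> * kern_real x = c) \<longleftrightarrow> (\<forall>k. 1 / moment k = c * (pochhammer \<alpha> k / fact k))" for c
  proof (intro iffI allI)
    fix k assume L: "\<forall>x. 0 \<le> x \<and> x < 1 \<longrightarrow> (1 - x) powr \<alpha> * kern_real x = c"
    have cs: "(\<lambda>k. (c * (pochhammer \<alpha> k / fact k)) * x ^ k) sums (c * (1 - x) powr (- \<alpha>))" if "\<bar>x\<bar> < 1" for x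
      using sums_mult[OF binom[OF that], of c] by (simp add: mult.assoc)
    show "1 / moment k = c * (pochhammer \<alpha> k / fact k)"
    proof (rule power_series_eq_on_right[where p = "\<lambda>k. 1 / moment k" and q = "\<lambda>k. c * (pochhammer \<alpha> k / fact k)"])
      show "summable (\<lambda>k. (c * (pochhammer \<alpha> k / fact k)) * x ^ k)" if "\<bar>x\<bar> < 1" for x using cs[OF that] by (rule sums_summable)
      fix x :: real assume x: "0 \<le> x" "x < 1"
      have "(1 - x) powr \<alpha> * (1 - x) powr (- \<alpha>) = 1" using x by (simp flip: powr_add)
      moreover have "c * (1 - x) powr (- \<alpha>) = kern_real x * ((1 - x) powr \<alpha> * (1 - x) powr (- \<alpha>))"
        using L x by (auto simp: mult_ac)
      ultimately have "kern_real x = c * (1 - x) powr (- \<alpha>)" by simp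
      then show "(\<Sum>k. (1 / moment k) * x ^ k) = (\<Sum>k. (c * (pochhammer \<alpha> k / fact k)) * x ^ k)"
        using cs[of x] x by (simp add: kr sums_iff)
    qed (rule ks)
  next
    fix x assume R: "\<forall>k. 1 / moment k = c * (pochhammer \<alpha> k / fact k)"
    show "0 \<le> x \<and> x < 1 \<longrightarrow> (1 - x) powr \<alpha> * kern_real x = c"
    proof
      assume x: "0 \<le> x \<and> x < 1"
      have "kern_real x = (\<Sum>k. c * ((pochhammer \<alpha> k / fact k) * x ^ k))"
        unfolding kr by (simp only: R[rule_format] mult.assoc)
      also have "\<dots> = c * (1 - x) powr (- \<alpha>)" using x by (intro sums_unique[symmetric] sums_mult binom) auto
      finally have "(1 - x) powr \<alpha> * kern_real x = c * ((1 - x) powr \<alpha> * (1 - x) powr (- \<alpha>))" by simp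
      also have "(1 - x) powr \<alpha> * (1 - x) powr (- \<alpha>) = 1" using x by (simp flip: powr_add)
      finally show "(1 - x) powr \<alpha> * kern_real x = c" by simp
    qed
  qed
  show ?thesis unfolding balanced_iff iff2 iff1 ..
qed

text \<open>The two polynomials agree at the infinitely many points t = \<alpha> + k, where t +
  \<alpha>\<nu> = a + k.\<close>

lemma Ppoly_power:
  assumes c: "c > 0" and eq: "\<And>k. c * poly Ppoly (\<alpha> + real k) = Gamma \<alpha> * (a + real k) ^ n"
  shows "Polynomial.smult c Ppoly = Polynomial.smult (Gamma \<alpha>) ([:\<alpha> * \<nu>, 1:] ^ n)"
proof -
  let ?d = "Polynomial.smult c Ppoly - Polynomial.smult (Gamma \<alpha>) ([:\<alpha> * \<nu>, 1:] ^ n)"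
  have "poly ?d (\<alpha> + real k) = 0" for k
    using eq[of k] by (simp add: a_def algebra_simps)
  then have "range (\<lambda>k. \<alpha> + real k) \<subseteq> {x. poly ?d x = 0}" by auto
  moreover have "infinite (range (\<lambda>k. \<alpha> + real k))"
    by (rule range_inj_infinite) (simp add: inj_def)
  ultimately have "infinite {x. poly ?d x = 0}" using finite_subset by blast
  then have "?d = 0" using poly_roots_finite by blast
  then show ?thesis by simp
qed

text \<open>\<open>qpoly (n - j)\<close> has degree n - j, so terms with j > n - i drop out. For the
  coefficients used below at most three terms remain.\<close>

lemma coeff_Ppoly:
  "coeff Ppoly i = (\<Sum>j\<le>n - i. real (n choose j) * \<nu> ^ j * Gamma (\<beta> + real j) * coeff (qpoly (n - j)) i)" if "i \<le> n"
proof -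
  have "coeff Ppoly i = (\<Sum>j\<le>n. real (n choose j) * \<nu> ^ j * Gamma (\<beta> + real j) * coeff (qpoly (n - j)) i)"
    by (simp add: Ppoly_def coeff_sum)
  also have "\<dots> = (\<Sum>j\<le>n - i. real (n choose j) * \<nu> ^ j * Gamma (\<beta> + real j) * coeff (qpoly (n - j)) i)"
    by (rule sum.mono_neutral_right) (use that in \<open>auto simp: coeff_qpoly_gt\<close>)
  finally show ?thesis .
qed

lemma poly_condition_imp:
  assumes \<beta>: "\<beta> > 0" and c: "c > 0" and eq: "\<And>k. c * poly Ppoly (\<alpha> + real k) = Gamma \<alpha> * (a + real k) ^ n"
  shows "n = 1 \<and> \<nu> = - 1 / (real m + 1)"
proof -
  define G where "G = Gamma \<beta>"
  have G: "G > 0" unfolding G_def using \<beta> by (rule Gamma_real_pos)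
  have G1: "Gamma (\<beta> + 1) = \<beta> * G" unfolding G_def using \<beta> by (intro Gamma_plus1) (auto elim!: nonpos_Ints_cases)
  have "Gamma ((\<beta> + 1) + 1) = (\<beta> + 1) * Gamma (\<beta> + 1)" using \<beta> by (intro Gamma_plus1) (auto elim!: nonpos_Ints_cases)
  moreover have "\<beta> + 1 + 1 = \<beta> + 2" by simp
  ultimately have G2: "Gamma (\<beta> + 2) = (\<beta> + 1) * \<beta> * G" by (simp only: G1 mult.assoc)
  have co: "c * coeff Ppoly i = Gamma \<alpha> * (real (n choose i) * (\<alpha> * \<nu>) ^ (n - i))" if "i \<le> n" for i
    using that arg_cong[OF Ppoly_power[OF c eq], of "\<lambda>p. coeff p i"] by (simp add: coeff_linear_poly_power)
  \<comment> \<open>The top coefficient fixes c, so that c G can be cancelled from the comparisons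
    of lower coefficients.\<close>
  have lead: "Gamma \<alpha> = c * G" using co[of n] by (simp add: coeff_Ppoly coeff_qpoly_lead G_def)
  obtain d where d: "n = Suc d" using n1 by (cases n) auto
  have dn: "d \<le> n" "n - d = 1" "n - 0 = Suc d" "n - 1 = d" "n choose d = n" "real (Suc d) = real n" "real (d + 2) = real n + 1"
    using d by auto
  have qn: "qpoly n = qpoly (Suc d)" using d by simp
  have "{..1::nat} = {0, 1}" by auto
  then have "coeff Ppoly d = Gamma \<beta> * coeff (qpoly (Suc d)) d + real n * \<nu> * Gamma (\<beta> + 1) * coeff (qpoly d) d"
    using coeff_Ppoly[OF dn(1)] unfolding dn(2) by (simp add: qn dn(4)[unfolded One_nat_def])
  also have "\<dots> = G * (- (real n * (real n + 1)) / 2) + real n * \<nu> * (\<beta> * G)"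
    unfolding coeff_qpoly_second coeff_qpoly_lead G1 G_def[symmetric] dn(6,7) by simp
  finally have cd: "coeff Ppoly d = (real n * G) * (- (real n + 1) / 2 + \<nu> * \<beta>)" by (simp add: field_simps)
  have "c * ((real n * G) * (- (real n + 1) / 2 + \<nu> * \<beta>)) = c * G * (real n * (\<alpha> * \<nu>) ^ 1)"
    using co[OF dn(1)] unfolding lead dn(2,5) cd .
  then have "(c * G * real n) * (- (real n + 1) / 2 + \<nu> * \<beta>) = (c * G * real n) * (\<alpha> * \<nu>)"
    by (simp only: mult_ac power_one_right)
  then have "- (real n + 1) / 2 + \<nu> * \<beta> = \<alpha> * \<nu>" using c G n1 by simp
  \<comment> \<open>Because \<beta> = \<alpha> - (n+m), the terms \<alpha>\<nu> on the two sides
    cancel.\<close>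
  then have nuN: "\<nu> * real N = - (real n + 1) / 2" by (simp add: \<beta>_def algebra_simps)
  show ?thesis
  proof (cases d)
    case 0
    then have "n = 1" using d by simp
    moreover have "\<nu> * (real m + 1) = - 1" using nuN \<open>n = 1\<close> by (simp add: add.commute)
    ultimately show ?thesis by (simp add: field_simps)
  next
    case (Suc e)
    then have n: "n = Suc (Suc e)" using d by simp
    then have en: "e \<le> n" and ne: "real e = real n - 2" by auto
    have neg: "\<nu> < 0"
    proof (rule ccontr)
      assume "\<not> \<nu> < 0"
      then have "\<nu> * real N \<ge> 0" by simp
      then show False using nuN by simp
    qed
    define C where "C = real (n choose 2)"
    have C: "C = real (e + 1) * real (e + 2) / 2"
    proof -
      have "n choose 2 = (e + 1) * (e + 2) div 2" unfolding n choose_two by (simp add: mult.commute)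
      moreover have "2 dvd (e + 1) * (e + 2)" by simp
      ultimately show ?thesis unfolding C_def by (simp only: real_of_nat_div of_nat_mult of_nat_numeral)
    qed
    have C0: "C > 0" unfolding C by simp
    have n2: "n choose e = n choose 2" using binomial_symmetric[of e n] n by simp
    have "coeff Ppoly e = G * (real (e + 1) * real (e + 2) * real (e + 3) * (3 * real e + 8) / 24)
        + real n * \<nu> * (\<beta> * G) * (- (real (e + 1) * real (e + 2)) / 2) + C * \<nu>\<^sup>2 * ((\<beta> + 1) * \<beta> * G)"
    proof -
      have ni: "n - e = 2" "n - 0 = Suc (Suc e)" "n - 1 = Suc e" "n - 2 = e" using n by auto
      have qn: "qpoly n = qpoly (Suc (Suc e))" using n by simp
      have "{..2::nat} = {0, 1, 2}" by auto
      then have "coeff Ppoly e = Gamma \<beta> * coeff (qpoly (Suc (Suc e))) e + real n * \<nu> * Gamma (\<beta> + 1) * coeff (qpoly (Suc e)) e + real (n choose 2) * \<nu>\<^sup>2 * Gamma (\<beta> + 2) * coeff (qpoly e) e"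
        using coeff_Ppoly[OF en] unfolding ni(1) by (simp add: qn ni(3)[unfolded One_nat_def] ni(4))
      then show ?thesis
        unfolding coeff_qpoly_third coeff_qpoly_second coeff_qpoly_lead G1 G2 C_def[symmetric] G_def[symmetric] by simp
    qed
    also have "\<dots> = (G * C) * ((real n + 1) * (3 * real n + 2) / 12 - real n * (\<nu> * \<beta>) + \<nu>\<^sup>2 * \<beta> * (\<beta> + 1))"
      unfolding C of_nat_add ne by (simp add: field_simps power2_eq_square)
    finally have ce: "coeff Ppoly e = (G * C) * ((real n + 1) * (3 * real n + 2) / 12 - real n * (\<nu> * \<beta>) + \<nu>\<^sup>2 * \<beta> * (\<beta> + 1))" .
    have n2': "n - e = 2" using n by simp
    have "c * ((G * C) * ((real n + 1) * (3 * real n + 2) / 12 - real n * (\<nu> * \<beta>) + \<nu>\<^sup>2 * \<beta> * (\<beta> + 1))) = c * G * (C * (\<alpha> * \<nu>)\<^sup>2)"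
      using co[OF en] unfolding lead n2 C_def[symmetric] ce n2' .
    then have "(c * G * C) * ((real n + 1) * (3 * real n + 2) / 12 - real n * (\<nu> * \<beta>) + \<nu>\<^sup>2 * \<beta> * (\<beta> + 1)) = (c * G * C) * (\<alpha> * \<nu>)\<^sup>2"
      by (simp only: mult.assoc)
    then have e1: "(real n + 1) * (3 * real n + 2) / 12 - real n * (\<nu> * \<beta>) + \<nu>\<^sup>2 * \<beta> * (\<beta> + 1) = (\<alpha> * \<nu>)\<^sup>2"
      using c G C0 by simp
    have "\<alpha> * \<nu> = \<nu> * \<beta> + \<nu> * real N" by (simp add: \<beta>_def algebra_simps)
    \<comment> \<open>Squared, this cancels the term \<nu>^2 \<beta>^2 of the third comparison. The
      constants left over are (n+1)^2/4 - (n+1)(3n+2)/12 = (n+1)/12, which forces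
      \<nu>\<beta>(1+\<nu>) to be positive.\<close>
    then have an: "\<alpha> * \<nu> = \<nu> * \<beta> - (real n + 1) / 2" unfolding nuN by (simp add: field_simps)
    have "\<nu> * \<beta> * (1 + \<nu>) = (real n + 1) / 12"
      using e1 unfolding an by (simp add: field_simps power2_eq_square)
    moreover have "\<nu> * \<beta> * (1 + \<nu>) < 0" using neg \<beta> \<nu>1 by (intro mult_neg_pos mult_neg_pos) auto
    ultimately show ?thesis by simp
  qed
qed

text \<open>For n = 1 both sides are linear in t, with roots 1 - \<nu>\<beta> and - \<alpha>\<nu>.
  These coincide because \<nu>(m+1) = -1, and the leading coefficients match for c =
  \<Gamma>(\<alpha>)/\<Gamma>(\<beta>).\<close>

lemma poly_condition_if:
  assumes \<beta>: "\<beta> > 0" and n: "n = 1" and \<nu>: "\<nu> = - 1 / (real m + 1)"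
  shows "\<exists>c>0. \<forall>k. c * poly Ppoly (\<alpha> + real k) = Gamma \<alpha> * (a + real k) ^ n"
proof -
  have G: "Gamma \<beta> > 0" "Gamma \<alpha> > 0" using \<beta> \<alpha>0 by (auto intro: Gamma_real_pos)
  have G1: "Gamma (\<beta> + 1) = \<beta> * Gamma \<beta>" using \<beta> by (intro Gamma_plus1) (auto elim!: nonpos_Ints_cases)
  have "\<nu> * (real m + 1) = - 1" unfolding \<nu> by simp
  moreover have "real N = real m + 1" using n by simp
  then have "\<nu> * \<beta> = \<nu> * \<alpha> - \<nu> * (real m + 1)" unfolding \<beta>_def by (simp only: right_diff_distrib)
  ultimately have nb: "\<nu> * \<beta> = \<alpha> * \<nu> + 1" by (simp add: mult.commute)
  have "poly Ppoly t = Gamma \<beta> * (t - 1 + \<nu> * \<beta>)" for t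
  proof -
    obtain B where B: "\<beta> = B" by simp
    show ?thesis using G1 unfolding Ppoly_def unfolding B unfolding n by (simp add: qpoly_def algebra_simps)
  qed
  then have P: "poly Ppoly (\<alpha> + real k) = Gamma \<beta> * (a + real k)" for k
    unfolding nb by (simp add: a_def algebra_simps)
  show ?thesis
  proof (intro exI conjI allI)
    show "Gamma \<alpha> / Gamma \<beta> > 0" using G by simp
    fix k
    have "(a + real k) ^ n = a + real k" by (simp only: n power_one_right)
    then show "Gamma \<alpha> / Gamma \<beta> * poly Ppoly (\<alpha> + real k) = Gamma \<alpha> * (a + real k) ^ n"
      unfolding P using G by simp
  qed
qed

end

theorem theorem1p1:
  fixes n m :: nat and \<mu> \<nu> \<alpha> :: real
  assumes "n \<ge> 1" and "m \<ge> 1" and "\<mu> > 0" and "\<nu> > -1" and "\<alpha> > 0"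
  shows "balanced n m \<mu> \<nu> \<alpha> \<longleftrightarrow>
           (\<alpha> > real (m + n) \<and> n = 1 \<and> \<nu> = - 1 / (real m + 1))"
proof -
  interpret hartogs n m \<mu> \<nu> \<alpha> using assms by unfold_locales
  show ?thesis
  proof (cases "\<alpha> > real (m + n)")
    case True
    then have \<beta>: "\<beta> > 0" by (simp add: \<beta>_def)
    show ?thesis
      unfolding balanced_iff_poly[OF \<beta>] using True poly_condition_imp[OF \<beta>] poly_condition_if[OF \<beta>] by metis
  next
    case False
    then have "\<beta> \<le> 0" by (simp add: \<beta>_def)
    then show ?thesis using not_balanced[OF moment_infinite] False by simp
  qed
qed

end
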